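(* Let $\mathbb{k}\in\{\mathbb{R},\mathbb{C}\}$. The tensor products $\otimes^1_w$ on $\mathsf{TVS}_w$ and $\otimes^1_m$ on $\mathsf{TVS}_m$ satisfy $$V\otimes^1_wW\cong\bigl(V\otimes_{\mathbb{k}}W,\,\sigma(V\otimes_{\mathbb{k}}W,\,L(V,(W')_\sigma))\bigr),\qquad V,W\in\mathsf{TVS}_w,$$ $$V\otimes^1_mW\cong\bigl(V\otimes_{\mathbb{k}}W,\,\tau(V\otimes_{\mathbb{k}}W,\,L(V,(W')_\tau))\bigr),\qquad V,W\in\mathsf{TVS}_m.$$ Here $L(V,U)$ denotes the space of continuous linear maps $V\to U$, $(W')_\sigma=(W',\sigma(W',W))$, $(W')_\tau=(W',\tau(W',W))$, and the pairings are $\langle v\otimes w,f\rangle=f(v)(w)$.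
   Context: $\mathsf{TVS}$ is the category of Hausdorff locally convex topological $\mathbb{k}$-vector spaces and continuous linear maps; $V'$ is the space of continuous linear functionals on $V$. $\mathsf{chu}$ is the category of triples $(V,W,\langle-,-\rangle)$ with $V,W$ vector spaces and $\langle-,-\rangle: V\otimes_{\mathbb{k}}W\to\mathbb{k}$ linear such that both $V\to W^\star$ and $W\to V^\star$ are injective; a morphism $(V_1,W_1)\to(V_2,W_2)$ is a pair of linear maps $f: V_1\to V_2$, $g: W_2\to W_1$ with $\langle f(v),w\rangle_2=\langle v,g(w)\rangle_1$. The duality is $(V,W,\langle-,-\rangle)^\star=(W,V,\langle-,-\rangle)$ (arguments swapped). The internal hom is $\underline{\mathrm{Hom}}((V_1,W_1),(V_2,W_2))=(\mathrm{Hom}_{\mathsf{chu}}((V_1,W_1),(V_2,W_2)),\,V_1\otimes_{\mathbb{k}}W_2)$ with pairing $\langle(f,g),v\otimes w\rangle=\langle f(v),w\rangle_2$. For a pair $(V,W)\in\mathsf{chu}$, a dual topology on $V$ is a Hausdorff locally convex topology for which $W\to V^\star$ induces an isomorphism of $W$ onto the topological dual; $\sigma(V,W)$ is the weakest and $\tau(V,W)$ the strongest dual topology. $\mathsf{TVS}_w$ (resp. $\mathsf{TVS}_m$) is the full subcategory of $\mathsf{TVS}$ of spaces whose topology is $\sigma(V,V')$ (resp. $\tau(V,V')$). $T_w,T_m$ send $V$ to $(V,V',\mathrm{eval})$; $R:\mathsf{chu}\to\mathsf{TVS}_w$ and $\mathcal{L}:\mathsf{chu}\to\mathsf{TVS}_m$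 send $(V,W)$ to $(V,\sigma(V,W))$ and $(V,\tau(V,W))$. Set $\underline{\mathrm{Hom}}_w(V,W)=R(\underline{\mathrm{Hom}}(T_wV,T_wW))$, $D_w(V)=R((T_wV)^\star)$, $V\otimes^1_wW=D_w(\underline{\mathrm{Hom}}_w(V,D_w(W)))$; and $\underline{\mathrm{Hom}}_m$, $D_m$, $\otimes^1_m$ analogously with $\mathcal{L},T_m$ in place of $R,T_w$. *)

theory Defs
  imports
    "HOL-Analysis.Analysis"
    "HOL-Algebra.Module"
    "HOL-Library.Poly_Mapping"
begin

section \<open>The ground field\<close>

text \<open>The normed fields \<open>\<real>\<close> and \<open>\<complex>\<close>, and nothing else up to isometric isomorphism.\<close>

class real_or_complex = real_normed_field +
  assumes real_or_complex:
    "(\<exists>\<phi> :: 'a \<Rightarrow> real. bij \<phi> \<and> (\<forall>x y. \<phi> (x + y) = \<phi> x + \<phi> y) \<and>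
        (\<forall>x y. \<phi> (x * y) = \<phi> x * \<phi> y) \<and> (\<forall>x. norm (\<phi> x) = norm x)) \<or>
     (\<exists>\<phi> :: 'a \<Rightarrow> complex. bij \<phi> \<and> (\<forall>x y. \<phi> (x + y) = \<phi> x + \<phi> y) \<and>
        (\<forall>x y. \<phi> (x * y) = \<phi> x * \<phi> y) \<and> (\<forall>x. norm (\<phi> x) = norm x))"

instance real :: real_or_complex
  by standard (rule disjI1, rule exI[of _ "\<lambda>x. x"], simp add: bij_def)

instance complex :: real_or_complex
  by standard (rule disjI2, rule exI[of _ "\<lambda>x. x"], simp add: bij_def)

section \<open>Vector spaces with explicit carrier and linear maps\<close>

text \<open>
  \<open>scalars\<close> serves both as the coefficient ring and as the one-dimensional space; in all other
  spaces the components \<open>mult\<close> and \<open>one\<close> of the record type \<open>module\<close> play no role. Maps between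
  carriers are extensional, so that they are determined by their values on the carrier.
\<close>

definition scalars :: "('k::real_or_complex, 'k) module" where
  "scalars = \<lparr>carrier = UNIV, mult = (*), one = 1, zero = 0, add = (+), smult = (*)\<rparr>"

definition vector_spaces :: "('k::real_or_complex, 'v) module set" where
  "vector_spaces = {V. Module.module (scalars :: ('k, 'k) module) V}"

definition linear_maps ::
    "('k::real_or_complex, 'v) module \<Rightarrow> ('k, 'w) module \<Rightarrow> ('v \<Rightarrow> 'w) set" where
  "linear_maps V W = {f \<in> carrier V \<rightarrow>\<^sub>E carrier W.
     (\<forall>x\<in>carrier V. \<forall>y\<in>carrier V. f (x \<oplus>\<^bsub>V\<^esub> y) = f x \<oplus>\<^bsub>W\<^esub> f y) \<and>
     (\<forall>c. \<forall>x\<in>carrier V. f (c \<odot>\<^bsub>V\<^esub> x) = c \<odot>\<^bsub>W\<^esub> f x)}"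

definition pointwise_space ::
    "('v \<Rightarrow> 'w) set \<Rightarrow> ('k::real_or_complex, 'v) module \<Rightarrow> ('k, 'w) module \<Rightarrow> ('k, 'v \<Rightarrow> 'w) module" where
  "pointwise_space S V W = \<lparr>carrier = S, mult = undefined, one = undefined,
     zero = (\<lambda>x\<in>carrier V. \<zero>\<^bsub>W\<^esub>),
     add = (\<lambda>f g. \<lambda>x\<in>carrier V. f x \<oplus>\<^bsub>W\<^esub> g x),
     smult = (\<lambda>c f. \<lambda>x\<in>carrier V. c \<odot>\<^bsub>W\<^esub> f x)\<rparr>"

definition hom_space ::
    "('k::real_or_complex, 'v) module \<Rightarrow> ('k, 'w) module \<Rightarrow> ('k, 'v \<Rightarrow> 'w) module" where
  "hom_space V W = pointwise_space (linear_maps V W) V W"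

definition algebraic_dual :: "('k::real_or_complex, 'v) module \<Rightarrow> ('k, 'v \<Rightarrow> 'k) module" where
  "algebraic_dual V = hom_space V scalars"

section \<open>The algebraic tensor product\<close>

text \<open>
  The quotient of the free vector space on \<open>carrier V \<times> carrier W\<close> by the subspace spanned by
  the bilinearity relations.
\<close>

type_synonym ('k, 'v, 'w) tensor = "(('v \<times> 'w) \<Rightarrow>\<^sub>0 'k) set"

definition free_scale :: "'k::real_or_complex \<Rightarrow> ('b \<Rightarrow>\<^sub>0 'k) \<Rightarrow> ('b \<Rightarrow>\<^sub>0 'k)" where
  "free_scale c p = Poly_Mapping.map (\<lambda>x. c * x) p"

definition tensor_relations ::
    "('k::real_or_complex, 'v) module \<Rightarrow> ('k, 'w) module \<Rightarrow> (('v \<times> 'w) \<Rightarrow>\<^sub>0 'k) set" where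
  "tensor_relations V W =
     {Poly_Mapping.single (v \<oplus>\<^bsub>V\<^esub> v', w) 1 - Poly_Mapping.single (v, w) 1 - Poly_Mapping.single (v', w) 1
        | v v' w. v \<in> carrier V \<and> v' \<in> carrier V \<and> w \<in> carrier W} \<union>
     {Poly_Mapping.single (v, w \<oplus>\<^bsub>W\<^esub> w') 1 - Poly_Mapping.single (v, w) 1 - Poly_Mapping.single (v, w') 1
        | v w w'. v \<in> carrier V \<and> w \<in> carrier W \<and> w' \<in> carrier W} \<union>
     {Poly_Mapping.single (c \<odot>\<^bsub>V\<^esub> v, w) 1 - Poly_Mapping.single (v, w) c
        | c v w. v \<in> carrier V \<and> w \<in> carrier W} \<union>
     {Poly_Mapping.single (v, c \<odot>\<^bsub>W\<^esub> w) 1 - Poly_Mapping.single (v, w) c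
        | c v w. v \<in> carrier V \<and> w \<in> carrier W}"

definition tensor_class ::
    "('k::real_or_complex, 'v) module \<Rightarrow> ('k, 'w) module \<Rightarrow> (('v \<times> 'w) \<Rightarrow>\<^sub>0 'k) \<Rightarrow> ('k, 'v, 'w) tensor" where
  "tensor_class V W p = {q. q - p \<in> Modules.module.span free_scale (tensor_relations V W)}"

definition tensor_space ::
    "('k::real_or_complex, 'v) module \<Rightarrow> ('k, 'w) module \<Rightarrow> ('k, ('k, 'v, 'w) tensor) module" where
  "tensor_space V W = \<lparr>
     carrier = tensor_class V W ` {p. Poly_Mapping.keys p \<subseteq> carrier V \<times> carrier W},
     mult = undefined, one = undefined,
     zero = tensor_class V W 0,
     add = (\<lambda>S T. \<Union>p\<in>S. \<Union>q\<in>T. tensor_class V W (p + q)),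
     smult = (\<lambda>c T. \<Union>p\<in>T. tensor_class V W (free_scale c p))\<rparr>"

definition pure_tensor ::
    "('k::real_or_complex, 'v) module \<Rightarrow> ('k, 'w) module \<Rightarrow> 'v \<Rightarrow> 'w \<Rightarrow> ('k, 'v, 'w) tensor" where
  "pure_tensor V W v w = tensor_class V W (Poly_Mapping.single (v, w) 1)"

text \<open>
  For bilinear \<open>B\<close> this is the linear functional on the tensor product sending the tensor of \<open>v\<close>
  and \<open>w\<close> to \<open>B v w\<close>; all representatives of a class then have the same value
  (lemma \<open>tensor_lift_pure_tensor\<close> below).
\<close>

definition free_lift :: "('v \<Rightarrow> 'w \<Rightarrow> 'k) \<Rightarrow> (('v \<times> 'w) \<Rightarrow>\<^sub>0 'k::real_or_complex) \<Rightarrow> 'k" where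
  "free_lift B p = (\<Sum>(v, w)\<in>Poly_Mapping.keys p. Poly_Mapping.lookup p (v, w) * B v w)"

definition tensor_lift :: "('v \<Rightarrow> 'w \<Rightarrow> 'k) \<Rightarrow> ('k::real_or_complex, 'v, 'w) tensor \<Rightarrow> 'k" where
  "tensor_lift B T = the_elem (free_lift B ` T)"

lemma lookup_free_scale: "Poly_Mapping.lookup (free_scale c p) x = c * Poly_Mapping.lookup p x"
  by (simp add: free_scale_def Poly_Mapping.map.rep_eq when_def)

lemma vector_space_free_scale: "Vector_Spaces.vector_space free_scale"
  by unfold_locales
    (auto intro!: poly_mapping_eqI simp: lookup_free_scale lookup_add algebra_simps)

lemma module_free_scale: "Modules.module free_scale"
  using vector_space_free_scale by (simp add: module_iff_vector_space)

lemma free_lift_superset: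
  assumes "finite S" "Poly_Mapping.keys p \<subseteq> S"
  shows "free_lift B p = (\<Sum>(v, w)\<in>S. Poly_Mapping.lookup p (v, w) * B v w)"
  unfolding free_lift_def
  by (rule sum.mono_neutral_left) (use assms in \<open>auto simp: in_keys_iff\<close>)

lemma free_lift_add: "free_lift B (p + q) = free_lift B p + free_lift B q"
proof -
  let ?S = "Poly_Mapping.keys p \<union> Poly_Mapping.keys q"
  show ?thesis
    by (simp add: free_lift_superset[of ?S] Poly_Mapping.keys_add lookup_add
        case_prod_unfold algebra_simps sum.distrib)
qed

lemma free_lift_scale: "free_lift B (free_scale c p) = c * free_lift B p"
proof -
  have "Poly_Mapping.keys (free_scale c p) \<subseteq> Poly_Mapping.keys p"
    by (auto simp: in_keys_iff lookup_free_scale)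
  then show ?thesis
    by (simp add: free_lift_superset[of "Poly_Mapping.keys p"] lookup_free_scale
        case_prod_unfold sum_distrib_left mult.assoc)
qed

lemma free_lift_diff: "free_lift B (p - q) = free_lift B p - free_lift B q"
  using free_lift_add[of B "p - q" q] by simp

lemma free_lift_single: "free_lift B (Poly_Mapping.single (v, w) c) = c * B v w"
  by (subst free_lift_superset[of "{(v, w)}"]) auto

lemma tensor_lift_tensor_class:
  assumes "\<And>v v' w. v \<in> carrier V \<Longrightarrow> v' \<in> carrier V \<Longrightarrow> w \<in> carrier W \<Longrightarrow>
             B (v \<oplus>\<^bsub>V\<^esub> v') w = B v w + B v' w"
    and "\<And>v w w'. v \<in> carrier V \<Longrightarrow> w \<in> carrier W \<Longrightarrow> w' \<in> carrier W \<Longrightarrow>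
             B v (w \<oplus>\<^bsub>W\<^esub> w') = B v w + B v w'"
    and "\<And>c v w. v \<in> carrier V \<Longrightarrow> w \<in> carrier W \<Longrightarrow> B (c \<odot>\<^bsub>V\<^esub> v) w = c * B v w"
    and "\<And>c v w. v \<in> carrier V \<Longrightarrow> w \<in> carrier W \<Longrightarrow> B v (c \<odot>\<^bsub>W\<^esub> w) = c * B v w"
  shows "tensor_lift B (tensor_class V W p) = free_lift B p"
proof -
  interpret free: Modules.module free_scale
    by (rule module_free_scale)
  have zero: "free_lift B r = 0" if "r \<in> free.span (tensor_relations V W)" for r
    using that
  proof (induction rule: free.span_induct_alt)
    case base
    show ?case by (simp add: free_lift_def)
  next
    case (step c x y)
    from step(1) have "free_lift B x = 0"
      using assms by (auto simp: tensor_relations_def free_lift_diff free_lift_single)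
    then show ?case
      using step by (simp add: free_lift_add free_lift_scale)
  qed
  have "free_lift B ` tensor_class V W p \<subseteq> {free_lift B p}"
    using zero by (force simp: tensor_class_def free_lift_diff)
  moreover have "p \<in> tensor_class V W p"
    by (simp add: tensor_class_def free.span_zero)
  ultimately have "free_lift B ` tensor_class V W p = {free_lift B p}"
    by blast
  then show ?thesis
    by (simp add: tensor_lift_def)
qed

lemma tensor_lift_pure_tensor:
  assumes "\<And>v v' w. v \<in> carrier V \<Longrightarrow> v' \<in> carrier V \<Longrightarrow> w \<in> carrier W \<Longrightarrow>
             B (v \<oplus>\<^bsub>V\<^esub> v') w = B v w + B v' w"
    and "\<And>v w w'. v \<in> carrier V \<Longrightarrow> w \<in> carrier W \<Longrightarrow> w' \<in> carrier W \<Longrightarrow>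
             B v (w \<oplus>\<^bsub>W\<^esub> w') = B v w + B v w'"
    and "\<And>c v w. v \<in> carrier V \<Longrightarrow> w \<in> carrier W \<Longrightarrow> B (c \<odot>\<^bsub>V\<^esub> v) w = c * B v w"
    and "\<And>c v w. v \<in> carrier V \<Longrightarrow> w \<in> carrier W \<Longrightarrow> B v (c \<odot>\<^bsub>W\<^esub> w) = c * B v w"
  shows "tensor_lift B (pure_tensor V W v w) = B v w"
  using tensor_lift_tensor_class[OF assms] by (simp add: pure_tensor_def free_lift_single)

section \<open>Hausdorff locally convex spaces\<close>

record ('k, 'v) tvs =
  vect :: "('k, 'v) module"
  topol :: "'v topology"

definition convex_in :: "('k::real_or_complex, 'v) module \<Rightarrow> 'v set \<Rightarrow> bool" where
  "convex_in V C \<longleftrightarrow> C \<subseteq> carrier V \<and>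
     (\<forall>x\<in>C. \<forall>y\<in>C. \<forall>t. 0 \<le> t \<and> t \<le> 1 \<longrightarrow>
        (of_real (1 - t) \<odot>\<^bsub>V\<^esub> x) \<oplus>\<^bsub>V\<^esub> (of_real t \<odot>\<^bsub>V\<^esub> y) \<in> C)"

definition TVS :: "('k::real_or_complex, 'v) tvs set" where
  "TVS = {A. vect A \<in> vector_spaces \<and> topspace (topol A) = carrier (vect A) \<and>
     continuous_map (prod_topology (topol A) (topol A)) (topol A) (\<lambda>(x, y). x \<oplus>\<^bsub>vect A\<^esub> y) \<and>
     continuous_map (prod_topology euclidean (topol A)) (topol A) (\<lambda>(c, x). c \<odot>\<^bsub>vect A\<^esub> x) \<and>
     Hausdorff_space (topol A) \<and>
     neighbourhood_base_at \<zero>\<^bsub>vect A\<^esub> (convex_in (vect A)) (topol A)}"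

definition scalars_tvs :: "('k::real_or_complex, 'k) tvs" where
  "scalars_tvs = \<lparr>vect = scalars, topol = euclidean\<rparr>"

definition continuous_linear_maps ::
    "('k::real_or_complex, 'v) tvs \<Rightarrow> ('k, 'w) tvs \<Rightarrow> ('v \<Rightarrow> 'w) set" where
  "continuous_linear_maps A B =
     {f \<in> linear_maps (vect A) (vect B). continuous_map (topol A) (topol B) f}"

definition L :: "('k::real_or_complex, 'v) tvs \<Rightarrow> ('k, 'w) tvs \<Rightarrow> ('k, 'v \<Rightarrow> 'w) module" where
  "L A B = pointwise_space (continuous_linear_maps A B) (vect A) (vect B)"

definition topological_dual :: "('k::real_or_complex, 'v) tvs \<Rightarrow> ('k, 'v \<Rightarrow> 'k) module" where
  "topological_dual A = L A scalars_tvs"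

definition tvs_isomorphic :: "('k::real_or_complex, 'v) tvs \<Rightarrow> ('k, 'w) tvs \<Rightarrow> bool"
    (infix \<open>\<cong>\<^sub>T\<^sub>V\<^sub>S\<close> 50) where
  "A \<cong>\<^sub>T\<^sub>V\<^sub>S B \<longleftrightarrow> A \<in> TVS \<and> B \<in> TVS \<and>
     (\<exists>f \<in> continuous_linear_maps A B. \<exists>g \<in> continuous_linear_maps B A.
        (\<forall>x\<in>carrier (vect A). g (f x) = x) \<and> (\<forall>y\<in>carrier (vect B). f (g y) = y))"

section \<open>The category chu\<close>

text \<open>A pairing is given as a bilinear map rather than as a functional on the tensor product.\<close>

record ('k, 'v, 'w) chu_triple =
  lspace :: "('k, 'v) module"
  rspace :: "('k, 'w) module"
  pairing :: "'v \<Rightarrow> 'w \<Rightarrow> 'k"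

definition curry_left :: "('k::real_or_complex, 'v, 'w) chu_triple \<Rightarrow> 'v \<Rightarrow> ('w \<Rightarrow> 'k)" where
  "curry_left P = (\<lambda>v\<in>carrier (lspace P). \<lambda>w\<in>carrier (rspace P). pairing P v w)"

definition curry_right :: "('k::real_or_complex, 'v, 'w) chu_triple \<Rightarrow> 'w \<Rightarrow> ('v \<Rightarrow> 'k)" where
  "curry_right P = (\<lambda>w\<in>carrier (rspace P). \<lambda>v\<in>carrier (lspace P). pairing P v w)"

definition chu :: "('k::real_or_complex, 'v, 'w) chu_triple set" where
  "chu = {P. lspace P \<in> vector_spaces \<and> rspace P \<in> vector_spaces \<and>
     curry_left P \<in> linear_maps (lspace P) (algebraic_dual (rspace P)) \<and>
     curry_right P \<in> linear_maps (rspace P) (algebraic_dual (lspace P)) \<and>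
     inj_on (curry_left P) (carrier (lspace P)) \<and>
     inj_on (curry_right P) (carrier (rspace P))}"

definition chu_homs ::
    "('k::real_or_complex, 'v1, 'w1) chu_triple \<Rightarrow> ('k, 'v2, 'w2) chu_triple
      \<Rightarrow> (('v1 \<Rightarrow> 'v2) \<times> ('w2 \<Rightarrow> 'w1)) set" where
  "chu_homs P Q = {(f, g). f \<in> linear_maps (lspace P) (lspace Q) \<and> g \<in> linear_maps (rspace Q) (rspace P) \<and>
     (\<forall>v\<in>carrier (lspace P). \<forall>w\<in>carrier (rspace Q). pairing Q (f v) w = pairing P v (g w))}"

definition chu_hom_space ::
    "('k::real_or_complex, 'v1, 'w1) chu_triple \<Rightarrow> ('k, 'v2, 'w2) chu_triple
      \<Rightarrow> ('k, ('v1 \<Rightarrow> 'v2) \<times> ('w2 \<Rightarrow> 'w1)) module" where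
  "chu_hom_space P Q =
    (let F = hom_space (lspace P) (lspace Q); G = hom_space (rspace Q) (rspace P) in
     \<lparr>carrier = chu_homs P Q, mult = undefined, one = undefined,
      zero = (\<zero>\<^bsub>F\<^esub>, \<zero>\<^bsub>G\<^esub>),
      add = (\<lambda>(f, g) (f', g'). (f \<oplus>\<^bsub>F\<^esub> f', g \<oplus>\<^bsub>G\<^esub> g')),
      smult = (\<lambda>c (f, g). (c \<odot>\<^bsub>F\<^esub> f, c \<odot>\<^bsub>G\<^esub> g))\<rparr>)"

definition chu_dual :: "('k::real_or_complex, 'v, 'w) chu_triple \<Rightarrow> ('k, 'w, 'v) chu_triple" where
  "chu_dual P = \<lparr>lspace = rspace P, rspace = lspace P, pairing = (\<lambda>w v. pairing P v w)\<rparr>"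

definition chu_internal_hom ::
    "('k::real_or_complex, 'v1, 'w1) chu_triple \<Rightarrow> ('k, 'v2, 'w2) chu_triple
      \<Rightarrow> ('k, ('v1 \<Rightarrow> 'v2) \<times> ('w2 \<Rightarrow> 'w1), ('k, 'v1, 'w2) tensor) chu_triple" where
  "chu_internal_hom P Q =
     \<lparr>lspace = chu_hom_space P Q,
      rspace = tensor_space (lspace P) (rspace Q),
      pairing = (\<lambda>(f, g). tensor_lift (\<lambda>v w. pairing Q (f v) w))\<rparr>"

section \<open>Dual topologies\<close>

definition dual_topologies :: "('k::real_or_complex, 'v, 'w) chu_triple \<Rightarrow> 'v topology set" where
  "dual_topologies P = {T. P \<in> chu \<and> \<lparr>vect = lspace P, topol = T\<rparr> \<in> TVS \<and>
     bij_betw (curry_right P) (carrier (rspace P))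
       (carrier (topological_dual \<lparr>vect = lspace P, topol = T\<rparr>))}"

definition coarser_topology :: "'v topology \<Rightarrow> 'v topology \<Rightarrow> bool" where
  "coarser_topology S T \<longleftrightarrow> (\<forall>U. openin S U \<longrightarrow> openin T U)"

definition weak_topology :: "('k::real_or_complex, 'v, 'w) chu_triple \<Rightarrow> 'v topology" (\<open>\<sigma>\<close>) where
  "\<sigma> P = (THE T. T \<in> dual_topologies P \<and> (\<forall>S\<in>dual_topologies P. coarser_topology T S))"

definition mackey_topology :: "('k::real_or_complex, 'v, 'w) chu_triple \<Rightarrow> 'v topology" (\<open>\<tau>\<close>) where
  "\<tau> P = (THE T. T \<in> dual_topologies P \<and> (\<forall>S\<in>dual_topologies P. coarser_topology S T))"

definition to_chu :: "('k::real_or_complex, 'v) tvs \<Rightarrow> ('k, 'v, 'v \<Rightarrow> 'k) chu_triple" where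
  "to_chu A = \<lparr>lspace = vect A, rspace = topological_dual A, pairing = (\<lambda>v f. f v)\<rparr>"

definition weak_space :: "('k::real_or_complex, 'v, 'w) chu_triple \<Rightarrow> ('k, 'v) tvs" where
  "weak_space P = \<lparr>vect = lspace P, topol = \<sigma> P\<rparr>"

definition mackey_space :: "('k::real_or_complex, 'v, 'w) chu_triple \<Rightarrow> ('k, 'v) tvs" where
  "mackey_space P = \<lparr>vect = lspace P, topol = \<tau> P\<rparr>"

definition TVS_w :: "('k::real_or_complex, 'v) tvs set" where
  "TVS_w = {A \<in> TVS. topol A = \<sigma> (to_chu A)}"

definition TVS_m :: "('k::real_or_complex, 'v) tvs set" where
  "TVS_m = {A \<in> TVS. topol A = \<tau> (to_chu A)}"

section \<open>The tensor products on weak spaces and on Mackey spaces\<close>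

definition Hom_w ::
    "('k::real_or_complex, 'v) tvs \<Rightarrow> ('k, 'w) tvs
      \<Rightarrow> ('k, ('v \<Rightarrow> 'w) \<times> (('w \<Rightarrow> 'k) \<Rightarrow> ('v \<Rightarrow> 'k))) tvs" where
  "Hom_w A B = weak_space (chu_internal_hom (to_chu A) (to_chu B))"

definition D_w :: "('k::real_or_complex, 'v) tvs \<Rightarrow> ('k, 'v \<Rightarrow> 'k) tvs" where
  "D_w A = weak_space (chu_dual (to_chu A))"

definition tensor_w ::
    "('k::real_or_complex, 'v) tvs \<Rightarrow> ('k, 'w) tvs
      \<Rightarrow> ('k, ('v \<Rightarrow> 'w \<Rightarrow> 'k) \<times> ((('w \<Rightarrow> 'k) \<Rightarrow> 'k) \<Rightarrow> ('v \<Rightarrow> 'k)) \<Rightarrow> 'k) tvs"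
    (infixr \<open>\<otimes>\<^sub>w\<close> 70) where
  "A \<otimes>\<^sub>w B = D_w (Hom_w A (D_w B))"

definition Hom_m ::
    "('k::real_or_complex, 'v) tvs \<Rightarrow> ('k, 'w) tvs
      \<Rightarrow> ('k, ('v \<Rightarrow> 'w) \<times> (('w \<Rightarrow> 'k) \<Rightarrow> ('v \<Rightarrow> 'k))) tvs" where
  "Hom_m A B = mackey_space (chu_internal_hom (to_chu A) (to_chu B))"

definition D_m :: "('k::real_or_complex, 'v) tvs \<Rightarrow> ('k, 'v \<Rightarrow> 'k) tvs" where
  "D_m A = mackey_space (chu_dual (to_chu A))"

definition tensor_m ::
    "('k::real_or_complex, 'v) tvs \<Rightarrow> ('k, 'w) tvs
      \<Rightarrow> ('k, ('v \<Rightarrow> 'w \<Rightarrow> 'k) \<times> ((('w \<Rightarrow> 'k) \<Rightarrow> 'k) \<Rightarrow> ('v \<Rightarrow> 'k)) \<Rightarrow> 'k) tvs"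
    (infixr \<open>\<otimes>\<^sub>m\<close> 70) where
  "A \<otimes>\<^sub>m B = D_m (Hom_m A (D_m B))"

definition weak_dual :: "('k::real_or_complex, 'v) tvs \<Rightarrow> ('k, 'v \<Rightarrow> 'k) tvs" where
  "weak_dual A = \<lparr>vect = topological_dual A,
     topol = \<sigma> \<lparr>lspace = topological_dual A, rspace = vect A, pairing = (\<lambda>f v. f v)\<rparr>\<rparr>"

definition mackey_dual :: "('k::real_or_complex, 'v) tvs \<Rightarrow> ('k, 'v \<Rightarrow> 'k) tvs" where
  "mackey_dual A = \<lparr>vect = topological_dual A,
     topol = \<tau> \<lparr>lspace = topological_dual A, rspace = vect A, pairing = (\<lambda>f v. f v)\<rparr>\<rparr>"

end

(*
  Unwinding the definitions, the tensor product of V and W is the topological dual of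
  X = Hom(V, W') with the weak or Mackey topology for the pairing with X. Since X is paired with
  the algebraic tensor product of V and W'', and W'' = W as a vector space, this dual is the algebraic
  tensor product of V and W; and X consists of the continuous linear maps from V to W', because a
  linear map between weak (or Mackey) spaces is continuous as soon as it has a transpose on the
  duals. Topologies are handled through ideals of seminorms. For the Mackey topology the ideal
  consists of the seminorms p such that every functional below p belongs to the dual. That it is
  closed under sums, and stable under composition with linear maps having a transpose, follows from
  the Hahn-Banach theorem, which splits a functional below p + q and extends a functional below
  p o f along f. This avoids the Mackey-Arens theorem and compactness arguments.
*)
theory Submission
  imports Defs
begin


text \<open>\<open>\<sigma>\<close> and \<open>\<tau>\<close> are definite descriptions over all
  Hausdorff locally convex topologies, so explicit candidates are not enough: every competing
  topology must be brought into seminorm form, which Minkowski functionals do, and extremality then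
  becomes inclusion of ideals. Moreover these topologies are only meaningful for nondegenerate
  pairings, so each triple has to be shown to lie in \<open>chu\<close> first. For tensor spaces
  this amounts to the fact that a tensor killed by enough rank-one forms \<alpha> \<otimes> \<beta>
  is zero, proved by shortening a list of summands, without bases. The Hahn-Banach theorem is needed
  for two purposes, extension along a map that may fail to be injective and splitting of a
  functional below p + q. Both follow from one sandwich statement: a real functional is placed below
  a sublinear function and above a convex cone \<open>K\<close> of pairs (vector, real number). The
  real and the complex case are treated together through a real part \<open>re\<close> and a scalar
  \<open>j\<close>.\<close>

text \<open>Over \<open>\<complex>\<close> take \<open>j = \<i>\<close>, over \<open>\<real>\<close> take \<open>j = 0\<close>.\<close>

locale real_part =
  fixes re :: "'k::real_or_complex \<Rightarrow> real" and j :: 'k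
  assumes re_add: "re (x + y) = re x + re y"
    and re_scale: "re (of_real t * x) = t * re x"
    and re_le_norm: "re x \<le> norm x" and re_one: "re 1 = 1" and re_j: "re j = 0"
    and j: "j = 0 \<or> j * j = - 1"
    and coordinates: "x = of_real (re x) - of_real (re (j * x)) * j"

text \<open>The class supplies an isometric ring isomorphism \<phi> onto the reals or the complex
  numbers, and \<open>re\<close> is its real part. Over the complex numbers
  \<open>coordinates\<close> says x = Re x + i Im x, because Re (i x) = - Im x. The work lies in
  relating \<phi> to \<open>of_real\<close>, of which the class says nothing.\<close>

lemma real_part_exists:
  obtains re :: "'k::real_or_complex \<Rightarrow> real" and j :: 'k where "real_part re j"
  using real_or_complex[where 'a = 'k]
proof (elim disjE exE conjE)
  fix \<phi> :: "'k \<Rightarrow> real"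
  assume \<phi>: "bij \<phi>" "\<forall>x y. \<phi> (x + y) = \<phi> x + \<phi> y" "\<forall>x y. \<phi> (x * y) = \<phi> x * \<phi> y"
    "\<forall>x. norm (\<phi> x) = norm x"
  have inj: "\<phi> x = \<phi> y \<Longrightarrow> x = y" for x y
    using \<phi>(1) by (auto simp: bij_def inj_def)
  have "\<phi> 1 \<noteq> 0" using \<phi>(4) by (metis norm_one norm_zero zero_neq_one)
  then have one: "\<phi> 1 = 1" using \<phi>(3) by (metis mult_cancel_left2 mult_1)
  have diff: "\<phi> (x - y) = \<phi> x - \<phi> y" for x y
    using \<phi>(2) by (metis add_diff_cancel_right' diff_add_cancel)
  \<comment> \<open>A real number is determined by its distances to 0 and 1, and \<phi> preserves
    both.\<close>
  have real: "\<phi> (of_real t) = t" for t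
  proof -
    have "\<bar>\<phi> (of_real t)\<bar> = \<bar>t\<bar>" using \<phi>(4) by (metis norm_of_real real_norm_def)
    moreover have "\<bar>\<phi> (of_real t) - 1\<bar> = \<bar>t - 1\<bar>"
      using \<phi>(4) diff one by (metis norm_of_real of_real_1 of_real_diff real_norm_def)
    ultimately show ?thesis by arith
  qed
  show thesis
  proof (rule that[of \<phi> 0], unfold_locales)
    show "\<phi> x \<le> norm x" for x using \<phi>(4) by (metis abs_ge_self real_norm_def)
    show "\<phi> 0 = 0" using diff[of 0 0] by simp
    show "x = of_real (\<phi> x) - of_real (\<phi> (0 * x)) * 0" for x
      by (rule inj) (simp add: real)
  qed (use \<phi> one real in auto)
next
  fix \<phi> :: "'k \<Rightarrow> complex"
  assume \<phi>: "bij \<phi>" "\<forall>x y. \<phi> (x + y) = \<phi> x + \<phi> y" "\<forall>x y. \<phi> (x * y) = \<phi> x * \<phi> y"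
    "\<forall>x. norm (\<phi> x) = norm x"
  have inj: "\<phi> x = \<phi> y \<Longrightarrow> x = y" for x y
    using \<phi>(1) by (auto simp: bij_def inj_def)
  have "\<phi> 1 \<noteq> 0" using \<phi>(4) by (metis norm_one norm_zero zero_neq_one)
  then have one: "\<phi> 1 = 1" using \<phi>(3) by (metis mult_cancel_left2 mult_1)
  have diff: "\<phi> (x - y) = \<phi> x - \<phi> y" for x y
    using \<phi>(2) by (metis add_diff_cancel_right' diff_add_cancel)
  \<comment> \<open>The circles through the real number t with centres 0 and 1 meet in t
    only.\<close>
  have real: "\<phi> (of_real t) = of_real t" for t
  proof -
    define z where "z = \<phi> (of_real t)"
    have "norm z = \<bar>t\<bar>" using \<phi>(4) unfolding z_def by (metis norm_of_real)
    then have 1: "(Re z)\<^sup>2 + (Im z)\<^sup>2 = t\<^sup>2"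
      by (metis cmod_power2 power2_abs)
    have "norm (z - 1) = \<bar>t - 1\<bar>"
      using \<phi>(4) diff one unfolding z_def by (metis norm_of_real of_real_1 of_real_diff)
    then have "(Re (z - 1))\<^sup>2 + (Im (z - 1))\<^sup>2 = (t - 1)\<^sup>2"
      by (metis cmod_power2 power2_abs)
    then have 2: "(Re z - 1)\<^sup>2 + (Im z)\<^sup>2 = (t - 1)\<^sup>2" by simp
    have "Re z = t" using 1 2 by (simp add: power2_eq_square algebra_simps)
    moreover from this 1 have "Im z = 0" by simp
    ultimately show ?thesis unfolding z_def by (simp add: complex_eq_iff)
  qed
  obtain j where j: "\<phi> j = \<i>" using \<phi>(1) by (metis bij_pointE)
  have minus: "\<phi> (- 1) = - 1" using diff[of 0 1] diff[of 0 0] one by simp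
  show thesis
  proof (rule that[of "\<lambda>x. Re (\<phi> x)" j], unfold_locales)
    show "Re (\<phi> x) \<le> norm x" for x using \<phi>(4) by (metis complex_Re_le_cmod)
    show "j = 0 \<or> j * j = - 1" by (rule disjI2, rule inj) (use \<phi> j minus in simp)
    show "x = of_real (Re (\<phi> x)) - of_real (Re (\<phi> (j * x))) * j" for x
      by (rule inj) (use \<phi> j real in \<open>simp add: diff complex_eq_iff\<close>)
  qed (use \<phi> one real j in auto)
qed

section \<open>Vector spaces with an explicit carrier\<close>

locale vspace =
  fixes V :: "('k::real_or_complex, 'v) module" (structure)
  assumes vector_space: "V \<in> vector_spaces"
begin

lemma is_module: "Module.module (scalars :: ('k, 'k) module) V"
  using vector_space by (simp add: vector_spaces_def)

lemma abelian: "abelian_group V"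
  using is_module by (simp add: module_def)

lemma zero_closed [simp, intro]: "\<zero> \<in> carrier V"
  using abelian by (simp add: abelian_group.axioms(1) abelian_monoid.zero_closed)

lemma add_closed [simp, intro]: "x \<in> carrier V \<Longrightarrow> y \<in> carrier V \<Longrightarrow> x \<oplus> y \<in> carrier V"
  using abelian by (simp add: abelian_group.axioms(1) abelian_monoid.a_closed)

lemma smult_closed [simp, intro]: "x \<in> carrier V \<Longrightarrow> c \<odot> x \<in> carrier V"
  using module.smult_closed[OF is_module, of c x] by (simp add: scalars_def)

lemma add_assoc: "x \<in> carrier V \<Longrightarrow> y \<in> carrier V \<Longrightarrow> z \<in> carrier V \<Longrightarrow> (x \<oplus> y) \<oplus> z = x \<oplus> (y \<oplus> z)"
  using abelian by (simp add: abelian_group.axioms(1) abelian_monoid.a_assoc)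

lemma add_comm: "x \<in> carrier V \<Longrightarrow> y \<in> carrier V \<Longrightarrow> x \<oplus> y = y \<oplus> x"
  using abelian by (simp add: abelian_group.axioms(1) abelian_monoid.a_comm)

lemma add_lcomm: "x \<in> carrier V \<Longrightarrow> y \<in> carrier V \<Longrightarrow> z \<in> carrier V \<Longrightarrow> x \<oplus> (y \<oplus> z) = y \<oplus> (x \<oplus> z)"
  by (metis add_assoc add_comm)

lemmas add_ac = add_assoc add_comm add_lcomm

lemma add_zero [simp]: "x \<in> carrier V \<Longrightarrow> \<zero> \<oplus> x = x" "x \<in> carrier V \<Longrightarrow> x \<oplus> \<zero> = x"
  using abelian by (simp_all add: abelian_group.axioms(1) abelian_monoid.l_zero abelian_monoid.r_zero)

lemma smult_add_left: "x \<in> carrier V \<Longrightarrow> (c + d) \<odot> x = c \<odot> x \<oplus> d \<odot> x"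
  using module.smult_l_distr[OF is_module, of c d x] by (simp add: scalars_def)

lemma smult_add_right: "x \<in> carrier V \<Longrightarrow> y \<in> carrier V \<Longrightarrow> c \<odot> (x \<oplus> y) = c \<odot> x \<oplus> c \<odot> y"
  using module.smult_r_distr[OF is_module, of c x y] by (simp add: scalars_def)

lemma smult_smult [simp]: "x \<in> carrier V \<Longrightarrow> c \<odot> (d \<odot> x) = (c * d) \<odot> x"
  using module.smult_assoc1[OF is_module, of c d x] by (simp add: scalars_def)

lemma smult_one [simp]: "x \<in> carrier V \<Longrightarrow> 1 \<odot> x = x"
  using module.smult_one[OF is_module, of x] by (simp add: scalars_def)

lemma smult_zero_left [simp]: "x \<in> carrier V \<Longrightarrow> 0 \<odot> x = \<zero>"
  using module.smult_l_null[OF is_module, of x] by (simp add: scalars_def)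

lemma smult_zero_right [simp]: "c \<odot> \<zero> = \<zero>"
  using smult_smult[of \<zero> c 0] by simp

text \<open>Negatives are written as multiples by -1 throughout, so that linear maps and seminorms
  handle them by homogeneity.\<close>

lemma add_neg [simp]:
  assumes "x \<in> carrier V"
  shows "x \<oplus> (- 1) \<odot> x = \<zero>" "(- 1) \<odot> x \<oplus> x = \<zero>"
  using smult_add_left[OF assms, of 1 "- 1"] smult_add_left[OF assms, of "- 1" 1] assms by simp_all

lemma add_neg_cancel [simp]:
  assumes "x \<in> carrier V" "y \<in> carrier V"
  shows "x \<oplus> ((- 1) \<odot> x \<oplus> y) = y" "(- 1) \<odot> x \<oplus> (x \<oplus> y) = y"
  using assms by (simp_all flip: add_assoc)

lemma diff_eq_zero:
  assumes "x \<in> carrier V" "y \<in> carrier V" "x \<oplus> (- 1) \<odot> y = \<zero>"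
  shows "x = y"
  using assms add_zero(1)[of y] by (metis add_assoc add_neg(2) add_zero(2) smult_closed)

end

text \<open>Additive inverses come for free: (-1) x is one, by distributivity and 0 x = 0.\<close>

lemma vector_spacesI:
  fixes V :: "('k::real_or_complex, 'v) module" (structure)
  assumes "\<zero> \<in> carrier V"
    and "\<And>x y. x \<in> carrier V \<Longrightarrow> y \<in> carrier V \<Longrightarrow> x \<oplus> y \<in> carrier V"
    and "\<And>c x. x \<in> carrier V \<Longrightarrow> c \<odot> x \<in> carrier V"
    and "\<And>x y z. x \<in> carrier V \<Longrightarrow> y \<in> carrier V \<Longrightarrow> z \<in> carrier V \<Longrightarrow> (x \<oplus> y) \<oplus> z = x \<oplus> (y \<oplus> z)"
    and "\<And>x y. x \<in> carrier V \<Longrightarrow> y \<in> carrier V \<Longrightarrow> x \<oplus> y = y \<oplus> x"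
    and "\<And>x. x \<in> carrier V \<Longrightarrow> \<zero> \<oplus> x = x"
    and "\<And>c d x. x \<in> carrier V \<Longrightarrow> (c + d) \<odot> x = c \<odot> x \<oplus> d \<odot> x"
    and "\<And>c x y. x \<in> carrier V \<Longrightarrow> y \<in> carrier V \<Longrightarrow> c \<odot> (x \<oplus> y) = c \<odot> x \<oplus> c \<odot> y"
    and "\<And>c d x. x \<in> carrier V \<Longrightarrow> (c * d) \<odot> x = c \<odot> (d \<odot> x)"
    and "\<And>x. x \<in> carrier V \<Longrightarrow> 1 \<odot> x = x"
    and "\<And>x. x \<in> carrier V \<Longrightarrow> 0 \<odot> x = \<zero>"
  shows "V \<in> vector_spaces"
proof -
  have cring: "cring (scalars :: ('k, 'k) module)"
  proof (rule cringI)
    show "abelian_group (scalars :: ('k, 'k) module)"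
      by (rule abelian_groupI) (auto simp: scalars_def algebra_simps intro: exI[of _ "- x" for x])
    show "comm_monoid (scalars :: ('k, 'k) module)"
      by (rule comm_monoidI) (auto simp: scalars_def)
  qed (auto simp: scalars_def algebra_simps)
  have abelian: "abelian_group V"
  proof (rule abelian_groupI)
    fix x assume x: "x \<in> carrier V"
    have "(- 1) \<odot> x \<oplus> 1 \<odot> x = \<zero>"
      using assms(7)[OF x, of "- 1" 1] assms(11)[OF x] by simp
    then show "\<exists>y\<in>carrier V. y \<oplus> x = \<zero>"
      using x assms(3,10) by metis
  qed (use assms in auto)
  show ?thesis
    unfolding vector_spaces_def mem_Collect_eq
    by (rule moduleI[OF cring abelian]) (use assms in \<open>auto simp: scalars_def\<close>)
qed

lemma scalars_simps [simp]:
  "carrier scalars = UNIV" "add scalars = (+)" "zero scalars = 0" "smult scalars = (*)"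
  by (auto simp: scalars_def)

lemma scalars_vector_space: "(scalars :: ('k::real_or_complex, 'k) module) \<in> vector_spaces"
  by (rule vector_spacesI) (auto simp: algebra_simps)

section \<open>The Hahn--Banach theorem\<close>

context vspace
begin

definition sublinear :: "('v \<Rightarrow> real) \<Rightarrow> bool" where
  "sublinear q \<longleftrightarrow> (\<forall>x\<in>carrier V. \<forall>y\<in>carrier V. q (x \<oplus> y) \<le> q x + q y) \<and>
     (\<forall>t\<ge>0. \<forall>x\<in>carrier V. q (of_real t \<odot> x) = t * q x)"

lemma sublinear_add: "sublinear q \<Longrightarrow> x \<in> carrier V \<Longrightarrow> y \<in> carrier V \<Longrightarrow> q (x \<oplus> y) \<le> q x + q y"
  and sublinear_scale: "sublinear q \<Longrightarrow> 0 \<le> t \<Longrightarrow> x \<in> carrier V \<Longrightarrow> q (of_real t \<odot> x) = t * q x"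
  by (auto simp: sublinear_def)

lemma sublinear_zero: "sublinear q \<Longrightarrow> q \<zero> = 0"
  using sublinear_scale[of q 0 \<zero>] by simp

lemma sublinear_neg: "sublinear q \<Longrightarrow> x \<in> carrier V \<Longrightarrow> 0 \<le> q x + q ((- 1) \<odot> x)"
  using sublinear_add[of q x "(- 1) \<odot> x"] sublinear_zero[of q] by simp

text \<open>The inequality at 1/t and t x is the reverse of the inequality at t and x.\<close>

lemma sublinearI:
  assumes "\<And>x y. x \<in> carrier V \<Longrightarrow> y \<in> carrier V \<Longrightarrow> q (x \<oplus> y) \<le> q x + q y"
    and "\<And>t x. 0 < t \<Longrightarrow> x \<in> carrier V \<Longrightarrow> q (of_real t \<odot> x) \<le> t * q x"
    and "q \<zero> = 0"
  shows "sublinear q"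
  unfolding sublinear_def
proof (intro conjI ballI allI impI)
  fix t :: real and x assume t: "0 \<le> t" and x: "x \<in> carrier V"
  show "q (of_real t \<odot> x) = t * q x"
  proof (cases "t = 0")
    case False
    with t have t: "0 < t" by simp
    have "q (of_real (1 / t) \<odot> (of_real t \<odot> x)) \<le> (1 / t) * q (of_real t \<odot> x)"
      using t x by (intro assms) auto
    then have "q x \<le> (1 / t) * q (of_real t \<odot> x)"
      using t x by (simp flip: of_real_mult)
    then have "t * q x \<le> q (of_real t \<odot> x)"
      using t by (simp add: field_simps)
    then show ?thesis using assms(2)[OF t x] by simp
  qed (use x assms(3) in simp)
qed (use assms in auto)

text \<open>Zorn's lemma with pointwise infima of chains as bounds. Minimal sublinear functions turn
  out to be linear (\<open>sublinear_minimal_additive\<close>), so no functional has to be extended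
  one dimension at a time.\<close>

lemma minimal_sublinear:
  assumes p: "sublinear p"
  obtains q where "sublinear q" "\<And>x. x \<in> carrier V \<Longrightarrow> q x \<le> p x"
    "\<And>r x. sublinear r \<Longrightarrow> (\<And>y. y \<in> carrier V \<Longrightarrow> r y \<le> q y) \<Longrightarrow> x \<in> carrier V \<Longrightarrow> r x = q x"
proof -
  \<comment> \<open>Extensionality makes the pointwise order antisymmetric; \<open>ge\<close> is the
    reversed order, so that the maximal elements of Zorn's lemma are the minimal functions.\<close>
  define M where "M = {q. sublinear q \<and> q \<in> extensional (carrier V) \<and> (\<forall>x\<in>carrier V. q x \<le> p x)}"
  define ge where "ge q r \<longleftrightarrow> (\<forall>x\<in>carrier V. r x \<le> q x)" for q r :: "'v \<Rightarrow> real"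
  have restrict_sub: "sublinear (restrict q (carrier V)) \<longleftrightarrow> sublinear q" for q
    by (auto simp: sublinear_def)
  have "\<exists>m\<in>M. \<forall>a\<in>M. ge m a \<longrightarrow> a = m"
  proof (rule predicate_Zorn)
    show "partial_order_on M (relation_of ge M)"
      unfolding partial_order_on_def preorder_on_def
    proof (intro conjI)
      show "antisym (relation_of ge M)"
      proof (rule antisymI)
        fix q r assume qr: "(q, r) \<in> relation_of ge M" "(r, q) \<in> relation_of ge M"
        then have "q x = r x" if "x \<in> carrier V" for x
          using that by (intro order_antisym) (auto simp: relation_of_def ge_def)
        then show "q = r"
          using qr by (intro extensionalityI[of q "carrier V" r]) (auto simp: relation_of_def M_def)
      qed
      show "trans (relation_of ge M)"
        by (rule transI) (force simp: relation_of_def ge_def intro: order_trans)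
    qed (auto simp: relation_of_def ge_def refl_on_def)
  next
    fix C assume C: "C \<in> Chains (relation_of ge M)"
    have CM: "C \<subseteq> M" and total: "\<And>q r. q \<in> C \<Longrightarrow> r \<in> C \<Longrightarrow> ge q r \<or> ge r q"
      using C by (auto simp: Chains_def relation_of_def)
    show "\<exists>u\<in>M. \<forall>a\<in>C. ge a u"
    proof (cases "C = {}")
      case True
      have "restrict p (carrier V) \<in> M"
        using p by (simp add: M_def restrict_sub)
      then show ?thesis using True by blast
    next
      case False
      define u where "u = (\<lambda>x\<in>carrier V. INF q\<in>C. q x)"
      have sub: "sublinear q" and le: "x \<in> carrier V \<Longrightarrow> q x \<le> p x" if "q \<in> C" for q x
        using that CM by (auto simp: M_def)
      \<comment> \<open>From 0 \<le> q x + q (-x) and q \<le> p. The bound is independent of q, so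
        the infimum over the chain is finite.\<close>
      have lower: "- p ((- 1) \<odot> x) \<le> q x" if "q \<in> C" "x \<in> carrier V" for q x
        using sublinear_neg[OF sub[OF that(1)] that(2)] le[OF that(1), of "(- 1) \<odot> x"] that by simp
      have bdd: "bdd_below ((\<lambda>q. q x) ` C)" if "x \<in> carrier V" for x
        using lower that by (intro bdd_belowI[of _ "- p ((- 1) \<odot> x)"]) auto
      have u_le: "u x \<le> q x" if "q \<in> C" "x \<in> carrier V" for q x
        using that bdd by (auto simp: u_def intro: cINF_lower)
      have u_ge: "c \<le> u x" if "x \<in> carrier V" "\<And>q. q \<in> C \<Longrightarrow> c \<le> q x" for c x
        using that False by (auto simp: u_def intro: cINF_greatest)
      have "sublinear u"
      proof (rule sublinearI)
        fix x y assume xy: "x \<in> carrier V" "y \<in> carrier V"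
        \<comment> \<open>The smaller of two members of the chain lies below both, which allows the
          infima at x and y to be taken independently.\<close>
        have *: "u (x \<oplus> y) \<le> q x + r y" if qr: "q \<in> C" "r \<in> C" for q r
        proof -
          obtain m where m: "m \<in> C" "m x \<le> q x" "m y \<le> r y"
            using total[OF qr] qr xy by (metis ge_def order_refl)
          have "u (x \<oplus> y) \<le> m (x \<oplus> y)" using m xy by (intro u_le) auto
          also have "\<dots> \<le> m x + m y" using sublinear_add[OF sub[OF m(1)]] xy by blast
          finally show ?thesis using m by linarith
        qed
        have "u (x \<oplus> y) - r y \<le> u x" if "r \<in> C" for r
          using *[OF _ that] by (intro u_ge xy) (simp add: algebra_simps)
        then have "u (x \<oplus> y) - u x \<le> u y"
          by (intro u_ge xy) (simp add: algebra_simps)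
        then show "u (x \<oplus> y) \<le> u x + u y" by simp
      next
        fix t :: real and x assume t: "0 < t" and x: "x \<in> carrier V"
        have "u (of_real t \<odot> x) / t \<le> u x"
        proof (rule u_ge[OF x])
          fix q assume q: "q \<in> C"
          have "u (of_real t \<odot> x) \<le> t * q x"
            using u_le[OF q, of "of_real t \<odot> x"] x sublinear_scale[OF sub[OF q] _ x, of t] t by simp
          then show "u (of_real t \<odot> x) / t \<le> q x" using t by (simp add: field_simps)
        qed
        then show "u (of_real t \<odot> x) \<le> t * u x" using t by (simp add: field_simps)
      next
        have "(\<lambda>q. q \<zero>) ` C = {0}"
          using False sublinear_zero[OF sub] by force
        then show "u \<zero> = 0" by (simp add: u_def)
      qed
      moreover have "u x \<le> p x" if "x \<in> carrier V" for x
        using False u_le le that by (meson all_not_in_conv order_trans)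
      ultimately have "u \<in> M" by (auto simp: M_def u_def)
      then show ?thesis using u_le by (auto simp: ge_def)
    qed
  qed
  then obtain q where q: "q \<in> M" "\<And>r. r \<in> M \<Longrightarrow> ge q r \<Longrightarrow> r = q" by blast
  show thesis
  proof (rule that[of q])
    fix r x assume r: "sublinear r" "\<And>y. y \<in> carrier V \<Longrightarrow> r y \<le> q y" and x: "x \<in> carrier V"
    have "restrict r (carrier V) \<in> M"
      using r q(1) by (auto simp: M_def restrict_sub intro: order_trans)
    then have "restrict r (carrier V) = q"
      by (rule q(2)) (use r in \<open>simp add: ge_def\<close>)
    then show "r x = q x" using x by (metis restrict_apply')
  qed (use q(1) in \<open>auto simp: M_def\<close>)
qed

text \<open>
  \<open>K\<close> plays the role of the hypograph of a superlinear function below \<open>p\<close>; the infimal convolution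
  \<open>G\<close> is the largest sublinear function below \<open>p\<close> with \<open>G (- z) \<le> - s\<close> on \<open>K\<close>.
\<close>

lemma infimal_convolution:
  assumes p: "sublinear p"
    and K: "K \<subseteq> carrier V \<times> UNIV" "(\<zero>, 0) \<in> K"
      "\<And>z s z' s'. (z, s) \<in> K \<Longrightarrow> (z', s') \<in> K \<Longrightarrow> (z \<oplus> z', s + s') \<in> K"
      "\<And>t z s. 0 < t \<Longrightarrow> (z, s) \<in> K \<Longrightarrow> (of_real t \<odot> z, t * s) \<in> K"
    and le: "\<And>z s. (z, s) \<in> K \<Longrightarrow> s \<le> p z"
  obtains G where "sublinear G" "\<And>x. x \<in> carrier V \<Longrightarrow> G x \<le> p x"
    "\<And>z s. (z, s) \<in> K \<Longrightarrow> G ((- 1) \<odot> z) \<le> - s"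
proof -
  define G where "G x = (INF (z, s)\<in>K. p (x \<oplus> z) - s)" for x
  have Kc: "z \<in> carrier V" if "(z, s) \<in> K" for z s
    using K(1) that by auto
  \<comment> \<open>Subadditivity applied to z = -x + (x + z), together with s \<le> p z, bounds the
    infimum defining \<open>G\<close> from below.\<close>
  have lower: "- p ((- 1) \<odot> x) \<le> p (x \<oplus> z) - s" if x: "x \<in> carrier V" and z: "(z, s) \<in> K" for x z s
  proof -
    have "p z = p ((- 1) \<odot> x \<oplus> (x \<oplus> z))" using x Kc[OF z] by simp
    also have "\<dots> \<le> p ((- 1) \<odot> x) + p (x \<oplus> z)" using x Kc[OF z] by (intro sublinear_add[OF p]) auto
    finally show ?thesis using le[OF z] by linarith
  qed
  have bdd: "bdd_below ((\<lambda>(z, s). p (x \<oplus> z) - s) ` K)" if "x \<in> carrier V" for x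
    using lower[OF that] by (intro bdd_belowI[of _ "- p ((- 1) \<odot> x)"]) auto
  have G_le: "G x \<le> p (x \<oplus> z) - s" if "x \<in> carrier V" "(z, s) \<in> K" for x z s
    using cINF_lower[OF bdd[OF that(1)] that(2)] by (simp add: G_def)
  have G_ge: "c \<le> G x" if "x \<in> carrier V" "\<And>z s. (z, s) \<in> K \<Longrightarrow> c \<le> p (x \<oplus> z) - s" for c x
    unfolding G_def using that K(2) by (intro cINF_greatest) auto
  have G_le_p: "G x \<le> p x" if "x \<in> carrier V" for x
    using G_le[OF that K(2)] that by simp
  have "sublinear G"
  proof (rule sublinearI)
    fix x y assume xy: "x \<in> carrier V" "y \<in> carrier V"
    have *: "G (x \<oplus> y) \<le> (p (x \<oplus> z) - s) + (p (y \<oplus> z') - s')" if z: "(z, s) \<in> K" "(z', s') \<in> K" for z s z' s'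
    proof -
      have "G (x \<oplus> y) \<le> p ((x \<oplus> y) \<oplus> (z \<oplus> z')) - (s + s')"
        using xy z K(3) by (intro G_le) auto
      also have "(x \<oplus> y) \<oplus> (z \<oplus> z') = (x \<oplus> z) \<oplus> (y \<oplus> z')"
        using xy z Kc by (simp add: add_ac)
      also have "p \<dots> \<le> p (x \<oplus> z) + p (y \<oplus> z')"
        using xy z Kc by (intro sublinear_add[OF p]) auto
      finally show ?thesis by simp
    qed
    have "G (x \<oplus> y) - (p (y \<oplus> z') - s') \<le> G x" if z: "(z', s') \<in> K" for z' s'
      using *[OF _ z] by (intro G_ge xy) (simp add: algebra_simps)
    then have "G (x \<oplus> y) - G x \<le> G y"
      by (intro G_ge xy) (simp add: algebra_simps)
    then show "G (x \<oplus> y) \<le> G x + G y" by simp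
  next
    fix t :: real and x assume t: "0 < t" and x: "x \<in> carrier V"
    have "G (of_real t \<odot> x) / t \<le> G x"
    proof (rule G_ge[OF x])
      fix z s assume z: "(z, s) \<in> K"
      have "G (of_real t \<odot> x) \<le> p (of_real t \<odot> x \<oplus> of_real t \<odot> z) - t * s"
        using z x K(4)[OF t z] by (intro G_le) auto
      also have "of_real t \<odot> x \<oplus> of_real t \<odot> z = of_real t \<odot> (x \<oplus> z)"
        using x Kc[OF z] by (simp add: smult_add_right)
      also have "p \<dots> = t * p (x \<oplus> z)"
        using t x Kc[OF z] by (intro sublinear_scale[OF p]) auto
      finally show "G (of_real t \<odot> x) / t \<le> p (x \<oplus> z) - s" using t by (simp add: field_simps)
    qed
    then show "G (of_real t \<odot> x) \<le> t * G x" using t by (simp add: field_simps)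
  next
    have "0 \<le> G \<zero>" by (intro G_ge) (use le Kc in auto)
    moreover have "G \<zero> \<le> 0" using G_le_p[of \<zero>] sublinear_zero[OF p] by simp
    ultimately show "G \<zero> = 0" by simp
  qed
  moreover have "G ((- 1) \<odot> z) \<le> - s" if "(z, s) \<in> K" for z s
    using G_le[of "(- 1) \<odot> z", OF _ that] Kc[OF that] sublinear_zero[OF p] by simp
  ultimately show thesis using that G_le_p by blast
qed

text \<open>Convolving q with the ray through (y, q y) gives a sublinear function below q whose
  value at -y is at most - q y. By minimality it equals q, so q (-y) = - q y. Then q x \<le> q (-y)
  + q (x + y) is the missing half of additivity.\<close>

lemma sublinear_minimal_additive:
  assumes q: "sublinear q"
    and min: "\<And>r x. sublinear r \<Longrightarrow> (\<And>y. y \<in> carrier V \<Longrightarrow> r y \<le> q y) \<Longrightarrow> x \<in> carrier V \<Longrightarrow> r x = q x"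
    and x: "x \<in> carrier V" and y: "y \<in> carrier V"
  shows "q ((- 1) \<odot> y) = - q y" "q (x \<oplus> y) = q x + q y"
proof -
  have neg: "q ((- 1) \<odot> y) = - q y" if y: "y \<in> carrier V" for y
  proof -
    define K where "K = {(of_real t \<odot> y, t * q y) | t. 0 \<le> t}"
    obtain r where r: "sublinear r" "\<And>x. x \<in> carrier V \<Longrightarrow> r x \<le> q x"
      "\<And>z s. (z, s) \<in> K \<Longrightarrow> r ((- 1) \<odot> z) \<le> - s"
    proof (rule infimal_convolution[OF q, of K])
      show "(\<zero>, 0) \<in> K" using y by (auto simp: K_def intro!: exI[of _ 0])
      show "(z \<oplus> z', s + s') \<in> K" if "(z, s) \<in> K" "(z', s') \<in> K" for z s z' s'
      proof -
        obtain t t' where "z = of_real t \<odot> y" "s = t * q y" "0 \<le> t" "z' = of_real t' \<odot> y" "s' = t' * q y" "0 \<le> t'"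
          using \<open>(z, s) \<in> K\<close> \<open>(z', s') \<in> K\<close> by (auto simp: K_def)
        then show ?thesis
          unfolding K_def using y
          by (auto simp: smult_add_left distrib_right add_comm[of "of_real t \<odot> y"] intro!: exI[of _ "t' + t"])
      qed
      show "(of_real t \<odot> z, t * s) \<in> K" if "0 < t" "(z, s) \<in> K" for t z s
      proof -
        obtain t' where "z = of_real t' \<odot> y" "s = t' * q y" "0 \<le> t'"
          using \<open>(z, s) \<in> K\<close> by (auto simp: K_def)
        then show ?thesis
          unfolding K_def using y \<open>0 < t\<close> by (auto intro!: exI[of _ "t * t'"])
      qed
    qed (use y sublinear_scale[OF q] in \<open>auto simp: K_def\<close>)
    have "r ((- 1) \<odot> y) \<le> - q y"
      by (rule r(3)) (use y in \<open>auto simp: K_def intro!: exI[of _ 1]\<close>)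
    then have "q ((- 1) \<odot> y) \<le> - q y"
      using min[OF r(1,2), of "(- 1) \<odot> y"] y by simp
    then show ?thesis using sublinear_neg[OF q y] by simp
  qed
  show "q ((- 1) \<odot> y) = - q y" using neg[OF y] .
  have "q x = q ((- 1) \<odot> y \<oplus> (y \<oplus> x))" using x y by simp
  also have "\<dots> \<le> q ((- 1) \<odot> y) + q (y \<oplus> x)" using x y by (intro sublinear_add[OF q]) auto
  finally show "q (x \<oplus> y) = q x + q y"
    using neg[OF y] sublinear_add[OF q x y] x y by (simp add: add_comm)
qed

text \<open>A minimal sublinear function below the infimal convolution \<open>G\<close> is linear,
  and evaluating at -z turns the bound on \<open>G\<close> into s \<le> \<rho> z. In
  \<open>hahn_banach\<close> the cone \<open>K\<close> is the graph of a real functional carried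
  over by a map, in \<open>functional_split\<close> it is a hypograph.\<close>

lemma real_hahn_banach:
  assumes p: "sublinear p"
    and K: "K \<subseteq> carrier V \<times> UNIV" "(\<zero>, 0) \<in> K"
      "\<And>z s z' s'. (z, s) \<in> K \<Longrightarrow> (z', s') \<in> K \<Longrightarrow> (z \<oplus> z', s + s') \<in> K"
      "\<And>t z s. 0 < t \<Longrightarrow> (z, s) \<in> K \<Longrightarrow> (of_real t \<odot> z, t * s) \<in> K"
    and le: "\<And>z s. (z, s) \<in> K \<Longrightarrow> s \<le> p z"
  obtains \<rho> where "\<And>x y. x \<in> carrier V \<Longrightarrow> y \<in> carrier V \<Longrightarrow> \<rho> (x \<oplus> y) = \<rho> x + \<rho> y"
    "\<And>t x. x \<in> carrier V \<Longrightarrow> \<rho> (of_real t \<odot> x) = t * \<rho> x"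
    "\<And>x. x \<in> carrier V \<Longrightarrow> \<rho> x \<le> p x" "\<And>z s. (z, s) \<in> K \<Longrightarrow> s \<le> \<rho> z"
proof -
  obtain G where G: "sublinear G" "\<And>x. x \<in> carrier V \<Longrightarrow> G x \<le> p x"
    "\<And>z s. (z, s) \<in> K \<Longrightarrow> G ((- 1) \<odot> z) \<le> - s"
    using infimal_convolution[OF assms] by blast
  obtain q where q: "sublinear q" "\<And>x. x \<in> carrier V \<Longrightarrow> q x \<le> G x"
    and min: "\<And>r x. sublinear r \<Longrightarrow> (\<And>y. y \<in> carrier V \<Longrightarrow> r y \<le> q y) \<Longrightarrow> x \<in> carrier V \<Longrightarrow> r x = q x"
    using minimal_sublinear[OF G(1)] by blast
  have neg: "q ((- 1) \<odot> y) = - q y" if "y \<in> carrier V" for y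
    by (rule sublinear_minimal_additive(1)[OF q(1) _ that that]) (rule min, assumption+)
  have add: "q (x \<oplus> y) = q x + q y" if "x \<in> carrier V" "y \<in> carrier V" for x y
    by (rule sublinear_minimal_additive(2)[OF q(1) _ that]) (rule min, assumption+)
  show thesis
  proof (rule that[of q])
    fix t x assume x: "x \<in> carrier V"
    show "q (of_real t \<odot> x) = t * q x"
    proof (cases "0 \<le> t")
      case False
      then have "q (of_real (- t) \<odot> x) = (- t) * q x"
        by (intro sublinear_scale q x) auto
      moreover have "q ((- 1) \<odot> (of_real (- t) \<odot> x)) = - q (of_real (- t) \<odot> x)"
        using x by (intro neg) simp
      then have "q (of_real t \<odot> x) = - q (of_real (- t) \<odot> x)"
        using x by simp
      ultimately show ?thesis by simp
    qed (use sublinear_scale[OF q(1)] x in simp)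
  next
    fix z s assume z: "(z, s) \<in> K"
    then have "z \<in> carrier V" using K(1) by auto
    then show "s \<le> q z"
      using q(2)[of "(- 1) \<odot> z"] G(3)[OF z] neg[of z] by simp
  qed (use add order_trans[OF q(2) G(2)] in auto)
qed

end


section \<open>Seminorms and the Hahn-Banach theorem over the ground field\<close>

definition seminorms :: "('k::real_or_complex, 'v) module \<Rightarrow> ('v \<Rightarrow> real) set" where
  "seminorms V = {p. (\<forall>x\<in>carrier V. \<forall>y\<in>carrier V. p (x \<oplus>\<^bsub>V\<^esub> y) \<le> p x + p y) \<and>
     (\<forall>c. \<forall>x\<in>carrier V. p (c \<odot>\<^bsub>V\<^esub> x) = norm c * p x)}"

lemma seminorm_add: "p \<in> seminorms V \<Longrightarrow> x \<in> carrier V \<Longrightarrow> y \<in> carrier V \<Longrightarrow> p (x \<oplus>\<^bsub>V\<^esub> y) \<le> p x + p y"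
  and seminorm_scale: "p \<in> seminorms V \<Longrightarrow> x \<in> carrier V \<Longrightarrow> p (c \<odot>\<^bsub>V\<^esub> x) = norm c * p x"
  by (auto simp: seminorms_def)

lemma linear_maps_add: "f \<in> linear_maps V W \<Longrightarrow> x \<in> carrier V \<Longrightarrow> y \<in> carrier V \<Longrightarrow> f (x \<oplus>\<^bsub>V\<^esub> y) = f x \<oplus>\<^bsub>W\<^esub> f y"
  and linear_maps_scale: "f \<in> linear_maps V W \<Longrightarrow> x \<in> carrier V \<Longrightarrow> f (c \<odot>\<^bsub>V\<^esub> x) = c \<odot>\<^bsub>W\<^esub> f x"
  and linear_maps_closed: "f \<in> linear_maps V W \<Longrightarrow> x \<in> carrier V \<Longrightarrow> f x \<in> carrier W"
  and linear_maps_extensional: "f \<in> linear_maps V W \<Longrightarrow> f \<in> extensional (carrier V)"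
  by (auto simp: linear_maps_def PiE_iff)

lemma linear_mapsI:
  assumes "f \<in> extensional (carrier V)" "\<And>x. x \<in> carrier V \<Longrightarrow> f x \<in> carrier W"
    and "\<And>x y. x \<in> carrier V \<Longrightarrow> y \<in> carrier V \<Longrightarrow> f (x \<oplus>\<^bsub>V\<^esub> y) = f x \<oplus>\<^bsub>W\<^esub> f y"
    and "\<And>c x. x \<in> carrier V \<Longrightarrow> f (c \<odot>\<^bsub>V\<^esub> x) = c \<odot>\<^bsub>W\<^esub> f x"
  shows "f \<in> linear_maps V W"
  using assms by (auto simp: linear_maps_def PiE_iff)

lemma linear_maps_zero:
  assumes "vspace V" "vspace W" "f \<in> linear_maps V W"
  shows "f \<zero>\<^bsub>V\<^esub> = \<zero>\<^bsub>W\<^esub>"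
proof -
  interpret V: vspace V by fact
  interpret W: vspace W by fact
  have "f (0 \<odot>\<^bsub>V\<^esub> \<zero>\<^bsub>V\<^esub>) = 0 \<odot>\<^bsub>W\<^esub> f \<zero>\<^bsub>V\<^esub>"
    using assms(3) by (intro linear_maps_scale) auto
  then show ?thesis using assms(3) by (simp add: linear_maps_closed)
qed

context vspace
begin

lemma seminorm_zero: "p \<in> seminorms V \<Longrightarrow> p \<zero> = 0"
  using seminorm_scale[of p V \<zero> 0] by simp

lemma seminorm_neg: "p \<in> seminorms V \<Longrightarrow> x \<in> carrier V \<Longrightarrow> p ((- 1) \<odot> x) = p x"
  using seminorm_scale[of p V x "- 1"] by simp

lemma seminorm_nonneg:
  assumes "p \<in> seminorms V" "x \<in> carrier V"
  shows "0 \<le> p x"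
  using seminorm_add[OF assms(1), of x "(- 1) \<odot> x"] assms by (simp add: seminorm_neg seminorm_zero)

lemma seminorm_sublinear: "p \<in> seminorms V \<Longrightarrow> sublinear p"
  by (auto simp: sublinear_def seminorms_def)

lemma seminorms_plus:
  "p \<in> seminorms V \<Longrightarrow> q \<in> seminorms V \<Longrightarrow> (\<lambda>x. p x + q x) \<in> seminorms V"
  unfolding seminorms_def by (auto simp: distrib_left) (smt (verit))

lemma functional_zero: "\<phi> \<in> linear_maps V scalars \<Longrightarrow> \<phi> \<zero> = 0"
  using linear_maps_scale[of \<phi> V scalars \<zero> 0] by simp

lemma seminorms_zero: "(\<lambda>x. 0) \<in> seminorms V"
  by (auto simp: seminorms_def)

lemma seminorms_times: "p \<in> seminorms V \<Longrightarrow> 0 \<le> r \<Longrightarrow> (\<lambda>x. r * p x) \<in> seminorms V"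
  by (auto simp: seminorms_def simp flip: distrib_left intro: mult_left_mono)

lemma seminorms_functional: "\<phi> \<in> linear_maps V scalars \<Longrightarrow> (\<lambda>x. norm (\<phi> x)) \<in> seminorms V"
  by (auto simp: seminorms_def linear_maps_add linear_maps_scale norm_mult norm_triangle_ineq)

lemma seminorms_comp:
  "f \<in> linear_maps V U \<Longrightarrow> p \<in> seminorms U \<Longrightarrow> (\<lambda>x. p (f x)) \<in> seminorms V"
  by (auto simp: seminorms_def linear_maps_add linear_maps_scale linear_maps_closed)

text \<open>Multiplying x by a scalar c of norm 1 makes \<omega> (c x) equal to the norm of \<omega>
  x and leaves p unchanged.\<close>

lemma norm_le_if_re_le:
  assumes "real_part re j" and \<omega>: "\<omega> \<in> linear_maps V scalars" and p: "p \<in> seminorms V"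
    and le: "\<And>x. x \<in> carrier V \<Longrightarrow> re (\<omega> x) \<le> p x" and x: "x \<in> carrier V"
  shows "norm (\<omega> x) \<le> p x"
proof (cases "\<omega> x = 0")
  case False
  interpret real_part re j by fact
  define c where "c = of_real (norm (\<omega> x)) / \<omega> x"
  have "norm c = 1" using False by (simp add: c_def norm_divide)
  have "\<omega> (c \<odot> x) = of_real (norm (\<omega> x))"
    using linear_maps_scale[OF \<omega> x, of c] False by (simp add: c_def)
  then have "norm (\<omega> x) = re (\<omega> (c \<odot> x))"
    using re_scale[of "norm (\<omega> x)" 1] re_one by simp
  also have "\<dots> \<le> p (c \<odot> x)" using x by (intro le) auto
  also have "\<dots> = p x" using seminorm_scale[OF p x] \<open>norm c = 1\<close> by simp
  finally show ?thesis .
qed (use seminorm_nonneg[OF p x] in simp)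

text \<open>The formula of Bohnenblust and Sobczyk, \<psi> x = \<rho> x - i \<rho> (i x), with
  \<open>j\<close> in place of i. For j = 0 the second term vanishes. Homogeneity is checked for
  real scalars and for \<open>j\<close>, which suffices by \<open>coordinates\<close>.\<close>

lemma complexification:
  assumes "real_part re j" and p: "p \<in> seminorms V"
    and \<rho>: "\<And>x y. x \<in> carrier V \<Longrightarrow> y \<in> carrier V \<Longrightarrow> \<rho> (x \<oplus> y) = \<rho> x + \<rho> y"
      "\<And>t x. x \<in> carrier V \<Longrightarrow> \<rho> (of_real t \<odot> x) = t * \<rho> x"
      "\<And>x. x \<in> carrier V \<Longrightarrow> \<rho> x \<le> p x"
  obtains \<psi> where "\<psi> \<in> linear_maps V scalars" "\<And>x. x \<in> carrier V \<Longrightarrow> norm (\<psi> x) \<le> p x"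
    "\<And>x. x \<in> carrier V \<Longrightarrow> re (\<psi> x) = \<rho> x"
    "\<And>x. x \<in> carrier V \<Longrightarrow> \<psi> x = of_real (\<rho> x) - of_real (\<rho> (j \<odot> x)) * j"
proof -
  interpret real_part re j by fact
  define \<psi> where "\<psi> = (\<lambda>x\<in>carrier V. of_real (\<rho> x) - of_real (\<rho> (j \<odot> x)) * j)"
  have add: "\<psi> (x \<oplus> y) = \<psi> x + \<psi> y" if "x \<in> carrier V" "y \<in> carrier V" for x y
    using that by (simp add: \<psi>_def \<rho> smult_add_right algebra_simps)
  have real: "\<psi> (of_real t \<odot> x) = of_real t * \<psi> x" if "x \<in> carrier V" for t x
  proof -
    have "j \<odot> (of_real t \<odot> x) = of_real t \<odot> (j \<odot> x)" using that by (simp add: mult.commute)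
    then have "\<rho> (j \<odot> (of_real t \<odot> x)) = t * \<rho> (j \<odot> x)" using that \<rho>(2) by (metis smult_closed)
    then show ?thesis
      using that \<rho>(2)[OF that] by (simp add: \<psi>_def algebra_simps)
  qed
  have \<rho>_zero: "\<rho> \<zero> = 0" using \<rho>(2)[of \<zero> 0] by simp
  have jmult: "\<psi> (j \<odot> x) = j * \<psi> x" if x: "x \<in> carrier V" for x
    using j
  proof
    assume j: "j * j = - 1"
    have "\<rho> ((j * j) \<odot> x) = - \<rho> x" using \<rho>(2)[OF x, of "- 1"] j by simp
    moreover have "j * (of_real a - of_real b * j) = of_real a * j - of_real b * (j * j)" for a b
      by (simp only: algebra_simps)
    ultimately show ?thesis using x by (simp add: \<psi>_def j)
  qed (use x \<rho>_zero in \<open>simp add: \<psi>_def\<close>)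
  have scale: "\<psi> (c \<odot> x) = c * \<psi> x" if x: "x \<in> carrier V" for c x
  proof -
    obtain a b where c: "c = of_real a + of_real b * j"
    proof
      show "c = of_real (re c) + of_real (- re (j * c)) * j"
        by (simp flip: coordinates)
    qed
    have "\<psi> (c \<odot> x) = \<psi> (of_real a \<odot> x \<oplus> of_real b \<odot> (j \<odot> x))"
      using x by (simp add: c smult_add_left)
    also have "\<dots> = c * \<psi> x"
      using x by (simp add: add real jmult del: smult_smult) (simp add: c algebra_simps)
    finally show ?thesis .
  qed
  have lin: "\<psi> \<in> linear_maps V scalars"
    by (rule linear_mapsI) (auto simp: add scale, simp add: \<psi>_def)
  have re_\<psi>: "re (\<psi> x) = \<rho> x" if "x \<in> carrier V" for x
  proof -
    have "re (\<psi> x) = re (of_real (\<rho> x) * 1 + of_real (- \<rho> (j \<odot> x)) * j)"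
      using that by (simp add: \<psi>_def)
    then show ?thesis by (simp add: re_add re_scale re_one re_j del: mult_1_right of_real_minus)
  qed
  show thesis
  proof (rule that[of \<psi>])
    show "norm (\<psi> x) \<le> p x" if "x \<in> carrier V" for x
      by (rule norm_le_if_re_le[OF assms(1) lin p _ that]) (simp add: re_\<psi> \<rho>(3))
  qed (use lin re_\<psi> in \<open>auto simp: \<psi>_def\<close>)
qed

text \<open>Extension along f instead of from a subspace. Injectivity is no issue: where f x = 0,
  the bound by p (f x) forces \<phi> x = 0. The real functional lies above the image
  \<open>K\<close> of the graph of re \<phi>.\<close>

lemma hahn_banach:
  assumes "vspace M" and f: "f \<in> linear_maps M V" and p: "p \<in> seminorms V"
    and \<phi>: "\<phi> \<in> linear_maps M scalars" and le: "\<And>x. x \<in> carrier M \<Longrightarrow> norm (\<phi> x) \<le> p (f x)"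
  obtains \<psi> where "\<psi> \<in> linear_maps V scalars" "\<And>x. x \<in> carrier V \<Longrightarrow> norm (\<psi> x) \<le> p x"
    "\<And>x. x \<in> carrier M \<Longrightarrow> \<psi> (f x) = \<phi> x"
proof -
  interpret M: vspace M by fact
  obtain re :: "'k \<Rightarrow> real" and j where "real_part re j" by (rule real_part_exists)
  interpret real_part re j by fact
  define K where "K = {(f x, re (\<phi> x)) | x. x \<in> carrier M}"
  have re_zero: "re 0 = 0" using re_add[of 0 0] by simp
  have re_minus: "re (- a) = - re a" for a using re_add[of a "- a"] re_zero by simp
  obtain \<rho> where \<rho>: "\<And>x y. x \<in> carrier V \<Longrightarrow> y \<in> carrier V \<Longrightarrow> \<rho> (x \<oplus> y) = \<rho> x + \<rho> y"
    "\<And>t x. x \<in> carrier V \<Longrightarrow> \<rho> (of_real t \<odot> x) = t * \<rho> x"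
    "\<And>x. x \<in> carrier V \<Longrightarrow> \<rho> x \<le> p x" "\<And>z s. (z, s) \<in> K \<Longrightarrow> s \<le> \<rho> z"
  proof (rule real_hahn_banach[OF seminorm_sublinear[OF p], of K])
    show "(\<zero>, 0) \<in> K"
      unfolding K_def using linear_maps_zero[OF assms(1) vspace_axioms f]
        M.functional_zero[OF \<phi>] re_zero
      by (auto intro!: exI[of _ "\<zero>\<^bsub>M\<^esub>"])
    show "(z \<oplus> z', s + s') \<in> K" if z: "(z, s) \<in> K" "(z', s') \<in> K" for z s z' s'
    proof -
      obtain x x' where "z = f x" "s = re (\<phi> x)" "x \<in> carrier M" "z' = f x'" "s' = re (\<phi> x')" "x' \<in> carrier M"
        using z by (auto simp: K_def)
      then show ?thesis
        unfolding K_def using linear_maps_add[OF f] linear_maps_add[OF \<phi>] re_add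
        by (auto intro!: exI[of _ "x \<oplus>\<^bsub>M\<^esub> x'"])
    qed
    show "(of_real t \<odot> z, t * s) \<in> K" if z: "(z, s) \<in> K" for t z s
    proof -
      obtain x where "z = f x" "s = re (\<phi> x)" "x \<in> carrier M"
        using z by (auto simp: K_def)
      then show ?thesis
        unfolding K_def using linear_maps_scale[OF f] linear_maps_scale[OF \<phi>] re_scale
        by (auto intro!: exI[of _ "of_real t \<odot>\<^bsub>M\<^esub> x"])
    qed
    show "s \<le> p z" if "(z, s) \<in> K" for z s
      using that order_trans[OF re_le_norm le] by (auto simp: K_def)
  qed (use linear_maps_closed[OF f] in \<open>auto simp: K_def\<close>)
  \<comment> \<open>\<open>K\<close> contains the pairs of both x and -x, so the one-sided bound
    becomes an equality.\<close>
  have eq: "\<rho> (f x) = re (\<phi> x)" if x: "x \<in> carrier M" for x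
  proof (rule order_antisym)
    have "re (\<phi> ((- 1) \<odot>\<^bsub>M\<^esub> x)) \<le> \<rho> (f ((- 1) \<odot>\<^bsub>M\<^esub> x))"
      using x by (intro \<rho>(4)) (auto simp: K_def)
    moreover have "\<rho> (f ((- 1) \<odot>\<^bsub>M\<^esub> x)) = - \<rho> (f x)"
      using \<rho>(2)[of "f x" "- 1"] linear_maps_closed[OF f x] linear_maps_scale[OF f x] by simp
    ultimately show "\<rho> (f x) \<le> re (\<phi> x)"
      using linear_maps_scale[OF \<phi> x, of "- 1"] re_minus by simp
    show "re (\<phi> x) \<le> \<rho> (f x)" using x by (intro \<rho>(4)) (auto simp: K_def)
  qed
  obtain \<psi> where \<psi>: "\<psi> \<in> linear_maps V scalars" "\<And>x. x \<in> carrier V \<Longrightarrow> norm (\<psi> x) \<le> p x"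
    "\<And>x. x \<in> carrier V \<Longrightarrow> re (\<psi> x) = \<rho> x"
    "\<And>x. x \<in> carrier V \<Longrightarrow> \<psi> x = of_real (\<rho> x) - of_real (\<rho> (j \<odot> x)) * j"
    by (rule complexification[OF \<open>real_part re j\<close> p \<rho>(1,2,3)]) (assumption+, rule that)
  have "\<psi> (f x) = \<phi> x" if x: "x \<in> carrier M" for x
  proof -
    have "j \<odot> f x = f (j \<odot>\<^bsub>M\<^esub> x)" using linear_maps_scale[OF f x] by simp
    then have "\<psi> (f x) = of_real (re (\<phi> x)) - of_real (re (\<phi> (j \<odot>\<^bsub>M\<^esub> x))) * j"
      using \<psi>(4)[OF linear_maps_closed[OF f x]] eq x by simp
    also have "\<dots> = \<phi> x" using linear_maps_scale[OF \<phi> x, of j] by (simp flip: coordinates)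
    finally show ?thesis .
  qed
  then show thesis using that \<psi>(1,2) by blast
qed

text \<open>The superlinear function re \<phi> - q lies below p. A real functional \<rho> between
  the two satisfies \<rho> \<le> p and re \<phi> - \<rho> \<le> q, so its complexification \<psi>
  and \<phi> - \<psi> are the two parts.\<close>

lemma functional_split:
  assumes p: "p \<in> seminorms V" and q: "q \<in> seminorms V"
    and \<phi>: "\<phi> \<in> linear_maps V scalars" and le: "\<And>x. x \<in> carrier V \<Longrightarrow> norm (\<phi> x) \<le> p x + q x"
  obtains \<psi> \<omega> where "\<psi> \<in> linear_maps V scalars" "\<And>x. x \<in> carrier V \<Longrightarrow> norm (\<psi> x) \<le> p x"
    "\<omega> \<in> linear_maps V scalars" "\<And>x. x \<in> carrier V \<Longrightarrow> norm (\<omega> x) \<le> q x"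
    "\<And>x. x \<in> carrier V \<Longrightarrow> \<phi> x = \<psi> x + \<omega> x"
proof -
  obtain re :: "'k \<Rightarrow> real" and j where "real_part re j" by (rule real_part_exists)
  interpret real_part re j by fact
  have re_zero: "re 0 = 0" using re_add[of 0 0] by simp
  have re_diff: "re (a - b) = re a - re b" for a b using re_add[of "a - b" b] by simp
  define K where "K = {(x, s) | x s. x \<in> carrier V \<and> s \<le> re (\<phi> x) - q x}"
  obtain \<rho> where \<rho>: "\<And>x y. x \<in> carrier V \<Longrightarrow> y \<in> carrier V \<Longrightarrow> \<rho> (x \<oplus> y) = \<rho> x + \<rho> y"
    "\<And>t x. x \<in> carrier V \<Longrightarrow> \<rho> (of_real t \<odot> x) = t * \<rho> x"
    "\<And>x. x \<in> carrier V \<Longrightarrow> \<rho> x \<le> p x" "\<And>z s. (z, s) \<in> K \<Longrightarrow> s \<le> \<rho> z"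
  proof (rule real_hahn_banach[OF seminorm_sublinear[OF p], of K])
    show "(\<zero>, 0) \<in> K"
      unfolding K_def by (simp add: functional_zero[OF \<phi>] re_zero seminorm_zero[OF q])
    show "(z \<oplus> z', s + s') \<in> K" if "(z, s) \<in> K" "(z', s') \<in> K" for z s z' s'
      using that linear_maps_add[OF \<phi>, of z z'] re_add seminorm_add[OF q, of z z']
      by (auto simp: K_def)
    show "(of_real t \<odot> z, t * s) \<in> K" if t: "0 < t" and z: "(z, s) \<in> K" for t z s
    proof -
      have "t * s \<le> t * (re (\<phi> z) - q z)" using t z by (auto simp: K_def)
      then show ?thesis
        using t z linear_maps_scale[OF \<phi>, of z "of_real t"] re_scale[of t "\<phi> z"] seminorm_scale[OF q, of z "of_real t"]
        by (auto simp: K_def algebra_simps)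
    qed
    show "s \<le> p z" if "(z, s) \<in> K" for z s
      using that le[of z] re_le_norm[of "\<phi> z"] by (auto simp: K_def)
  qed (auto simp: K_def)
  obtain \<psi> where \<psi>: "\<psi> \<in> linear_maps V scalars" "\<And>x. x \<in> carrier V \<Longrightarrow> norm (\<psi> x) \<le> p x"
    "\<And>x. x \<in> carrier V \<Longrightarrow> re (\<psi> x) = \<rho> x"
    by (rule complexification[OF \<open>real_part re j\<close> p \<rho>(1,2,3)]) (assumption+, rule that)
  define \<omega> where "\<omega> = (\<lambda>x\<in>carrier V. \<phi> x - \<psi> x)"
  have \<omega>: "\<omega> \<in> linear_maps V scalars"
    by (rule linear_mapsI)
      (auto simp: \<omega>_def linear_maps_add[OF \<phi>] linear_maps_add[OF \<psi>(1)] linear_maps_scale[OF \<phi>]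
        linear_maps_scale[OF \<psi>(1)] algebra_simps)
  have le_q: "norm (\<omega> x) \<le> q x" if "x \<in> carrier V" for x
  proof (rule norm_le_if_re_le[OF \<open>real_part re j\<close> \<omega> q _ that])
    fix y assume y: "y \<in> carrier V"
    have "re (\<phi> y) - q y \<le> \<rho> y" using y by (intro \<rho>(4)) (auto simp: K_def)
    then show "re (\<omega> y) \<le> q y" using y by (simp add: \<omega>_def re_diff \<psi>(3))
  qed
  show thesis
    by (rule that[OF \<psi>(1,2) \<omega> le_q]) (simp_all add: \<omega>_def)
qed

end

section \<open>Topologies defined by ideals of seminorms\<close>

text \<open>The abstract form of the set of all continuous seminorms, as opposed to a generating
  family. Sums are common upper bounds, so that a single seminorm describes a basic neighbourhood.
  The last clause compares on the carrier only, hence membership does not depend on values outside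
  it.\<close>

definition seminorm_ideal :: "('k::real_or_complex, 'v) module \<Rightarrow> ('v \<Rightarrow> real) set \<Rightarrow> bool" where
  "seminorm_ideal V S \<longleftrightarrow> S \<subseteq> seminorms V \<and> (\<lambda>x. 0) \<in> S \<and>
     (\<forall>p\<in>S. \<forall>q\<in>S. (\<lambda>x. p x + q x) \<in> S) \<and>
     (\<forall>p\<in>S. \<forall>q\<in>seminorms V. (\<forall>x\<in>carrier V. q x \<le> p x) \<longrightarrow> q \<in> S)"

definition separating :: "('k::real_or_complex, 'v) module \<Rightarrow> ('v \<Rightarrow> real) set \<Rightarrow> bool" where
  "separating V S \<longleftrightarrow> (\<forall>x\<in>carrier V. x \<noteq> \<zero>\<^bsub>V\<^esub> \<longrightarrow> (\<exists>p\<in>S. p x \<noteq> 0))"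

text \<open>Radius 1 suffices because ideals are closed under nonnegative multiples
  (\<open>times_in\<close>).\<close>

definition seminorm_topology :: "('k::real_or_complex, 'v) module \<Rightarrow> ('v \<Rightarrow> real) set \<Rightarrow> 'v topology" where
  "seminorm_topology V S = topology (\<lambda>U. U \<subseteq> carrier V \<and>
     (\<forall>x\<in>U. \<exists>p\<in>S. \<forall>z\<in>carrier V. p z < 1 \<longrightarrow> x \<oplus>\<^bsub>V\<^esub> z \<in> U))"

locale ideal_space = vspace V for V :: "('k::real_or_complex, 'v) module" (structure) +
  fixes S :: "('v \<Rightarrow> real) set"
  assumes ideal: "seminorm_ideal V S"
begin

lemma is_seminorm: "p \<in> S \<Longrightarrow> p \<in> seminorms V"
  and zero_in: "(\<lambda>x. 0) \<in> S"
  and plus_in: "p \<in> S \<Longrightarrow> q \<in> S \<Longrightarrow> (\<lambda>x. p x + q x) \<in> S"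
  and dominated_in: "p \<in> S \<Longrightarrow> q \<in> seminorms V \<Longrightarrow> (\<And>x. x \<in> carrier V \<Longrightarrow> q x \<le> p x) \<Longrightarrow> q \<in> S"
  using ideal by (auto simp: seminorm_ideal_def)

text \<open>Natural multiples are repeated sums, and the multiple by r is dominated by the one by
  the ceiling of r.\<close>

lemma times_in:
  assumes p: "p \<in> S" and r: "0 \<le> r"
  shows "(\<lambda>x. r * p x) \<in> S"
proof -
  have "(\<lambda>x. of_nat n * p x) \<in> S" for n
    by (induction n) (use zero_in plus_in p in \<open>auto simp: algebra_simps\<close>)
  then show ?thesis
  proof (rule dominated_in)
    show "(\<lambda>x. r * p x) \<in> seminorms V" using p r by (intro seminorms_times is_seminorm)
    show "r * p x \<le> of_nat (nat \<lceil>r\<rceil>) * p x" if "x \<in> carrier V" for x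
      by (intro mult_right_mono seminorm_nonneg[OF is_seminorm[OF p]] that) linarith
  qed
qed

lemma openin_iff:
  "openin (seminorm_topology V S) U \<longleftrightarrow>
     U \<subseteq> carrier V \<and> (\<forall>x\<in>U. \<exists>p\<in>S. \<forall>z\<in>carrier V. p z < 1 \<longrightarrow> x \<oplus> z \<in> U)"
proof -
  have "istopology (\<lambda>U. U \<subseteq> carrier V \<and> (\<forall>x\<in>U. \<exists>p\<in>S. \<forall>z\<in>carrier V. p z < 1 \<longrightarrow> x \<oplus> z \<in> U))"
    unfolding istopology_def
  proof (intro conjI allI impI)
    fix U U' assume U: "U \<subseteq> carrier V \<and> (\<forall>x\<in>U. \<exists>p\<in>S. \<forall>z\<in>carrier V. p z < 1 \<longrightarrow> x \<oplus> z \<in> U)"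
      and U': "U' \<subseteq> carrier V \<and> (\<forall>x\<in>U'. \<exists>p\<in>S. \<forall>z\<in>carrier V. p z < 1 \<longrightarrow> x \<oplus> z \<in> U')"
    show "\<forall>x\<in>U \<inter> U'. \<exists>p\<in>S. \<forall>z\<in>carrier V. p z < 1 \<longrightarrow> x \<oplus> z \<in> U \<inter> U'"
    proof
      fix x assume "x \<in> U \<inter> U'"
      then obtain p q where p: "p \<in> S" "\<forall>z\<in>carrier V. p z < 1 \<longrightarrow> x \<oplus> z \<in> U"
        and q: "q \<in> S" "\<forall>z\<in>carrier V. q z < 1 \<longrightarrow> x \<oplus> z \<in> U'"
        using U U' by blast
      have "\<forall>z\<in>carrier V. p z + q z < 1 \<longrightarrow> x \<oplus> z \<in> U \<inter> U'"
      proof (intro ballI impI)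
        fix z assume "z \<in> carrier V" "p z + q z < 1"
        moreover have "0 \<le> p z" "0 \<le> q z" using p(1) q(1) \<open>z \<in> carrier V\<close>
          by (auto intro: seminorm_nonneg is_seminorm)
        ultimately show "x \<oplus> z \<in> U \<inter> U'" using p(2) q(2) by auto
      qed
      then show "\<exists>p\<in>S. \<forall>z\<in>carrier V. p z < 1 \<longrightarrow> x \<oplus> z \<in> U \<inter> U'"
        by (rule bexI[OF _ plus_in[OF p(1) q(1)]])
    qed
  next
    fix \<K> assume *: "\<forall>U\<in>\<K>. U \<subseteq> carrier V \<and> (\<forall>x\<in>U. \<exists>p\<in>S. \<forall>z\<in>carrier V. p z < 1 \<longrightarrow> x \<oplus> z \<in> U)"
    then show "\<Union>\<K> \<subseteq> carrier V" by blast
    show "\<forall>x\<in>\<Union>\<K>. \<exists>p\<in>S. \<forall>z\<in>carrier V. p z < 1 \<longrightarrow> x \<oplus> z \<in> \<Union>\<K>"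
    proof
      fix x assume "x \<in> \<Union>\<K>"
      then obtain U where U: "U \<in> \<K>" "x \<in> U" by blast
      then obtain p where "p \<in> S" "\<forall>z\<in>carrier V. p z < 1 \<longrightarrow> x \<oplus> z \<in> U" using * by blast
      then show "\<exists>p\<in>S. \<forall>z\<in>carrier V. p z < 1 \<longrightarrow> x \<oplus> z \<in> \<Union>\<K>" using U(1) by blast
    qed
  qed blast
  then show ?thesis by (simp add: seminorm_topology_def)
qed

lemma topspace: "topspace (seminorm_topology V S) = carrier V"
proof
  have "openin (seminorm_topology V S) (carrier V)"
    using zero_in by (auto simp: openin_iff)
  then show "carrier V \<subseteq> topspace (seminorm_topology V S)" by (rule openin_subset)
  show "topspace (seminorm_topology V S) \<subseteq> carrier V"
    using openin_topspace[of "seminorm_topology V S"] unfolding openin_iff by blast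
qed

definition nbhd :: "'v \<Rightarrow> ('v \<Rightarrow> real) \<Rightarrow> 'v set" where
  "nbhd x p = {x \<oplus> z | z. z \<in> carrier V \<and> p z < 1}"

lemma nbhd_self: "x \<in> carrier V \<Longrightarrow> p \<in> S \<Longrightarrow> x \<in> nbhd x p"
  unfolding nbhd_def by (auto intro!: exI[of _ \<zero>] simp: seminorm_zero is_seminorm)

lemma openin_nbhd:
  assumes x: "x \<in> carrier V" and p: "p \<in> S"
  shows "openin (seminorm_topology V S) (nbhd x p)"
  unfolding openin_iff
proof (intro conjI ballI)
  show "nbhd x p \<subseteq> carrier V" using x by (auto simp: nbhd_def)
  fix y assume "y \<in> nbhd x p"
  then obtain z where z: "y = x \<oplus> z" "z \<in> carrier V" "p z < 1" by (auto simp: nbhd_def)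
  \<comment> \<open>The factor turns \<open>p w < 1 - p z\<close>, which keeps z + w in the unit
    ball of p, into a condition with bound 1.\<close>
  define r where "r = 1 / (1 - p z)"
  have r: "0 < r" using z by (simp add: r_def)
  have "y \<oplus> w \<in> nbhd x p" if w: "w \<in> carrier V" "r * p w < 1" for w
  proof -
    have "p w < 1 - p z" using w z by (simp add: r_def field_simps)
    then have "p (z \<oplus> w) < 1" using seminorm_add[OF is_seminorm[OF p], of z w] z w by simp
    then show ?thesis
      unfolding nbhd_def using x z w by (auto intro!: exI[of _ "z \<oplus> w"] simp: add_assoc)
  qed
  then show "\<exists>q\<in>S. \<forall>w\<in>carrier V. q w < 1 \<longrightarrow> y \<oplus> w \<in> nbhd x p"
    using times_in[OF p, of r] r by (intro bexI[of _ "\<lambda>w. r * p w"]) auto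
qed

lemma seminorm_space_TVS:
  assumes sep: "separating V S"
  shows "\<lparr>vect = V, topol = seminorm_topology V S\<rparr> \<in> TVS"
proof -
  let ?T = "seminorm_topology V S"
  have add: "continuous_map (prod_topology ?T ?T) ?T (\<lambda>(x, y). x \<oplus> y)"
    unfolding continuous_map_def
  proof (intro conjI allI impI)
    fix U assume U: "openin ?T U"
    show "openin (prod_topology ?T ?T)
        {x \<in> topspace (prod_topology ?T ?T). (case x of (x, y) \<Rightarrow> x \<oplus> y) \<in> U}"
      unfolding openin_prod_topology_alt
    proof (intro allI impI)
      fix x y assume "(x, y) \<in> {x \<in> topspace (prod_topology ?T ?T). (case x of (x, y) \<Rightarrow> x \<oplus> y) \<in> U}"
      then have xy: "x \<in> carrier V" "y \<in> carrier V" "x \<oplus> y \<in> U" by (auto simp: topspace)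
      obtain p where p: "p \<in> S" "\<forall>z\<in>carrier V. p z < 1 \<longrightarrow> (x \<oplus> y) \<oplus> z \<in> U"
        using U xy(3) by (auto simp: openin_iff)
      \<comment> \<open>The factor 2 makes p smaller than 1/2 on both increments.\<close>
      define q where "q z = 2 * p z" for z
      have q: "q \<in> S" unfolding q_def using p by (intro times_in) auto
      have "a \<oplus> b \<in> U" if a: "a \<in> nbhd x q" and b: "b \<in> nbhd y q" for a b
      proof -
        obtain w where w: "a = x \<oplus> w" "w \<in> carrier V" "q w < 1" using a by (auto simp: nbhd_def)
        obtain z where z: "b = y \<oplus> z" "z \<in> carrier V" "q z < 1" using b by (auto simp: nbhd_def)
        have "p (w \<oplus> z) < 1"
          using seminorm_add[OF is_seminorm[OF p(1)] w(2) z(2)] w z by (simp add: q_def)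
        then have "(x \<oplus> y) \<oplus> (w \<oplus> z) \<in> U" using p(2) w z by blast
        then show ?thesis using w z xy by (simp add: add_ac)
      qed
      moreover have "nbhd x q \<subseteq> carrier V" "nbhd y q \<subseteq> carrier V"
        using xy by (auto simp: nbhd_def)
      ultimately show "\<exists>A B. openin ?T A \<and> openin ?T B \<and> x \<in> A \<and> y \<in> B \<and>
          A \<times> B \<subseteq> {x \<in> topspace (prod_topology ?T ?T). (case x of (x, y) \<Rightarrow> x \<oplus> y) \<in> U}"
        using openin_nbhd[OF xy(1) q] openin_nbhd[OF xy(2) q] nbhd_self[OF xy(1) q] nbhd_self[OF xy(2) q]
        by (intro exI[of _ "nbhd x q"] exI[of _ "nbhd y q"]) (auto simp: topspace)
    qed
  qed (auto simp: topspace)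
  have scale: "continuous_map (prod_topology euclidean ?T) ?T (\<lambda>(c, x). c \<odot> x)"
    unfolding continuous_map_def
  proof (intro conjI allI impI)
    fix U assume U: "openin ?T U"
    show "openin (prod_topology euclidean ?T)
        {x \<in> topspace (prod_topology euclidean ?T). (case x of (c, x) \<Rightarrow> c \<odot> x) \<in> U}"
      unfolding openin_prod_topology_alt
    proof (intro allI impI)
      fix c :: 'k and x assume "(c, x) \<in> {x \<in> topspace (prod_topology euclidean ?T). (case x of (c, x) \<Rightarrow> c \<odot> x) \<in> U}"
      then have x: "x \<in> carrier V" "c \<odot> x \<in> U" by (auto simp: topspace)
      obtain p where p: "p \<in> S" "\<forall>z\<in>carrier V. p z < 1 \<longrightarrow> (c \<odot> x) \<oplus> z \<in> U"
        using U x(2) by (auto simp: openin_iff)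
      have px: "0 \<le> p x" using seminorm_nonneg[OF is_seminorm[OF p(1)] x(1)] .
      \<comment> \<open>For a = x + z the difference d a - c x is (d - c) x + d z. The radius
        \<delta> makes the first term smaller than 1/2, and the factor in \<open>q\<close> does so
        for the second, since the norm of d is at most that of c plus 1. Adding 1 to p x allows p x
        = 0.\<close>
      define \<delta> where "\<delta> = 1 / (2 * (p x + 1))"
      have \<delta>: "0 < \<delta>" "\<delta> < 1" using px by (auto simp: \<delta>_def)
      define q where "q z = (2 * (norm c + 1)) * p z" for z
      have q: "q \<in> S" unfolding q_def using p by (intro times_in) (auto simp: add_nonneg_nonneg)
      have "d \<odot> a \<in> U" if d: "d \<in> ball c \<delta>" and a: "a \<in> nbhd x q" for d a
      proof -
        obtain z where z: "a = x \<oplus> z" "z \<in> carrier V" "q z < 1" using a by (auto simp: nbhd_def)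
        have d': "norm (d - c) < \<delta>" using d by (simp add: dist_norm norm_minus_commute)
        have "norm d \<le> norm c + norm (d - c)" by (metis add_diff_cancel_left' diff_add_cancel norm_triangle_ineq add.commute)
        then have nd: "norm d \<le> norm c + 1" using d' \<delta> by simp
        have pz: "0 \<le> p z" using seminorm_nonneg[OF is_seminorm[OF p(1)] z(2)] .
        have "p ((d - c) \<odot> x \<oplus> d \<odot> z) \<le> norm (d - c) * p x + norm d * p z"
          using seminorm_add[OF is_seminorm[OF p(1)], of "(d - c) \<odot> x" "d \<odot> z"] x z
          by (simp add: seminorm_scale[OF is_seminorm[OF p(1)]])
        also have "norm (d - c) * p x \<le> \<delta> * p x" using d' px by (intro mult_right_mono) auto
        also have "\<delta> * p x < 1 / 2" using px by (simp add: \<delta>_def field_simps)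
        also have "norm d * p z \<le> (norm c + 1) * p z" using nd pz by (intro mult_right_mono) auto
        also have "(norm c + 1) * p z < 1 / 2" using z(3) by (simp add: q_def algebra_simps)
        finally have "p ((d - c) \<odot> x \<oplus> d \<odot> z) < 1" by simp
        then have "c \<odot> x \<oplus> ((d - c) \<odot> x \<oplus> d \<odot> z) \<in> U" using p(2) x z by simp
        moreover have "c \<odot> x \<oplus> ((d - c) \<odot> x \<oplus> d \<odot> z) = d \<odot> a"
          using x z smult_add_left[of x c "d - c"]
          by (simp add: smult_add_right flip: add_assoc)
        ultimately show ?thesis by simp
      qed
      moreover have "nbhd x q \<subseteq> carrier V" using x by (auto simp: nbhd_def)
      ultimately show "\<exists>A B. openin euclidean A \<and> openin ?T B \<and> c \<in> A \<and> x \<in> B \<and>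
          A \<times> B \<subseteq> {x \<in> topspace (prod_topology euclidean ?T). (case x of (c, x) \<Rightarrow> c \<odot> x) \<in> U}"
        using openin_nbhd[OF x(1) q] nbhd_self[OF x(1) q] \<delta>
        by (intro exI[of _ "ball c \<delta>"] exI[of _ "nbhd x q"]) (auto simp: topspace)
    qed
  qed (auto simp: topspace)
  have hausdorff: "Hausdorff_space ?T"
    unfolding Hausdorff_space_def
  proof (intro allI impI)
    fix x y assume "x \<in> topspace ?T \<and> y \<in> topspace ?T \<and> x \<noteq> y"
    then have xy: "x \<in> carrier V" "y \<in> carrier V" "x \<noteq> y" by (auto simp: topspace)
    then have "x \<oplus> (- 1) \<odot> y \<noteq> \<zero>" using diff_eq_zero by blast
    then obtain p where p: "p \<in> S" "p (x \<oplus> (- 1) \<odot> y) \<noteq> 0"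
      using sep xy by (auto simp: separating_def)
    note p' = is_seminorm[OF p(1)]
    define d where "d = p (x \<oplus> (- 1) \<odot> y)"
    have d: "0 < d" using p(2) seminorm_nonneg[OF p', of "x \<oplus> (- 1) \<odot> y"] xy by (simp add: d_def)
    \<comment> \<open>A common point of the two neighbourhoods would give d \<le> p z + p w, while
      the factor 2/d forces both terms below d/2.\<close>
    define q where "q z = (2 / d) * p z" for z
    have q: "q \<in> S" unfolding q_def using p d by (intro times_in) auto
    have "nbhd x q \<inter> nbhd y q = {}"
    proof (rule ccontr)
      assume "nbhd x q \<inter> nbhd y q \<noteq> {}"
      then obtain w z where w: "w \<in> carrier V" "q w < 1" and z: "z \<in> carrier V" "q z < 1"
        and eq: "x \<oplus> w = y \<oplus> z"
        by (auto simp: nbhd_def)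
      have "x = (x \<oplus> w) \<oplus> (- 1) \<odot> w" using xy w by (simp add: add_assoc)
      then have "x \<oplus> (- 1) \<odot> y = ((y \<oplus> z) \<oplus> (- 1) \<odot> w) \<oplus> (- 1) \<odot> y" using eq by simp
      also have "\<dots> = y \<oplus> ((- 1) \<odot> y \<oplus> (z \<oplus> (- 1) \<odot> w))"
        using xy z w by (simp add: add_ac del: add_neg_cancel)
      also have "\<dots> = z \<oplus> (- 1) \<odot> w" using xy z w by simp
      finally have "d \<le> p z + p w"
        unfolding d_def using seminorm_add[OF p', of z "(- 1) \<odot> w"] z w
        by (simp add: seminorm_neg[OF p'])
      moreover have "p z < d / 2" "p w < d / 2" using z w d by (auto simp: q_def field_simps)
      ultimately show False by simp
    qed
    then show "\<exists>A B. openin ?T A \<and> openin ?T B \<and> x \<in> A \<and> y \<in> B \<and> disjnt A B"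
      using openin_nbhd nbhd_self q xy by (meson disjnt_def)
  qed
  have convex: "convex_in V (nbhd \<zero> p)" if p: "p \<in> S" for p
    unfolding convex_in_def
  proof (intro conjI ballI allI impI)
    fix x y and t :: real
    assume xy: "x \<in> nbhd \<zero> p" "y \<in> nbhd \<zero> p" and t: "0 \<le> t \<and> t \<le> 1"
    have x: "x \<in> carrier V" "p x < 1" and y: "y \<in> carrier V" "p y < 1"
      using xy by (auto simp: nbhd_def)
    note p' = is_seminorm[OF p]
    have "norm (of_real (1 - t) :: 'k) = 1 - t" "norm (of_real t :: 'k) = t"
      unfolding norm_of_real using t by auto
    then have "p (of_real (1 - t) \<odot> x \<oplus> of_real t \<odot> y) \<le> (1 - t) * p x + t * p y"
      using seminorm_add[OF p', of "of_real (1 - t) \<odot> x" "of_real t \<odot> y"] x y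
      by (simp add: seminorm_scale[OF p'])
    also have "\<dots> < 1"
      using convex_bound_lt[OF x(2) y(2), of "1 - t" t] t by simp
    finally show "of_real (1 - t) \<odot> x \<oplus> of_real t \<odot> y \<in> nbhd \<zero> p"
      using x y by (auto simp: nbhd_def intro!: exI[of _ "of_real (1 - t) \<odot> x \<oplus> of_real t \<odot> y"])
  qed (auto simp: nbhd_def)
  have base: "neighbourhood_base_at \<zero> (convex_in V) ?T"
    unfolding neighbourhood_base_at_def
  proof (intro allI impI)
    fix U assume "openin ?T U \<and> \<zero> \<in> U"
    then obtain p where p: "p \<in> S" "\<forall>z\<in>carrier V. p z < 1 \<longrightarrow> \<zero> \<oplus> z \<in> U"
      unfolding openin_iff by blast
    then have "nbhd \<zero> p \<subseteq> U" by (auto simp: nbhd_def)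
    then show "\<exists>A B. openin ?T A \<and> convex_in V B \<and> \<zero> \<in> A \<and> A \<subseteq> B \<and> B \<subseteq> U"
      using openin_nbhd[OF zero_closed p(1)] nbhd_self[OF zero_closed p(1)] convex[OF p(1)] by blast
  qed
  show ?thesis
    unfolding TVS_def using vector_space topspace add scale hausdorff base by simp
qed

text \<open>If \<phi> maps the unit ball of some p in \<open>S\<close> into the unit ball of the
  field, homogeneity gives |\<phi>| \<le> p, and \<open>S\<close> is closed under domination. Thus
  the topological dual can be read off from \<open>S\<close>.\<close>

lemma continuous_functional_iff:
  assumes "\<phi> \<in> linear_maps V scalars"
  shows "continuous_map (seminorm_topology V S) euclidean \<phi> \<longleftrightarrow> (\<lambda>x. norm (\<phi> x)) \<in> S"
proof
  assume cont: "continuous_map (seminorm_topology V S) euclidean \<phi>"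
  have "openin (seminorm_topology V S) {x \<in> carrier V. \<phi> x \<in> ball 0 1}"
    using openin_continuous_map_preimage[OF cont, of "ball 0 1"] by (simp add: topspace)
  moreover have "\<zero> \<in> {x \<in> carrier V. \<phi> x \<in> ball 0 1}"
    by (simp add: functional_zero[OF assms])
  ultimately obtain p where p: "p \<in> S"
    "\<forall>z\<in>carrier V. p z < 1 \<longrightarrow> \<zero> \<oplus> z \<in> {x \<in> carrier V. \<phi> x \<in> ball 0 1}"
    unfolding openin_iff by blast
  have "norm (\<phi> x) \<le> p x" if x: "x \<in> carrier V" for x
  proof (rule ccontr)
    assume *: "\<not> norm (\<phi> x) \<le> p x"
    \<comment> \<open>Normalised so that \<phi> (t x) has norm 1 although p (t x) < 1.\<close>
    define t where "t = 1 / norm (\<phi> x)"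
    have nz: "0 < norm (\<phi> x)" using * seminorm_nonneg[OF is_seminorm[OF p(1)] x] by linarith
    have t: "norm (of_real t :: 'k) = t" unfolding norm_of_real using nz by (simp add: t_def)
    have "p (of_real t \<odot> x) = t * p x" using seminorm_scale[OF is_seminorm[OF p(1)] x, of "of_real t"] t by simp
    then have "p (of_real t \<odot> x) < 1" using * nz by (simp add: t_def)
    then have "norm (\<phi> (of_real t \<odot> x)) < 1" using x p(2) by auto
    moreover have "norm (\<phi> (of_real t \<odot> x)) = t * norm (\<phi> x)"
      using linear_maps_scale[OF assms x] t by (simp add: norm_mult)
    ultimately show False using nz by (simp add: t_def)
  qed
  then show "(\<lambda>x. norm (\<phi> x)) \<in> S"
    using p(1) seminorms_functional[OF assms] dominated_in by blast
next
  assume S: "(\<lambda>x. norm (\<phi> x)) \<in> S"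
  show "continuous_map (seminorm_topology V S) euclidean \<phi>"
    unfolding continuous_map_def
  proof (intro conjI allI impI)
    fix U :: "'k set" assume "openin euclidean U"
    then have U: "open U" by simp
    show "openin (seminorm_topology V S) {x \<in> topspace (seminorm_topology V S). \<phi> x \<in> U}"
      unfolding openin_iff topspace
    proof (intro conjI ballI)
      fix x assume "x \<in> {x \<in> carrier V. \<phi> x \<in> U}"
      then have x: "x \<in> carrier V" "\<phi> x \<in> U" by auto
      obtain e where e: "0 < e" "ball (\<phi> x) e \<subseteq> U" using U x(2) by (metis openE)
      have "\<phi> (x \<oplus> z) \<in> U" if z: "z \<in> carrier V" "(1 / e) * norm (\<phi> z) < 1" for z
      proof -
        have "dist (\<phi> x) (\<phi> (x \<oplus> z)) < e"
          using z e(1) linear_maps_add[OF assms x(1) z(1)] by (simp add: dist_norm field_simps)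
        then show ?thesis using e(2) by auto
      qed
      then show "\<exists>p\<in>S. \<forall>z\<in>carrier V. p z < 1 \<longrightarrow> x \<oplus> z \<in> {x \<in> carrier V. \<phi> x \<in> U}"
        using times_in[OF S, of "1 / e"] e(1) x(1)
        by (intro bexI[of _ "\<lambda>z. (1 / e) * norm (\<phi> z)"]) auto
    qed auto
  qed auto
qed

end

lemma continuous_seminorm_topology:
  assumes "ideal_space V S" "ideal_space W S'" and f: "f \<in> linear_maps V W"
    and comp: "\<And>q. q \<in> S' \<Longrightarrow> (\<lambda>x. q (f x)) \<in> S"
  shows "continuous_map (seminorm_topology V S) (seminorm_topology W S') f"
proof -
  interpret V: ideal_space V S by fact
  interpret W: ideal_space W S' by fact
  show ?thesis
    unfolding continuous_map_def
  proof (intro conjI allI impI)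
    fix U assume U: "openin (seminorm_topology W S') U"
    show "openin (seminorm_topology V S) {x \<in> topspace (seminorm_topology V S). f x \<in> U}"
      unfolding V.openin_iff V.topspace
    proof (intro conjI ballI)
      fix x assume "x \<in> {x \<in> carrier V. f x \<in> U}"
      then have x: "x \<in> carrier V" "f x \<in> U" by auto
      obtain q where q: "q \<in> S'" "\<forall>z\<in>carrier W. q z < 1 \<longrightarrow> f x \<oplus>\<^bsub>W\<^esub> z \<in> U"
        using U x(2) by (auto simp: W.openin_iff)
      show "\<exists>p\<in>S. \<forall>z\<in>carrier V. p z < 1 \<longrightarrow> x \<oplus>\<^bsub>V\<^esub> z \<in> {x \<in> carrier V. f x \<in> U}"
        using comp[OF q(1)] q(2) x(1) f
        by (intro bexI[of _ "\<lambda>x. q (f x)"]) (auto simp: linear_maps_add linear_maps_closed)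
    qed auto
  qed (use f in \<open>auto simp: V.topspace W.topspace linear_maps_closed\<close>)
qed


section \<open>Locally convex topologies are defined by seminorms\<close>

text \<open>These are the continuous seminorms: by homogeneity one bound near zero gives all smaller
  ones, and subadditivity carries them to other points.\<close>

definition cont_seminorms :: "('k::real_or_complex, 'v) tvs \<Rightarrow> ('v \<Rightarrow> real) set" where
  "cont_seminorms A = {p \<in> seminorms (vect A).
     \<exists>U. openin (topol A) U \<and> \<zero>\<^bsub>vect A\<^esub> \<in> U \<and> (\<forall>x\<in>U. p x < 1)}"

lemma (in vspace) seminormsI:
  assumes "\<And>x y. x \<in> carrier V \<Longrightarrow> y \<in> carrier V \<Longrightarrow> p (x \<oplus> y) \<le> p x + p y"
    and le: "\<And>c x. c \<noteq> 0 \<Longrightarrow> x \<in> carrier V \<Longrightarrow> p (c \<odot> x) \<le> norm c * p x"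
    and "p \<zero> = 0"
  shows "p \<in> seminorms V"
proof -
  have "p (c \<odot> x) = norm c * p x" if x: "x \<in> carrier V" for c x
  proof (cases "c = 0")
    case False
    have "p ((1 / c) \<odot> (c \<odot> x)) \<le> norm (1 / c) * p (c \<odot> x)"
      using False x by (intro le) auto
    then have "norm c * p x \<le> p (c \<odot> x)"
      using False x by (simp add: norm_divide field_simps)
    then show ?thesis using le[OF False x] by simp
  qed (use x assms(3) in simp)
  then show ?thesis using assms(1) by (simp add: seminorms_def)
qed

locale tvs =
  fixes A :: "('k::real_or_complex, 'v) tvs"
  assumes tvs: "A \<in> TVS"

sublocale tvs \<subseteq> vspace "vect A"
  using tvs by unfold_locales (simp add: TVS_def)

context tvs
begin

abbreviation "V \<equiv> vect A"

lemma topspace_eq: "topspace (topol A) = carrier V"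
  using tvs by (simp add: TVS_def)

lemma openin_carrier: "openin (topol A) U \<Longrightarrow> U \<subseteq> carrier V"
  using openin_subset topspace_eq by blast

lemma openin_translate:
  assumes "openin (topol A) U" "x \<in> carrier V"
  shows "openin (topol A) {y \<in> carrier V. x \<oplus>\<^bsub>V\<^esub> y \<in> U}"
proof -
  have "continuous_map (topol A) (prod_topology (topol A) (topol A)) (\<lambda>y. (x, y))"
    using assms by (auto intro: continuous_map_pairedI simp: topspace_eq)
  moreover have "continuous_map (prod_topology (topol A) (topol A)) (topol A) (\<lambda>(x, y). x \<oplus>\<^bsub>V\<^esub> y)"
    using tvs by (simp add: TVS_def)
  ultimately have "continuous_map (topol A) (topol A) (\<lambda>y. x \<oplus>\<^bsub>V\<^esub> y)"
    using continuous_map_compose by (fastforce simp: o_def)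
  then show ?thesis
    using openin_continuous_map_preimage assms(1) topspace_eq by fastforce
qed

lemma continuous_smult:
  "continuous_map (prod_topology euclidean (topol A)) (topol A) (\<lambda>(c, x). c \<odot>\<^bsub>V\<^esub> x)"
  using tvs by (simp add: TVS_def)

lemma openin_scale:
  assumes "openin (topol A) U"
  shows "openin (topol A) {y \<in> carrier V. c \<odot>\<^bsub>V\<^esub> y \<in> U}"
proof -
  have "continuous_map (topol A) (prod_topology euclidean (topol A)) (\<lambda>y. (c, y))"
    by (auto intro: continuous_map_pairedI simp: topspace_eq)
  then have "continuous_map (topol A) (topol A) (\<lambda>y. c \<odot>\<^bsub>V\<^esub> y)"
    using continuous_map_compose continuous_smult by (fastforce simp: o_def)
  then show ?thesis
    using openin_continuous_map_preimage assms(1) topspace_eq by fastforce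
qed

lemma open_scalars:
  assumes "openin (topol A) U" "x \<in> carrier V"
  shows "open {c. c \<odot>\<^bsub>V\<^esub> x \<in> U}"
proof -
  have "continuous_map euclidean (prod_topology euclidean (topol A)) (\<lambda>c :: 'k. (c, x))"
    using assms by (auto intro: continuous_map_pairedI simp: topspace_eq)
  then have "continuous_map euclidean (topol A) (\<lambda>c. c \<odot>\<^bsub>V\<^esub> x)"
    using continuous_map_compose continuous_smult by (fastforce simp: o_def)
  then show ?thesis
    using openin_continuous_map_preimage[OF _ assms(1)] by fastforce
qed

text \<open>\<open>B\<close> is the balanced core of a convex neighbourhood \<open>C\<close>. It
  inherits convexity, and it contains a neighbourhood of zero because scalar multiplication is
  jointly continuous at (0, 0). Since \<open>B\<close> may fail to be open, an open set inside it is
  returned as well.\<close>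

lemma balanced_convex_neighbourhood:
  assumes U: "openin (topol A) U" "\<zero>\<^bsub>V\<^esub> \<in> U"
  obtains B M where "openin (topol A) M" "\<zero>\<^bsub>V\<^esub> \<in> M" "M \<subseteq> B" "B \<subseteq> U" "B \<subseteq> carrier V"
    "\<And>c x. x \<in> B \<Longrightarrow> norm c \<le> 1 \<Longrightarrow> c \<odot>\<^bsub>V\<^esub> x \<in> B" "convex_in V B"
proof -
  obtain N C where N: "openin (topol A) N" "\<zero>\<^bsub>V\<^esub> \<in> N" "N \<subseteq> C" "C \<subseteq> U" and C: "convex_in V C"
  proof -
    have "neighbourhood_base_at \<zero>\<^bsub>V\<^esub> (convex_in V) (topol A)" using tvs by (simp add: TVS_def)
    then show thesis using that U unfolding neighbourhood_base_at_def by blast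
  qed
  define B where "B = {x \<in> carrier V. \<forall>c. norm c \<le> 1 \<longrightarrow> c \<odot>\<^bsub>V\<^esub> x \<in> C}"
  have "openin (prod_topology euclidean (topol A))
      {x \<in> topspace (prod_topology euclidean (topol A)). (case x of (c, x) \<Rightarrow> c \<odot>\<^bsub>V\<^esub> x) \<in> N}"
    using continuous_smult N(1) by (rule openin_continuous_map_preimage)
  moreover have "(0, \<zero>\<^bsub>V\<^esub>) \<in> {x \<in> topspace (prod_topology euclidean (topol A)). (case x of (c, x) \<Rightarrow> c \<odot>\<^bsub>V\<^esub> x) \<in> N}"
    using N(2) by (simp add: topspace_eq)
  ultimately obtain D M where "openin euclidean D" and M: "openin (topol A) M" "\<zero>\<^bsub>V\<^esub> \<in> M" "0 \<in> D"
    and DM: "D \<times> M \<subseteq> {x \<in> topspace (prod_topology euclidean (topol A)). (case x of (c, x) \<Rightarrow> c \<odot>\<^bsub>V\<^esub> x) \<in> N}"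
    unfolding openin_prod_topology_alt by meson
  then obtain \<delta> where \<delta>: "0 < \<delta>" "ball 0 \<delta> \<subseteq> D" by (metis openE open_openin)
  \<comment> \<open>For c of norm at most 1 the scalar c \<delta>/2 lies in \<open>D\<close>; the
    factor 2/\<delta> compensates for \<delta>/2.\<close>
  define M' where "M' = {y \<in> carrier V. of_real (2 / \<delta>) \<odot>\<^bsub>V\<^esub> y \<in> M}"
  have "c \<odot>\<^bsub>V\<^esub> x \<in> N" if x: "x \<in> M'" and c: "norm c \<le> 1" for c x
  proof -
    have "norm (c * of_real (\<delta> / 2)) = norm c * (\<delta> / 2)"
      unfolding norm_mult norm_of_real using \<delta> by simp
    also have "\<dots> \<le> 1 * (\<delta> / 2)" using c \<delta> by (intro mult_right_mono) auto
    also have "\<dots> < \<delta>" using \<delta> by simp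
    finally have "c * of_real (\<delta> / 2) \<in> D" using \<delta>(2) by (auto simp: subset_iff)
    then have "(c * of_real (\<delta> / 2)) \<odot>\<^bsub>V\<^esub> (of_real (2 / \<delta>) \<odot>\<^bsub>V\<^esub> x) \<in> N"
      using DM x by (auto simp: M'_def)
    moreover have "(c * of_real (\<delta> / 2)) * of_real (2 / \<delta>) = c"
      using \<delta> by (simp add: mult.assoc flip: of_real_mult)
    moreover have "x \<in> carrier V" using x by (simp add: M'_def)
    ultimately show ?thesis by simp
  qed
  then have MB: "M' \<subseteq> B" using N by (auto simp: B_def M'_def)
  show thesis
  proof (rule that[of M' B])
    show "openin (topol A) M'" unfolding M'_def by (rule openin_scale[OF M(1)])
    show "\<zero>\<^bsub>V\<^esub> \<in> M'" using M by (simp add: M'_def)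
    show "B \<subseteq> U"
    proof
      fix x assume "x \<in> B"
      then have "1 \<odot>\<^bsub>V\<^esub> x \<in> C" "x \<in> carrier V" unfolding B_def by (auto simp del: smult_one)
      then show "x \<in> U" using N by auto
    qed
    show "c \<odot>\<^bsub>V\<^esub> x \<in> B" if "x \<in> B" "norm c \<le> 1" for c x
    proof -
      have "norm (d * c) \<le> 1" if "norm d \<le> 1" for d
        using that \<open>norm c \<le> 1\<close> by (simp add: norm_mult mult_le_one)
      then show ?thesis using that by (simp add: B_def)
    qed
    show "convex_in V B"
      unfolding convex_in_def
    proof (intro conjI ballI allI impI)
      fix x y and t :: real
      assume xy: "x \<in> B" "y \<in> B" and t: "0 \<le> t \<and> t \<le> 1"
      have xy': "x \<in> carrier V" "y \<in> carrier V" using xy by (auto simp: B_def)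
      have "c \<odot>\<^bsub>V\<^esub> (of_real (1 - t) \<odot>\<^bsub>V\<^esub> x \<oplus>\<^bsub>V\<^esub> of_real t \<odot>\<^bsub>V\<^esub> y) \<in> C" if c: "norm c \<le> 1" for c
      proof -
        have "c \<odot>\<^bsub>V\<^esub> x \<in> C" "c \<odot>\<^bsub>V\<^esub> y \<in> C" using xy c by (auto simp: B_def)
        then have "of_real (1 - t) \<odot>\<^bsub>V\<^esub> (c \<odot>\<^bsub>V\<^esub> x) \<oplus>\<^bsub>V\<^esub> of_real t \<odot>\<^bsub>V\<^esub> (c \<odot>\<^bsub>V\<^esub> y) \<in> C"
          using C t unfolding convex_in_def by blast
        then show ?thesis using xy' by (simp add: smult_add_right mult.commute)
      qed
      then show "of_real (1 - t) \<odot>\<^bsub>V\<^esub> x \<oplus>\<^bsub>V\<^esub> of_real t \<odot>\<^bsub>V\<^esub> y \<in> B"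
        using xy' by (simp add: B_def)
    qed (auto simp: B_def)
  qed (use MB in \<open>auto simp: B_def\<close>)
qed

text \<open>\<open>p\<close> is the Minkowski functional of a balanced convex \<open>B\<close>.
  Convexity gives subadditivity, balancedness gives homogeneity, and continuity of scalar
  multiplication at 0 makes \<open>B\<close> absorbing, so that the infimum is taken over a nonempty
  set.\<close>

lemma minkowski_seminorm:
  assumes U: "openin (topol A) U" "\<zero>\<^bsub>V\<^esub> \<in> U"
  obtains p where "p \<in> cont_seminorms A" "\<And>x. x \<in> carrier V \<Longrightarrow> p x < 1 \<Longrightarrow> x \<in> U"
proof -
  obtain B M where M: "openin (topol A) M" "\<zero>\<^bsub>V\<^esub> \<in> M" "M \<subseteq> B" and B: "B \<subseteq> U" "B \<subseteq> carrier V"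
    and balanced: "\<And>c x. x \<in> B \<Longrightarrow> norm c \<le> 1 \<Longrightarrow> c \<odot>\<^bsub>V\<^esub> x \<in> B" and conv: "convex_in V B"
    by (rule balanced_convex_neighbourhood[OF U]) (rule that)
  define G where "G x = {t. 0 < t \<and> of_real (1 / t) \<odot>\<^bsub>V\<^esub> x \<in> B}" for x
  define p where "p x = Inf (G x)" for x
  have bdd: "bdd_below (G x)" for x by (rule bdd_belowI[of _ 0]) (simp add: G_def)
  have p_le: "p x \<le> t" if "t \<in> G x" for x t unfolding p_def by (rule cInf_lower[OF that bdd])
  have nonempty: "G x \<noteq> {}" if x: "x \<in> carrier V" for x
  proof -
    have "open {c. c \<odot>\<^bsub>V\<^esub> x \<in> M}" "0 \<in> {c. c \<odot>\<^bsub>V\<^esub> x \<in> M}"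
      using open_scalars[OF M(1) x] M(2) x by auto
    then obtain e where e: "0 < e" "ball 0 e \<subseteq> {c. c \<odot>\<^bsub>V\<^esub> x \<in> M}" by (metis openE)
    have "norm (of_real (e / 2) :: 'k) < e" unfolding norm_of_real using e by simp
    then have "of_real (e / 2) \<odot>\<^bsub>V\<^esub> x \<in> M" using e(2) by (auto simp: subset_iff)
    then have "2 / e \<in> G x" using e(1) M(3) by (auto simp: G_def)
    then show ?thesis by blast
  qed
  have p_ge: "c \<le> p x" if "x \<in> carrier V" "\<And>t. t \<in> G x \<Longrightarrow> c \<le> t" for c x
    unfolding p_def by (rule cInf_greatest[OF nonempty[OF that(1)] that(2)])
  have up: "s \<in> G x" if t: "t \<in> G x" "t \<le> s" and x: "x \<in> carrier V" for s t x
  proof -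
    have t': "0 < t" "of_real (1 / t) \<odot>\<^bsub>V\<^esub> x \<in> B" using t by (auto simp: G_def)
    have "norm (of_real (t / s) :: 'k) \<le> 1" unfolding norm_of_real using t' t(2) by simp
    then have "of_real (t / s) \<odot>\<^bsub>V\<^esub> (of_real (1 / t) \<odot>\<^bsub>V\<^esub> x) \<in> B" by (rule balanced[OF t'(2)])
    then have "of_real (t / s * (1 / t)) \<odot>\<^bsub>V\<^esub> x \<in> B" unfolding of_real_mult using x by simp
    then show ?thesis using t' t(2) by (simp add: G_def)
  qed
  have p_semi: "p \<in> seminorms V"
  proof (rule seminormsI)
    fix x y assume xy: "x \<in> carrier V" "y \<in> carrier V"
    have *: "p (x \<oplus>\<^bsub>V\<^esub> y) \<le> s + t" if s: "s \<in> G x" and t: "t \<in> G y" for s t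
    proof (rule p_le)
      have st: "0 < s" "0 < t" using s t by (auto simp: G_def)
      \<comment> \<open>With this weight (x + y) / (s + t) is a convex combination of x / s and y /
        t.\<close>
      define u where "u = t / (s + t)"
      have u: "0 \<le> u" "u \<le> 1" using st by (auto simp: u_def)
      have "of_real (1 - u) \<odot>\<^bsub>V\<^esub> (of_real (1 / s) \<odot>\<^bsub>V\<^esub> x) \<oplus>\<^bsub>V\<^esub> of_real u \<odot>\<^bsub>V\<^esub> (of_real (1 / t) \<odot>\<^bsub>V\<^esub> y) \<in> B"
        using conv s t u unfolding convex_in_def G_def by blast
      then have "of_real ((1 - u) * (1 / s)) \<odot>\<^bsub>V\<^esub> x \<oplus>\<^bsub>V\<^esub> of_real (u * (1 / t)) \<odot>\<^bsub>V\<^esub> y \<in> B"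
        unfolding of_real_mult using xy by simp
      moreover have "(1 - u) * (1 / s) = 1 / (s + t)" "u * (1 / t) = 1 / (s + t)"
        using st by (auto simp: u_def field_simps)
      ultimately have "of_real (1 / (s + t)) \<odot>\<^bsub>V\<^esub> (x \<oplus>\<^bsub>V\<^esub> y) \<in> B"
        unfolding smult_add_right[OF xy] by (simp only:)
      then show "s + t \<in> G (x \<oplus>\<^bsub>V\<^esub> y)" using st by (simp add: G_def)
    qed
    have "p (x \<oplus>\<^bsub>V\<^esub> y) - t \<le> p x" if "t \<in> G y" for t
      using *[OF _ that] by (intro p_ge xy) (simp add: algebra_simps)
    then have "p (x \<oplus>\<^bsub>V\<^esub> y) - p x \<le> p y"
      by (intro p_ge xy) (simp add: algebra_simps)
    then show "p (x \<oplus>\<^bsub>V\<^esub> y) \<le> p x + p y" by simp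
  next
    fix c :: 'k and x assume c: "c \<noteq> 0" and x: "x \<in> carrier V"
    have "p (c \<odot>\<^bsub>V\<^esub> x) / norm c \<le> p x"
    proof (rule p_ge[OF x])
      fix t assume t: "t \<in> G x"
      have t': "0 < t" "of_real (1 / t) \<odot>\<^bsub>V\<^esub> x \<in> B" using t by (auto simp: G_def)
      have "norm (c / of_real (norm c)) \<le> 1" using c by (simp add: norm_divide)
      then have "(c / of_real (norm c)) \<odot>\<^bsub>V\<^esub> (of_real (1 / t) \<odot>\<^bsub>V\<^esub> x) \<in> B"
        by (rule balanced[OF t'(2)])
      moreover have "(c / of_real (norm c)) * of_real (1 / t) = of_real (1 / (norm c * t)) * c"
        using c t'(1) by (simp add: field_simps)
      ultimately have "norm c * t \<in> G (c \<odot>\<^bsub>V\<^esub> x)" using c t'(1) x by (simp add: G_def)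
      then have "p (c \<odot>\<^bsub>V\<^esub> x) \<le> norm c * t" by (rule p_le)
      then show "p (c \<odot>\<^bsub>V\<^esub> x) / norm c \<le> t" using c by (simp add: field_simps)
    qed
    then show "p (c \<odot>\<^bsub>V\<^esub> x) \<le> norm c * p x" using c by (simp add: field_simps)
  next
    have "\<zero>\<^bsub>V\<^esub> \<in> B" using M by blast
    then have "G \<zero>\<^bsub>V\<^esub> = {0<..}" by (auto simp: G_def)
    then show "p \<zero>\<^bsub>V\<^esub> = 0" by (simp add: p_def)
  qed
  \<comment> \<open>On \<open>M\<close> itself only p \<le> 1 is available; passing to half of it
    gives a strict bound.\<close>
  have p_less: "p x < 1" if x: "x \<in> carrier V" "2 \<odot>\<^bsub>V\<^esub> x \<in> M" for x
  proof -
    have "1 / 2 \<in> G x" using x M(3) by (auto simp: G_def)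
    then show ?thesis using p_le by fastforce
  qed
  show thesis
  proof (rule that[of p])
    show "p \<in> cont_seminorms A"
      unfolding cont_seminorms_def
      using p_semi openin_scale[OF M(1), of 2] M(2) p_less by (auto intro!: exI[of _ "{y \<in> carrier V. 2 \<odot>\<^bsub>V\<^esub> y \<in> M}"])
    fix x assume x: "x \<in> carrier V" "p x < 1"
    then obtain t where t: "t \<in> G x" "t < 1"
      unfolding p_def using cInf_lessD[OF nonempty[OF x(1)]] by blast
    then have "1 \<in> G x" using up[of t x 1] x by simp
    then show "x \<in> U" using B x by (auto simp: G_def)
  qed
qed

lemma seminorm_ideal_cont: "seminorm_ideal V (cont_seminorms A)"
  unfolding seminorm_ideal_def
proof (intro conjI ballI impI)
  show "(\<lambda>x. 0) \<in> cont_seminorms A"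
    unfolding cont_seminorms_def using openin_topspace[of "topol A"]
    by (auto simp: seminorms_zero topspace_eq intro!: exI[of _ "carrier V"])
next
  fix p q assume p: "p \<in> cont_seminorms A" and q: "q \<in> cont_seminorms A"
  obtain U where U: "openin (topol A) U" "\<zero>\<^bsub>V\<^esub> \<in> U" "\<And>x. x \<in> U \<Longrightarrow> p x < 1"
    using p by (auto simp: cont_seminorms_def)
  obtain U' where U': "openin (topol A) U'" "\<zero>\<^bsub>V\<^esub> \<in> U'" "\<And>x. x \<in> U' \<Longrightarrow> q x < 1"
    using q by (auto simp: cont_seminorms_def)
  have semi: "p \<in> seminorms V" "q \<in> seminorms V" using p q by (auto simp: cont_seminorms_def)
  \<comment> \<open>On \<open>N\<close> both p and q are smaller than 1/2.\<close>
  define N where "N = {y \<in> carrier V. 2 \<odot>\<^bsub>V\<^esub> y \<in> U \<inter> U'}"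
  have "p x + q x < 1" if x: "x \<in> N" for x
  proof -
    have "p (2 \<odot>\<^bsub>V\<^esub> x) < 1" "q (2 \<odot>\<^bsub>V\<^esub> x) < 1" "x \<in> carrier V" using x U U' by (auto simp: N_def)
    then show ?thesis using seminorm_scale[OF semi(1), of x 2] seminorm_scale[OF semi(2), of x 2] by simp
  qed
  moreover have "openin (topol A) N" unfolding N_def using U(1) U'(1) by (intro openin_scale openin_Int)
  moreover have "\<zero>\<^bsub>V\<^esub> \<in> N" using U U' by (simp add: N_def)
  ultimately show "(\<lambda>x. p x + q x) \<in> cont_seminorms A"
    unfolding cont_seminorms_def using seminorms_plus[OF semi] by auto
next
  fix p q assume p: "p \<in> cont_seminorms A" and q: "q \<in> seminorms V" "\<forall>x\<in>carrier V. q x \<le> p x"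
  obtain U where U: "openin (topol A) U" "\<zero>\<^bsub>V\<^esub> \<in> U" "\<And>x. x \<in> U \<Longrightarrow> p x < 1"
    using p by (auto simp: cont_seminorms_def)
  have "q x < 1" if "x \<in> U" for x
    using U(3)[OF that] q(2) openin_carrier[OF U(1)] that by (meson order_le_less_trans subsetD)
  then show "q \<in> cont_seminorms A" unfolding cont_seminorms_def using q U by auto
qed (auto simp: cont_seminorms_def)

sublocale cont: ideal_space "vect A" "cont_seminorms A"
  by unfold_locales (rule seminorm_ideal_cont)

text \<open>Every neighbourhood of zero contains the unit ball of a continuous seminorm, and every
  such ball contains a neighbourhood; translations carry this to all points. From here on any space
  in \<open>TVS\<close> is an instance of \<open>ideal_space\<close>.\<close>

lemma topol_eq: "topol A = seminorm_topology V (cont_seminorms A)"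
proof -
  have "openin (topol A) U \<longleftrightarrow> openin (seminorm_topology V (cont_seminorms A)) U" for U
  proof
    assume U: "openin (topol A) U"
    show "openin (seminorm_topology V (cont_seminorms A)) U"
      unfolding cont.openin_iff
    proof (intro conjI ballI)
      fix x assume x: "x \<in> U"
      then have xc: "x \<in> carrier V" using openin_carrier[OF U] by auto
      obtain p where "p \<in> cont_seminorms A"
        "\<And>z. z \<in> carrier V \<Longrightarrow> p z < 1 \<Longrightarrow> z \<in> {y \<in> carrier V. x \<oplus>\<^bsub>V\<^esub> y \<in> U}"
        using x xc by (rule_tac minkowski_seminorm[OF openin_translate[OF U xc]]) auto
      then show "\<exists>p\<in>cont_seminorms A. \<forall>z\<in>carrier V. p z < 1 \<longrightarrow> x \<oplus>\<^bsub>V\<^esub> z \<in> U" by blast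
    qed (rule openin_carrier[OF U])
  next
    assume U: "openin (seminorm_topology V (cont_seminorms A)) U"
    show "openin (topol A) U"
    proof (subst openin_subopen, intro ballI)
      fix x assume "x \<in> U"
      then obtain p where p: "p \<in> cont_seminorms A" "\<forall>z\<in>carrier V. p z < 1 \<longrightarrow> x \<oplus>\<^bsub>V\<^esub> z \<in> U"
        and x: "x \<in> carrier V"
        using U unfolding cont.openin_iff by blast
      obtain N where N: "openin (topol A) N" "\<zero>\<^bsub>V\<^esub> \<in> N" "\<And>x. x \<in> N \<Longrightarrow> p x < 1"
        using p(1) by (auto simp: cont_seminorms_def)
      let ?N = "{y \<in> carrier V. (- 1) \<odot>\<^bsub>V\<^esub> x \<oplus>\<^bsub>V\<^esub> y \<in> N}"
      have "openin (topol A) ?N" using x by (intro openin_translate N) auto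
      moreover have "x \<in> ?N" using x N by simp
      moreover have "?N \<subseteq> U"
      proof
        fix y assume y: "y \<in> ?N"
        then have "x \<oplus>\<^bsub>V\<^esub> ((- 1) \<odot>\<^bsub>V\<^esub> x \<oplus>\<^bsub>V\<^esub> y) \<in> U" using p(2) N(3) x by blast
        then show "y \<in> U" using x y by simp
      qed
      ultimately show "\<exists>T. openin (topol A) T \<and> x \<in> T \<and> T \<subseteq> U" by blast
    qed
  qed
  then show ?thesis by (simp add: topology_eq)
qed

lemma separating_cont: "separating V (cont_seminorms A)"
  unfolding separating_def
proof (intro ballI impI)
  fix x assume x: "x \<in> carrier V" "x \<noteq> \<zero>\<^bsub>V\<^esub>"
  have "Hausdorff_space (topol A)" using tvs by (simp add: TVS_def)
  then obtain U U' where U: "openin (topol A) U" "\<zero>\<^bsub>V\<^esub> \<in> U" "x \<in> U'" "disjnt U U'"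
    unfolding Hausdorff_space_def topspace_eq using x zero_closed by metis
  obtain p where p: "p \<in> cont_seminorms A" "\<And>x. x \<in> carrier V \<Longrightarrow> p x < 1 \<Longrightarrow> x \<in> U"
    by (rule minkowski_seminorm[OF U(1,2)]) (rule that)
  have "p x \<noteq> 0" using p(2)[OF x(1)] U(3,4) by (auto simp: disjnt_def)
  then show "\<exists>p\<in>cont_seminorms A. p x \<noteq> 0" using p(1) by blast
qed

end

lemma (in ideal_space) carrier_topological_dual:
  "carrier (topological_dual \<lparr>vect = V, topol = seminorm_topology V S\<rparr>) =
     {\<phi> \<in> linear_maps V scalars. (\<lambda>x. norm (\<phi> x)) \<in> S}"
  by (auto simp: topological_dual_def L_def pointwise_space_def continuous_linear_maps_def scalars_tvs_def
      continuous_functional_iff)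

lemma (in tvs) carrier_dual:
  "carrier (topological_dual A) = {\<phi> \<in> linear_maps V scalars. (\<lambda>x. norm (\<phi> x)) \<in> cont_seminorms A}"
  using cont.carrier_topological_dual topol_eq by (cases A) auto

text \<open>Hahn-Banach extension along the map c -> c x from the one-dimensional space; this also
  covers x = 0.\<close>

lemma (in vspace) norming_functional:
  assumes p: "p \<in> seminorms V" and x: "x \<in> carrier V"
  obtains \<psi> where "\<psi> \<in> linear_maps V scalars" "\<And>y. y \<in> carrier V \<Longrightarrow> norm (\<psi> y) \<le> p y"
    "\<psi> x = of_real (p x)"
proof -
  have vs: "vspace (scalars :: ('k, 'k) module)"
    using scalars_vector_space by unfold_locales
  obtain \<psi> where \<psi>: "\<psi> \<in> linear_maps V scalars" "\<And>y. y \<in> carrier V \<Longrightarrow> norm (\<psi> y) \<le> p y"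
    "\<And>c. c \<in> carrier (scalars :: ('k, 'k) module) \<Longrightarrow> \<psi> (c \<odot> x) = c * of_real (p x)"
  proof (rule hahn_banach[OF vs _ p])
    show "(\<lambda>c. c \<odot> x) \<in> linear_maps scalars V"
      by (rule linear_mapsI) (use x in \<open>auto simp: smult_add_left extensional_def\<close>)
    show "(\<lambda>c. c * of_real (p x)) \<in> linear_maps scalars scalars"
      by (rule linear_mapsI) (auto simp: extensional_def algebra_simps)
    show "norm (c * of_real (p x) :: 'k) \<le> p (c \<odot> x)" for c
      using seminorm_scale[OF p x] seminorm_nonneg[OF p x] by (simp add: norm_mult)
  qed (rule that)
  show thesis by (rule that[OF \<psi>(1,2)]) (use \<psi>(3)[of 1] x in simp_all)
qed

section \<open>Weak and Mackey topologies\<close>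

text \<open>
  Any dual topology is defined by an ideal of seminorms that contains every \<open>|\<phi>|\<close> with \<open>\<phi> \<in> F\<close>, and by
  domination no functional outside \<open>F\<close> can lie below one of its seminorms. So the smallest such ideal
  and the set of all seminorms with the latter property are the extreme candidates.
\<close>

definition mackey_seminorms :: "('k::real_or_complex, 'v) module \<Rightarrow> ('v \<Rightarrow> 'k) set \<Rightarrow> ('v \<Rightarrow> real) set" where
  "mackey_seminorms V F = {p \<in> seminorms V.
     \<forall>\<phi>\<in>linear_maps V scalars. (\<forall>x\<in>carrier V. norm (\<phi> x) \<le> p x) \<longrightarrow> \<phi> \<in> F}"

text \<open>For a dual pair these are the seminorms dominated by finite sums of seminorms |\<phi>|
  with \<phi> in \<open>F\<close>. As an intersection, minimality is immediate.\<close>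

definition weak_seminorms :: "('k::real_or_complex, 'v) module \<Rightarrow> ('v \<Rightarrow> 'k) set \<Rightarrow> ('v \<Rightarrow> real) set" where
  "weak_seminorms V F = \<Inter>{S. seminorm_ideal V S \<and> (\<forall>\<phi>\<in>F. (\<lambda>x. norm (\<phi> x)) \<in> S)}"

locale dual_pair = vspace V for V :: "('k::real_or_complex, 'v) module" (structure) +
  fixes F :: "('v \<Rightarrow> 'k) set"
  assumes F_linear: "\<phi> \<in> F \<Longrightarrow> \<phi> \<in> linear_maps V scalars"
    and F_zero: "(\<lambda>x\<in>carrier V. 0) \<in> F"
    and F_add: "\<phi> \<in> F \<Longrightarrow> \<psi> \<in> F \<Longrightarrow> (\<lambda>x\<in>carrier V. \<phi> x + \<psi> x) \<in> F"
    and F_scale: "\<phi> \<in> F \<Longrightarrow> (\<lambda>x\<in>carrier V. c * \<phi> x) \<in> F"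
    and F_separating: "x \<in> carrier V \<Longrightarrow> x \<noteq> \<zero> \<Longrightarrow> \<exists>\<phi>\<in>F. \<phi> x \<noteq> 0"
begin

lemma mackey_ideal: "seminorm_ideal V (mackey_seminorms V F)"
  unfolding seminorm_ideal_def
proof (intro conjI ballI impI)
  have "\<phi> \<in> F" if "\<phi> \<in> linear_maps V scalars" "\<forall>x\<in>carrier V. norm (\<phi> x) \<le> 0" for \<phi>
  proof -
    have "\<phi> = (\<lambda>x\<in>carrier V. 0)"
      using that linear_maps_extensional[OF that(1)] by (intro extensionalityI[of _ "carrier V"]) auto
    then show ?thesis using F_zero by simp
  qed
  then show "(\<lambda>x. 0) \<in> mackey_seminorms V F"
    by (simp add: mackey_seminorms_def seminorms_zero)
next
  fix p q assume p: "p \<in> mackey_seminorms V F" and q: "q \<in> mackey_seminorms V F"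
  have semi: "p \<in> seminorms V" "q \<in> seminorms V" using p q by (auto simp: mackey_seminorms_def)
  have "\<phi> \<in> F" if \<phi>: "\<phi> \<in> linear_maps V scalars" "\<And>x. x \<in> carrier V \<Longrightarrow> norm (\<phi> x) \<le> p x + q x" for \<phi>
  proof -
    obtain \<psi> \<omega> where *: "\<psi> \<in> linear_maps V scalars" "\<And>x. x \<in> carrier V \<Longrightarrow> norm (\<psi> x) \<le> p x"
      "\<omega> \<in> linear_maps V scalars" "\<And>x. x \<in> carrier V \<Longrightarrow> norm (\<omega> x) \<le> q x"
      "\<And>x. x \<in> carrier V \<Longrightarrow> \<phi> x = \<psi> x + \<omega> x"
      by (rule functional_split[OF semi \<phi>]) (assumption+, rule that)
    have "\<psi> \<in> F" using p *(1,2) by (simp add: mackey_seminorms_def)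
    moreover have "\<omega> \<in> F" using q *(3,4) by (simp add: mackey_seminorms_def)
    ultimately have "(\<lambda>x\<in>carrier V. \<psi> x + \<omega> x) \<in> F" by (rule F_add)
    moreover have "\<phi> = (\<lambda>x\<in>carrier V. \<psi> x + \<omega> x)"
      by (rule extensionalityI[OF linear_maps_extensional[OF \<phi>(1)]]) (auto simp: *(5))
    ultimately show ?thesis by simp
  qed
  then show "(\<lambda>x. p x + q x) \<in> mackey_seminorms V F"
    using seminorms_plus[OF semi] by (simp add: mackey_seminorms_def)
next
  fix p q assume "p \<in> mackey_seminorms V F" "q \<in> seminorms V" "\<forall>x\<in>carrier V. q x \<le> p x"
  then show "q \<in> mackey_seminorms V F"
    unfolding mackey_seminorms_def by (auto, meson order_trans)
qed (auto simp: mackey_seminorms_def)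

text \<open>The kernel of \<phi> is contained in that of \<psi>. If \<phi> x0 is nonzero, x minus a
  suitable multiple of x0 lies in the kernel of \<phi>, so \<psi> is determined by its value at
  x0.\<close>

lemma functional_dominated_by_functional:
  assumes \<phi>: "\<phi> \<in> linear_maps V scalars" and \<psi>: "\<psi> \<in> linear_maps V scalars"
    and le: "\<And>x. x \<in> carrier V \<Longrightarrow> norm (\<psi> x) \<le> norm (\<phi> x)"
  obtains c where "\<psi> = (\<lambda>x\<in>carrier V. c * \<phi> x)"
proof (cases "\<exists>x0\<in>carrier V. \<phi> x0 \<noteq> 0")
  case True
  then obtain x0 where x0: "x0 \<in> carrier V" "\<phi> x0 \<noteq> 0" by blast
  have "\<psi> x = (\<psi> x0 / \<phi> x0) * \<phi> x" if x: "x \<in> carrier V" for x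
  proof -
    let ?y = "x \<oplus> (- \<phi> x / \<phi> x0) \<odot> x0"
    have "\<phi> ?y = 0"
      using x x0 by (simp add: linear_maps_add[OF \<phi>] linear_maps_scale[OF \<phi>])
    then have "\<psi> ?y = 0" using le[of ?y] x x0 by simp
    then show ?thesis
      using x x0 by (simp add: linear_maps_add[OF \<psi>] linear_maps_scale[OF \<psi>] field_simps)
  qed
  then have "\<psi> = (\<lambda>x\<in>carrier V. (\<psi> x0 / \<phi> x0) * \<phi> x)"
    by (intro extensionalityI[OF linear_maps_extensional[OF \<psi>]]) auto
  then show thesis by (rule that)
next
  case False
  then have "\<psi> = (\<lambda>x\<in>carrier V. 0 * \<phi> x)"
    using le by (intro extensionalityI[OF linear_maps_extensional[OF \<psi>]]) auto
  then show thesis by (rule that)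
qed

text \<open>A functional below |\<phi>| is a multiple of \<phi>, and \<open>F\<close> is closed
  under multiples.\<close>

lemma functional_in_mackey:
  assumes "\<phi> \<in> F"
  shows "(\<lambda>x. norm (\<phi> x)) \<in> mackey_seminorms V F"
proof -
  have "\<psi> \<in> F" if \<psi>: "\<psi> \<in> linear_maps V scalars" "\<And>x. x \<in> carrier V \<Longrightarrow> norm (\<psi> x) \<le> norm (\<phi> x)" for \<psi>
  proof -
    obtain c where "\<psi> = (\<lambda>x\<in>carrier V. c * \<phi> x)"
      by (rule functional_dominated_by_functional[OF F_linear[OF assms] \<psi>])
    then show ?thesis using F_scale[OF assms] by simp
  qed
  then show ?thesis
    using seminorms_functional[OF F_linear[OF assms]] by (simp add: mackey_seminorms_def)
qed

lemma weak_least: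
  "seminorm_ideal V S \<Longrightarrow> (\<And>\<phi>. \<phi> \<in> F \<Longrightarrow> (\<lambda>x. norm (\<phi> x)) \<in> S) \<Longrightarrow> weak_seminorms V F \<subseteq> S"
  by (auto simp: weak_seminorms_def)

lemma functional_in_weak: "\<phi> \<in> F \<Longrightarrow> (\<lambda>x. norm (\<phi> x)) \<in> weak_seminorms V F"
  by (auto simp: weak_seminorms_def)

lemma weak_le_mackey: "weak_seminorms V F \<subseteq> mackey_seminorms V F"
  by (rule weak_least[OF mackey_ideal functional_in_mackey])

text \<open>The closure conditions pass to intersections. That the members are seminorms depends on
  there being an ideal to intersect with, which \<open>weak_le_mackey\<close> provides.\<close>

lemma weak_ideal: "seminorm_ideal V (weak_seminorms V F)"
proof -
  have mem: "p \<in> weak_seminorms V F \<longleftrightarrow>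
      (\<forall>S. seminorm_ideal V S \<longrightarrow> (\<forall>\<phi>\<in>F. (\<lambda>x. norm (\<phi> x)) \<in> S) \<longrightarrow> p \<in> S)" for p
    by (auto simp: weak_seminorms_def)
  show ?thesis
    unfolding seminorm_ideal_def
  proof (intro conjI ballI impI)
    show "weak_seminorms V F \<subseteq> seminorms V"
      using weak_le_mackey by (auto simp: mackey_seminorms_def)
    show "(\<lambda>x. 0) \<in> weak_seminorms V F"
      unfolding mem by (simp add: seminorm_ideal_def)
    show "(\<lambda>x. p x + q x) \<in> weak_seminorms V F"
      if "p \<in> weak_seminorms V F" "q \<in> weak_seminorms V F" for p q
      using that unfolding mem by (simp add: seminorm_ideal_def)
    show "q \<in> weak_seminorms V F"
      if "p \<in> weak_seminorms V F" "q \<in> seminorms V" "\<forall>x\<in>carrier V. q x \<le> p x" for p q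
      unfolding mem
    proof (intro allI impI)
      fix S assume S: "seminorm_ideal V S" "\<forall>\<phi>\<in>F. (\<lambda>x. norm (\<phi> x)) \<in> S"
      then have "p \<in> S" using that(1) unfolding mem by blast
      then show "q \<in> S" using S(1) that(2,3) unfolding seminorm_ideal_def by blast
    qed
  qed
qed

lemma functional_in_mackey_iff:
  assumes "\<phi> \<in> linear_maps V scalars"
  shows "(\<lambda>x. norm (\<phi> x)) \<in> mackey_seminorms V F \<longleftrightarrow> \<phi> \<in> F"
  using functional_in_mackey assms by (auto simp: mackey_seminorms_def)

lemma functional_in_weak_iff:
  assumes "\<phi> \<in> linear_maps V scalars"
  shows "(\<lambda>x. norm (\<phi> x)) \<in> weak_seminorms V F \<longleftrightarrow> \<phi> \<in> F"
  using functional_in_weak weak_le_mackey functional_in_mackey_iff[OF assms] by blast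

lemma separating_weak: "separating V (weak_seminorms V F)"
  unfolding separating_def using F_separating functional_in_weak by (metis norm_eq_zero)

lemma separating_mackey: "separating V (mackey_seminorms V F)"
  using separating_weak weak_le_mackey unfolding separating_def by blast

end

text \<open>The seminorms q with q o f in the weak ideal of V form an ideal themselves. By the
  transpose condition it contains |\<psi>| for all \<psi> in \<open>G\<close>, hence the weak ideal
  of W.\<close>

lemma weak_seminorms_comp:
  assumes "dual_pair V F" "dual_pair W G" and f: "f \<in> linear_maps V W"
    and transpose: "\<And>\<psi>. \<psi> \<in> G \<Longrightarrow> (\<lambda>x\<in>carrier V. \<psi> (f x)) \<in> F"
    and q: "q \<in> weak_seminorms W G"
  shows "(\<lambda>x. q (f x)) \<in> weak_seminorms V F"
proof -
  interpret V: dual_pair V F by fact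
  interpret W: dual_pair W G by fact
  interpret S: ideal_space V "weak_seminorms V F" by unfold_locales (rule V.weak_ideal)
  have comp: "(\<lambda>x. q (f x)) \<in> seminorms V" if "q \<in> seminorms W" for q
    using V.seminorms_comp[OF f that] .
  have "weak_seminorms W G \<subseteq> {q \<in> seminorms W. (\<lambda>x. q (f x)) \<in> weak_seminorms V F}"
  proof (rule W.weak_least)
    show "seminorm_ideal W {q \<in> seminorms W. (\<lambda>x. q (f x)) \<in> weak_seminorms V F}"
      unfolding seminorm_ideal_def
      using S.zero_in S.plus_in S.dominated_in comp W.seminorms_zero W.seminorms_plus
        linear_maps_closed[OF f] by auto
    fix \<psi> assume \<psi>: "\<psi> \<in> G"
    have "(\<lambda>x. norm ((\<lambda>x\<in>carrier V. \<psi> (f x)) x)) \<in> weak_seminorms V F"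
      by (rule V.functional_in_weak[OF transpose[OF \<psi>]])
    \<comment> \<open>The transpose is restricted to the carrier and \<psi> o f is not; domination
      on the carrier passes from one to the other.\<close>
    then have "(\<lambda>x. norm (\<psi> (f x))) \<in> weak_seminorms V F"
      by (rule S.dominated_in) (use comp W.seminorms_functional[OF W.F_linear[OF \<psi>]] in auto)
    then show "(\<lambda>x. norm (\<psi> x)) \<in> {q \<in> seminorms W. (\<lambda>x. q (f x)) \<in> weak_seminorms V F}"
      using W.seminorms_functional[OF W.F_linear[OF \<psi>]] by simp
  qed
  then show ?thesis using q by blast
qed

text \<open>The classical fact that weakly continuous maps are continuous for the Mackey topologies.
  Usually weakly compact discs are pushed forward by the transpose; here a functional below q o f is
  extended along f to one below q.\<close>

lemma mackey_seminorms_comp: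
  assumes "dual_pair V F" "dual_pair W G" and f: "f \<in> linear_maps V W"
    and transpose: "\<And>\<psi>. \<psi> \<in> G \<Longrightarrow> (\<lambda>x\<in>carrier V. \<psi> (f x)) \<in> F"
    and q: "q \<in> mackey_seminorms W G"
  shows "(\<lambda>x. q (f x)) \<in> mackey_seminorms V F"
proof -
  interpret V: dual_pair V F by fact
  interpret W: dual_pair W G by fact
  have q': "q \<in> seminorms W" using q by (simp add: mackey_seminorms_def)
  have "\<phi> \<in> F" if \<phi>: "\<phi> \<in> linear_maps V scalars" "\<And>x. x \<in> carrier V \<Longrightarrow> norm (\<phi> x) \<le> q (f x)" for \<phi>
  proof -
    obtain \<psi> where \<psi>: "\<psi> \<in> linear_maps W scalars" "\<And>x. x \<in> carrier W \<Longrightarrow> norm (\<psi> x) \<le> q x"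
      "\<And>x. x \<in> carrier V \<Longrightarrow> \<psi> (f x) = \<phi> x"
      by (rule W.hahn_banach[OF V.vspace_axioms f q' \<phi>]) (assumption+, rule that)
    have "\<psi> \<in> G" using q \<psi>(1,2) by (simp add: mackey_seminorms_def)
    then have "(\<lambda>x\<in>carrier V. \<psi> (f x)) \<in> F" by (rule transpose)
    moreover have "\<phi> = (\<lambda>x\<in>carrier V. \<psi> (f x))"
      by (rule extensionalityI[OF linear_maps_extensional[OF \<phi>(1)]]) (auto simp: \<psi>(3))
    ultimately show ?thesis by simp
  qed
  then show ?thesis using V.seminorms_comp[OF f q'] by (simp add: mackey_seminorms_def)
qed

section \<open>Objects of chu as nondegenerate bilinear pairings\<close>

definition bilinear_on ::
    "('k::real_or_complex, 'v) module \<Rightarrow> ('k, 'w) module \<Rightarrow> ('v \<Rightarrow> 'w \<Rightarrow> 'k) \<Rightarrow> bool" where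
  "bilinear_on V W B \<longleftrightarrow>
     (\<forall>v\<in>carrier V. \<forall>v'\<in>carrier V. \<forall>w\<in>carrier W. B (v \<oplus>\<^bsub>V\<^esub> v') w = B v w + B v' w) \<and>
     (\<forall>v\<in>carrier V. \<forall>w\<in>carrier W. \<forall>w'\<in>carrier W. B v (w \<oplus>\<^bsub>W\<^esub> w') = B v w + B v w') \<and>
     (\<forall>c. \<forall>v\<in>carrier V. \<forall>w\<in>carrier W. B (c \<odot>\<^bsub>V\<^esub> v) w = c * B v w) \<and>
     (\<forall>c. \<forall>v\<in>carrier V. \<forall>w\<in>carrier W. B v (c \<odot>\<^bsub>W\<^esub> w) = c * B v w)"

text \<open>Linearity of \<open>curry_left P\<close> is linearity in the first argument, and that
  its values lie in the algebraic dual is linearity in the second. Given both, injectivity means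
  trivial kernel.\<close>

lemma curry_left_iff:
  assumes X: "lspace P \<in> vector_spaces" and Y: "rspace P \<in> vector_spaces"
  shows "curry_left P \<in> linear_maps (lspace P) (algebraic_dual (rspace P)) \<and>
       inj_on (curry_left P) (carrier (lspace P)) \<longleftrightarrow>
     bilinear_on (lspace P) (rspace P) (pairing P) \<and>
     (\<forall>v\<in>carrier (lspace P). (\<forall>w\<in>carrier (rspace P). pairing P v w = 0) \<longrightarrow> v = \<zero>\<^bsub>lspace P\<^esub>)"
    (is "?l \<and> ?i \<longleftrightarrow> ?b \<and> ?s")
proof -
  interpret X: vspace "lspace P" using X by unfold_locales
  interpret Y: vspace "rspace P" using Y by unfold_locales
  note defs = curry_left_def algebraic_dual_def hom_space_def pointwise_space_def
  have l: "?l \<longleftrightarrow> ?b"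
  proof
    assume l: ?l
    have "pairing P (v \<oplus>\<^bsub>lspace P\<^esub> v') w = pairing P v w + pairing P v' w"
      if "v \<in> carrier (lspace P)" "v' \<in> carrier (lspace P)" "w \<in> carrier (rspace P)" for v v' w
      using fun_cong[OF linear_maps_add[OF l that(1,2)], of w] that by (simp add: defs)
    moreover have "pairing P (c \<odot>\<^bsub>lspace P\<^esub> v) w = c * pairing P v w"
      if "v \<in> carrier (lspace P)" "w \<in> carrier (rspace P)" for c v w
      using fun_cong[OF linear_maps_scale[OF l that(1)], of c w] that by (simp add: defs)
    moreover have "(\<lambda>w\<in>carrier (rspace P). pairing P v w) \<in> linear_maps (rspace P) scalars"
      if "v \<in> carrier (lspace P)" for v
      using linear_maps_closed[OF l that] that by (simp add: defs)
    ultimately show ?b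
      unfolding bilinear_on_def by (simp add: linear_maps_def)
  next
    assume ?b
    then show ?l
      unfolding bilinear_on_def
      by (intro linear_mapsI) (auto simp: defs linear_maps_def fun_eq_iff)
  qed
  have "?i \<longleftrightarrow> ?s" if b: ?b
  proof
    assume i: ?i
    show ?s
    proof (intro ballI impI)
      fix v assume v: "v \<in> carrier (lspace P)" "\<forall>w\<in>carrier (rspace P). pairing P v w = 0"
      have "pairing P (0 \<odot>\<^bsub>lspace P\<^esub> v) w = 0 * pairing P v w" if "w \<in> carrier (rspace P)" for w
        using b v(1) that unfolding bilinear_on_def by blast
      then have "curry_left P v = curry_left P \<zero>\<^bsub>lspace P\<^esub>"
        using v by (auto simp: curry_left_def)
      then show "v = \<zero>\<^bsub>lspace P\<^esub>" using inj_onD[OF i] v(1) by blast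
    qed
  next
    assume s: ?s
    show ?i
    proof (rule inj_onI)
      fix x y assume xy: "x \<in> carrier (lspace P)" "y \<in> carrier (lspace P)" "curry_left P x = curry_left P y"
      have "pairing P x w = pairing P y w" if "w \<in> carrier (rspace P)" for w
        using fun_cong[OF xy(3), of w] that xy by (simp add: curry_left_def)
      then have "pairing P (x \<oplus>\<^bsub>lspace P\<^esub> (- 1) \<odot>\<^bsub>lspace P\<^esub> y) w = 0" if "w \<in> carrier (rspace P)" for w
        using b xy that by (simp add: bilinear_on_def)
      then have "x \<oplus>\<^bsub>lspace P\<^esub> (- 1) \<odot>\<^bsub>lspace P\<^esub> y = \<zero>\<^bsub>lspace P\<^esub>" using s xy by blast
      then show "x = y" using X.diff_eq_zero xy by blast
    qed
  qed
  with l show ?thesis by blast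
qed

lemma curry_left_chu_dual: "curry_left (chu_dual P) = curry_right P"
  by (simp add: curry_left_def curry_right_def chu_dual_def)

text \<open>The conditions on \<open>curry_right P\<close> are those of
  \<open>curry_left_iff\<close> for \<open>chu_dual P\<close>.\<close>

lemma chu_iff:
  "P \<in> chu \<longleftrightarrow> lspace P \<in> vector_spaces \<and> rspace P \<in> vector_spaces \<and>
     bilinear_on (lspace P) (rspace P) (pairing P) \<and>
     (\<forall>v\<in>carrier (lspace P). (\<forall>w\<in>carrier (rspace P). pairing P v w = 0) \<longrightarrow> v = \<zero>\<^bsub>lspace P\<^esub>) \<and>
     (\<forall>w\<in>carrier (rspace P). (\<forall>v\<in>carrier (lspace P). pairing P v w = 0) \<longrightarrow> w = \<zero>\<^bsub>rspace P\<^esub>)"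
proof (cases "lspace P \<in> vector_spaces \<and> rspace P \<in> vector_spaces")
  case True
  have "bilinear_on (rspace P) (lspace P) (\<lambda>w v. pairing P v w) \<longleftrightarrow>
      bilinear_on (lspace P) (rspace P) (pairing P)"
    unfolding bilinear_on_def by blast
  then show ?thesis
    using True curry_left_iff[of P] curry_left_iff[of "chu_dual P", unfolded curry_left_chu_dual]
    unfolding chu_def by (simp add: chu_dual_def) blast
qed (auto simp: chu_def)

text \<open>The second space realised inside the algebraic dual of the first. The weak and Mackey
  topologies depend only on \<open>lspace P\<close> and this set, so pairings with different second
  spaces can be compared.\<close>

definition functionals :: "('k::real_or_complex, 'v, 'w) chu_triple \<Rightarrow> ('v \<Rightarrow> 'k) set" where
  "functionals P = curry_right P ` carrier (rspace P)"

lemma dual_pair_functionals: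
  assumes P: "P \<in> chu"
  shows "dual_pair (lspace P) (functionals P)"
proof -
  note P' = P[unfolded chu_iff bilinear_on_def]
  interpret X: vspace "lspace P" using P' by unfold_locales blast
  interpret Y: vspace "rspace P" using P' by unfold_locales blast
  show ?thesis
  proof unfold_locales
    show "\<phi> \<in> linear_maps (lspace P) scalars" if "\<phi> \<in> functionals P" for \<phi>
      using that P' by (auto simp: functionals_def curry_right_def linear_maps_def)
    have "(\<lambda>x\<in>carrier (lspace P). 0) = curry_right P \<zero>\<^bsub>rspace P\<^esub>"
    proof -
      have "pairing P v (0 \<odot>\<^bsub>rspace P\<^esub> \<zero>\<^bsub>rspace P\<^esub>) = 0 * pairing P v \<zero>\<^bsub>rspace P\<^esub>" if "v \<in> carrier (lspace P)" for v
        using P' that by blast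
      then show ?thesis by (auto simp: curry_right_def)
    qed
    then show "(\<lambda>x\<in>carrier (lspace P). 0) \<in> functionals P" by (simp add: functionals_def)
    show "(\<lambda>x\<in>carrier (lspace P). \<phi> x + \<psi> x) \<in> functionals P" if FF: "\<phi> \<in> functionals P" "\<psi> \<in> functionals P" for \<phi> \<psi>
    proof -
      obtain w w' where w: "\<phi> = curry_right P w" "\<psi> = curry_right P w'" "w \<in> carrier (rspace P)" "w' \<in> carrier (rspace P)"
        using FF unfolding functionals_def by blast
      then have "(\<lambda>x\<in>carrier (lspace P). \<phi> x + \<psi> x) = curry_right P (w \<oplus>\<^bsub>rspace P\<^esub> w')"
        using P' by (auto simp: curry_right_def)
      then show ?thesis using w by (simp add: functionals_def)
    qed
    show "(\<lambda>x\<in>carrier (lspace P). c * \<phi> x) \<in> functionals P" if FF: "\<phi> \<in> functionals P" for \<phi> c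
    proof -
      obtain w where w: "\<phi> = curry_right P w" "w \<in> carrier (rspace P)"
        using FF unfolding functionals_def by blast
      then have "(\<lambda>x\<in>carrier (lspace P). c * \<phi> x) = curry_right P (c \<odot>\<^bsub>rspace P\<^esub> w)"
        using P' by (auto simp: curry_right_def)
      then show ?thesis using w by (simp add: functionals_def)
    qed
    show "\<exists>\<phi>\<in>functionals P. \<phi> x \<noteq> 0" if x: "x \<in> carrier (lspace P)" "x \<noteq> \<zero>\<^bsub>lspace P\<^esub>" for x
    proof -
      obtain w where "w \<in> carrier (rspace P)" "pairing P x w \<noteq> 0" using P' x by blast
      then show ?thesis using x by (auto simp: functionals_def curry_right_def)
    qed
  qed
qed

section \<open>Least and greatest dual topologies\<close>

lemma coarser_seminorm_topology:
  assumes "ideal_space V S" "ideal_space V S'" "S \<subseteq> S'"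
  shows "coarser_topology (seminorm_topology V S) (seminorm_topology V S')"
  using assms(3) unfolding coarser_topology_def ideal_space.openin_iff[OF assms(1)] ideal_space.openin_iff[OF assms(2)]
  by blast

lemma coarser_antisym: "coarser_topology S T \<Longrightarrow> coarser_topology T S \<Longrightarrow> S = T"
  by (auto simp: coarser_topology_def topology_eq)

text \<open>Continuity of \<phi> means that |\<phi>| is in \<open>S\<close>, so being a dual
  topology becomes a condition on the ideal. In the converse, \<open>dual_topologiesE\<close>, the
  ideal consists of the continuous seminorms.\<close>

lemma dual_topologiesI:
  assumes P: "P \<in> chu" and S: "ideal_space (lspace P) S" "separating (lspace P) S"
    and F: "\<And>\<phi>. \<phi> \<in> linear_maps (lspace P) scalars \<Longrightarrow> (\<lambda>x. norm (\<phi> x)) \<in> S \<longleftrightarrow> \<phi> \<in> functionals P"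
  shows "seminorm_topology (lspace P) S \<in> dual_topologies P"
proof -
  interpret F: dual_pair "lspace P" "functionals P" by (rule dual_pair_functionals[OF P])
  have "carrier (topological_dual \<lparr>vect = lspace P, topol = seminorm_topology (lspace P) S\<rparr>) = functionals P"
    unfolding ideal_space.carrier_topological_dual[OF S(1)] using F F.F_linear by auto
  moreover have "inj_on (curry_right P) (carrier (rspace P))" using P by (simp add: chu_def)
  ultimately show ?thesis
    unfolding dual_topologies_def using P ideal_space.seminorm_space_TVS[OF S]
    by (auto simp: bij_betw_def functionals_def)
qed

lemma dual_topologiesE:
  assumes "T \<in> dual_topologies P"
  obtains S where "ideal_space (lspace P) S" "T = seminorm_topology (lspace P) S"
    "\<And>\<phi>. \<phi> \<in> linear_maps (lspace P) scalars \<Longrightarrow> (\<lambda>x. norm (\<phi> x)) \<in> S \<longleftrightarrow> \<phi> \<in> functionals P"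
proof -
  interpret tvs "\<lparr>vect = lspace P, topol = T\<rparr>"
    using assms by unfold_locales (simp add: dual_topologies_def)
  have "functionals P = carrier (topological_dual \<lparr>vect = lspace P, topol = T\<rparr>)"
    using assms by (auto simp: dual_topologies_def bij_betw_def functionals_def)
  then show thesis
    using that[of "cont_seminorms \<lparr>vect = lspace P, topol = T\<rparr>"] cont.ideal_space_axioms topol_eq carrier_dual
    by simp
qed

text \<open>The definite description denotes something once a least dual topology exists;
  antisymmetry of \<open>coarser_topology\<close> makes it unique. Every competitor is given by an
  ideal containing |\<phi>| for all \<phi> in \<open>functionals P\<close>, hence the weak
  ideal.\<close>

lemma weak_topology_eq:
  assumes P: "P \<in> chu"
  shows "\<sigma> P = seminorm_topology (lspace P) (weak_seminorms (lspace P) (functionals P))"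
    and "\<sigma> P \<in> dual_topologies P"
proof -
  interpret F: dual_pair "lspace P" "functionals P" by (rule dual_pair_functionals[OF P])
  have ideal: "ideal_space (lspace P) (weak_seminorms (lspace P) (functionals P))"
    by unfold_locales (rule F.weak_ideal)
  let ?T = "seminorm_topology (lspace P) (weak_seminorms (lspace P) (functionals P))"
  have mem: "?T \<in> dual_topologies P"
    by (rule dual_topologiesI[OF P ideal F.separating_weak F.functional_in_weak_iff])
  have least: "coarser_topology ?T T" if T: "T \<in> dual_topologies P" for T
  proof -
    obtain S where S: "ideal_space (lspace P) S" "T = seminorm_topology (lspace P) S"
      "\<And>\<phi>. \<phi> \<in> linear_maps (lspace P) scalars \<Longrightarrow> (\<lambda>x. norm (\<phi> x)) \<in> S \<longleftrightarrow> \<phi> \<in> functionals P"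
      by (rule dual_topologiesE[OF T]) (rule that)
    show ?thesis
      unfolding S(2)
      by (rule coarser_seminorm_topology[OF ideal S(1) F.weak_least[OF ideal_space.ideal[OF S(1)]]])
        (simp add: S(3) F.F_linear)
  qed
  show *: "\<sigma> P = ?T"
    unfolding weak_topology_def by (rule the_equality) (use mem least coarser_antisym in blast)+
  show "\<sigma> P \<in> dual_topologies P" using mem * by simp
qed

lemma mackey_topology_eq:
  assumes P: "P \<in> chu"
  shows "\<tau> P = seminorm_topology (lspace P) (mackey_seminorms (lspace P) (functionals P))"
    and "\<tau> P \<in> dual_topologies P"
proof -
  interpret F: dual_pair "lspace P" "functionals P" by (rule dual_pair_functionals[OF P])
  have ideal: "ideal_space (lspace P) (mackey_seminorms (lspace P) (functionals P))"
    by unfold_locales (rule F.mackey_ideal)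
  let ?T = "seminorm_topology (lspace P) (mackey_seminorms (lspace P) (functionals P))"
  have mem: "?T \<in> dual_topologies P"
    by (rule dual_topologiesI[OF P ideal F.separating_mackey F.functional_in_mackey_iff])
  have greatest: "coarser_topology T ?T" if T: "T \<in> dual_topologies P" for T
  proof -
    obtain S where S: "ideal_space (lspace P) S" "T = seminorm_topology (lspace P) S"
      "\<And>\<phi>. \<phi> \<in> linear_maps (lspace P) scalars \<Longrightarrow> (\<lambda>x. norm (\<phi> x)) \<in> S \<longleftrightarrow> \<phi> \<in> functionals P"
      by (rule dual_topologiesE[OF T]) (rule that)
    interpret S: ideal_space "lspace P" S by fact
    \<comment> \<open>If |\<phi>| is below a member of \<open>S\<close>, it is itself in
      \<open>S\<close> by domination, so \<phi> is one of the functionals of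
      \<open>P\<close>.\<close>
    have "S \<subseteq> mackey_seminorms (lspace P) (functionals P)"
      unfolding mackey_seminorms_def
      using S(3) S.is_seminorm S.dominated_in[OF _ F.seminorms_functional] by auto
    then show ?thesis unfolding S(2) by (rule coarser_seminorm_topology[OF S(1) ideal])
  qed
  show *: "\<tau> P = ?T"
    unfolding mackey_topology_def by (rule the_equality) (use mem greatest coarser_antisym in blast)+
  show "\<tau> P \<in> dual_topologies P" using mem * by simp
qed

lemma weak_space_TVS: "P \<in> chu \<Longrightarrow> weak_space P \<in> TVS"
  and mackey_space_TVS: "P \<in> chu \<Longrightarrow> mackey_space P \<in> TVS"
  using weak_topology_eq(2)[of P] mackey_topology_eq(2)[of P]
  by (auto simp: weak_space_def mackey_space_def dual_topologies_def)

lemma weak_topology_functorial: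
  assumes P: "P \<in> chu" and Q: "Q \<in> chu" and f: "f \<in> linear_maps (lspace P) (lspace Q)"
    and transpose: "\<And>\<psi>. \<psi> \<in> functionals Q \<Longrightarrow> (\<lambda>x\<in>carrier (lspace P). \<psi> (f x)) \<in> functionals P"
  shows "continuous_map (\<sigma> P) (\<sigma> Q) f"
proof -
  interpret P: dual_pair "lspace P" "functionals P" by (rule dual_pair_functionals[OF P])
  interpret Q: dual_pair "lspace Q" "functionals Q" by (rule dual_pair_functionals[OF Q])
  show ?thesis
    unfolding weak_topology_eq(1)[OF P] weak_topology_eq(1)[OF Q]
  proof (rule continuous_seminorm_topology[OF _ _ f])
    show "(\<lambda>x. q (f x)) \<in> weak_seminorms (lspace P) (functionals P)"
      if "q \<in> weak_seminorms (lspace Q) (functionals Q)" for q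
      by (rule weak_seminorms_comp[OF P.dual_pair_axioms Q.dual_pair_axioms f transpose that])
  qed (unfold_locales, rule P.weak_ideal, unfold_locales, rule Q.weak_ideal)
qed

lemma mackey_topology_functorial:
  assumes P: "P \<in> chu" and Q: "Q \<in> chu" and f: "f \<in> linear_maps (lspace P) (lspace Q)"
    and transpose: "\<And>\<psi>. \<psi> \<in> functionals Q \<Longrightarrow> (\<lambda>x\<in>carrier (lspace P). \<psi> (f x)) \<in> functionals P"
  shows "continuous_map (\<tau> P) (\<tau> Q) f"
proof -
  interpret P: dual_pair "lspace P" "functionals P" by (rule dual_pair_functionals[OF P])
  interpret Q: dual_pair "lspace Q" "functionals Q" by (rule dual_pair_functionals[OF Q])
  show ?thesis
    unfolding mackey_topology_eq(1)[OF P] mackey_topology_eq(1)[OF Q]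
  proof (rule continuous_seminorm_topology[OF _ _ f])
    show "(\<lambda>x. q (f x)) \<in> mackey_seminorms (lspace P) (functionals P)"
      if "q \<in> mackey_seminorms (lspace Q) (functionals Q)" for q
      by (rule mackey_seminorms_comp[OF P.dual_pair_axioms Q.dual_pair_axioms f transpose that])
  qed (unfold_locales, rule P.mackey_ideal, unfold_locales, rule Q.mackey_ideal)
qed


section \<open>The algebraic tensor product\<close>

lemma lift_class: "bilinear_on V W B \<Longrightarrow> tensor_lift B (tensor_class V W p) = free_lift B p"
  by (rule tensor_lift_tensor_class) (auto simp: bilinear_on_def)

lemma lift_pure: "bilinear_on V W B \<Longrightarrow> tensor_lift B (pure_tensor V W v w) = B v w"
  by (simp add: pure_tensor_def lift_class free_lift_single)

locale tensor =
  fixes V :: "('k::real_or_complex, 'v) module" and W :: "('k, 'w) module"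
  assumes V: "V \<in> vector_spaces" and W: "W \<in> vector_spaces"
begin

sublocale V: vspace V by unfold_locales (rule V)
sublocale W: vspace W by unfold_locales (rule W)

abbreviation "T \<equiv> tensor_space V W"
abbreviation "tc \<equiv> tensor_class V W"
abbreviation "R \<equiv> Modules.module.span free_scale (tensor_relations V W)"

interpretation free: Modules.module free_scale by (rule module_free_scale)

lemma tc_self: "p \<in> tc p"
  by (simp add: tensor_class_def free.span_zero)

lemma tc_eq_iff: "tc p = tc q \<longleftrightarrow> p - q \<in> R"
proof
  assume "tc p = tc q"
  then show "p - q \<in> R" using tc_self[of p] by (auto simp: tensor_class_def)
next
  assume pq: "p - q \<in> R"
  have "x - p \<in> R \<longleftrightarrow> x - q \<in> R" for x
  proof
    assume "x - p \<in> R"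
    then have "(x - p) + (p - q) \<in> R" using pq by (rule free.span_add)
    then show "x - q \<in> R" by simp
  next
    assume "x - q \<in> R"
    then have "(x - q) - (p - q) \<in> R" using pq by (rule free.span_diff)
    then show "x - p \<in> R" by simp
  qed
  then show "tc p = tc q" by (simp add: tensor_class_def)
qed

text \<open>The class of p + q depends only on the classes of p and q, so all sets in the union that
  defines addition coincide. The same happens in \<open>tc_scale\<close>.\<close>

lemma tc_add: "tc p \<oplus>\<^bsub>T\<^esub> tc q = tc (p + q)"
proof -
  have *: "tc (p' + q') = tc (p + q)" if "p' \<in> tc p" "q' \<in> tc q" for p' q'
  proof -
    have "(p' - p) + (q' - q) \<in> R"
      using that by (intro free.span_add) (auto simp: tensor_class_def)
    then show ?thesis unfolding tc_eq_iff by (simp add: algebra_simps)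
  qed
  have "tc p \<oplus>\<^bsub>T\<^esub> tc q = (\<Union>p'\<in>tc p. \<Union>q'\<in>tc q. tc (p' + q'))"
    by (simp add: tensor_space_def)
  also have "\<dots> = (\<Union>p'\<in>tc p. \<Union>q'\<in>tc q. tc (p + q))"
    using * by (intro SUP_cong refl) auto
  also have "\<dots> = tc (p + q)" using tc_self by blast
  finally show ?thesis .
qed

lemma tc_scale: "c \<odot>\<^bsub>T\<^esub> tc p = tc (free_scale c p)"
proof -
  have *: "tc (free_scale c p') = tc (free_scale c p)" if "p' \<in> tc p" for p'
  proof -
    have "free_scale c (p' - p) \<in> R"
      using that by (intro free.span_scale) (auto simp: tensor_class_def)
    then show ?thesis unfolding tc_eq_iff by (simp add: free.scale_right_diff_distrib)
  qed
  have "c \<odot>\<^bsub>T\<^esub> tc p = (\<Union>p'\<in>tc p. tc (free_scale c p'))"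
    by (simp add: tensor_space_def)
  also have "\<dots> = (\<Union>p'\<in>tc p. tc (free_scale c p))"
    using * by (intro SUP_cong refl) auto
  also have "\<dots> = tc (free_scale c p)" using tc_self by blast
  finally show ?thesis .
qed

lemma zero_eq: "\<zero>\<^bsub>T\<^esub> = tc 0"
  by (simp add: tensor_space_def)

lemma carrier_eq: "carrier T = tc ` {p. Poly_Mapping.keys p \<subseteq> carrier V \<times> carrier W}"
  by (simp add: tensor_space_def)

lemma carrierE:
  assumes "t \<in> carrier T"
  obtains p where "t = tc p" "Poly_Mapping.keys p \<subseteq> carrier V \<times> carrier W"
  using assms by (auto simp: carrier_eq)

lemma carrierI: "Poly_Mapping.keys p \<subseteq> carrier V \<times> carrier W \<Longrightarrow> tc p \<in> carrier T"
  by (auto simp: carrier_eq)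

lemma keys_free_scale: "Poly_Mapping.keys (free_scale c p) \<subseteq> Poly_Mapping.keys p"
  by (auto simp: in_keys_iff lookup_free_scale)

lemma tensor_vector_space: "T \<in> vector_spaces"
proof (rule vector_spacesI)
  show "\<zero>\<^bsub>T\<^esub> \<in> carrier T" unfolding zero_eq by (rule carrierI) simp
  show "x \<oplus>\<^bsub>T\<^esub> y \<in> carrier T" if xy: "x \<in> carrier T" "y \<in> carrier T" for x y
  proof -
    obtain p where p: "x = tc p" "Poly_Mapping.keys p \<subseteq> carrier V \<times> carrier W" using xy(1) by (rule carrierE)
    obtain q where q: "y = tc q" "Poly_Mapping.keys q \<subseteq> carrier V \<times> carrier W" using xy(2) by (rule carrierE)
    show ?thesis
      unfolding p(1) q(1) tc_add by (rule carrierI) (use p(2) q(2) Poly_Mapping.keys_add[of p q] in blast)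
  qed
  show "c \<odot>\<^bsub>T\<^esub> x \<in> carrier T" if x: "x \<in> carrier T" for c x
  proof -
    obtain p where p: "x = tc p" "Poly_Mapping.keys p \<subseteq> carrier V \<times> carrier W" using x by (rule carrierE)
    show ?thesis
      unfolding p(1) tc_scale by (rule carrierI) (use p(2) keys_free_scale[of c p] in blast)
  qed
qed (auto simp: zero_eq tc_add tc_scale add_ac free.scale_left_distrib free.scale_right_distrib
      free.scale_scale elim!: carrierE)

sublocale T: vspace T by unfold_locales (rule tensor_vector_space)

lemma pure_closed [simp, intro]: "v \<in> carrier V \<Longrightarrow> w \<in> carrier W \<Longrightarrow> pure_tensor V W v w \<in> carrier T"
  unfolding pure_tensor_def by (rule carrierI) simp

lemma pure_add_left:
  assumes "v \<in> carrier V" "v' \<in> carrier V" "w \<in> carrier W"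
  shows "pure_tensor V W (v \<oplus>\<^bsub>V\<^esub> v') w = pure_tensor V W v w \<oplus>\<^bsub>T\<^esub> pure_tensor V W v' w"
proof -
  have "Poly_Mapping.single (v \<oplus>\<^bsub>V\<^esub> v', w) 1 - Poly_Mapping.single (v, w) 1 - Poly_Mapping.single (v', w) 1 \<in> R"
    using assms by (intro free.span_base) (auto simp: tensor_relations_def)
  then show ?thesis by (simp add: pure_tensor_def tc_add tc_eq_iff diff_diff_eq)
qed

lemma pure_add_right:
  assumes "v \<in> carrier V" "w \<in> carrier W" "w' \<in> carrier W"
  shows "pure_tensor V W v (w \<oplus>\<^bsub>W\<^esub> w') = pure_tensor V W v w \<oplus>\<^bsub>T\<^esub> pure_tensor V W v w'"
proof -
  have "Poly_Mapping.single (v, w \<oplus>\<^bsub>W\<^esub> w') 1 - Poly_Mapping.single (v, w) 1 - Poly_Mapping.single (v, w') 1 \<in> R"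
    using assms by (intro free.span_base) (auto simp: tensor_relations_def)
  then show ?thesis by (simp add: pure_tensor_def tc_add tc_eq_iff diff_diff_eq)
qed

lemma tc_single_left:
  assumes "v \<in> carrier V" "w \<in> carrier W"
  shows "tc (Poly_Mapping.single (v, w) c) = pure_tensor V W (c \<odot>\<^bsub>V\<^esub> v) w"
proof -
  have "Poly_Mapping.single (c \<odot>\<^bsub>V\<^esub> v, w) 1 - Poly_Mapping.single (v, w) c \<in> R"
    using assms by (intro free.span_base) (auto simp: tensor_relations_def)
  then have "pure_tensor V W (c \<odot>\<^bsub>V\<^esub> v) w = tc (Poly_Mapping.single (v, w) c)"
    by (simp add: pure_tensor_def tc_eq_iff)
  then show ?thesis by simp
qed

lemma tc_single_right:
  assumes "v \<in> carrier V" "w \<in> carrier W"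
  shows "tc (Poly_Mapping.single (v, w) c) = pure_tensor V W v (c \<odot>\<^bsub>W\<^esub> w)"
proof -
  have "Poly_Mapping.single (v, c \<odot>\<^bsub>W\<^esub> w) 1 - Poly_Mapping.single (v, w) c \<in> R"
    using assms by (intro free.span_base) (auto simp: tensor_relations_def)
  then have "pure_tensor V W v (c \<odot>\<^bsub>W\<^esub> w) = tc (Poly_Mapping.single (v, w) c)"
    by (simp add: pure_tensor_def tc_eq_iff)
  then show ?thesis by simp
qed

lemma pure_scale:
  assumes "v \<in> carrier V" "w \<in> carrier W"
  shows "pure_tensor V W (c \<odot>\<^bsub>V\<^esub> v) w = pure_tensor V W v (c \<odot>\<^bsub>W\<^esub> w)"
  using tc_single_left[OF assms] tc_single_right[OF assms] by metis

lemma pure_zero: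
  "w \<in> carrier W \<Longrightarrow> pure_tensor V W \<zero>\<^bsub>V\<^esub> w = \<zero>\<^bsub>T\<^esub>"
  "v \<in> carrier V \<Longrightarrow> pure_tensor V W v \<zero>\<^bsub>W\<^esub> = \<zero>\<^bsub>T\<^esub>"
  using tc_single_left[of "\<zero>\<^bsub>V\<^esub>" w 0] tc_single_right[of v "\<zero>\<^bsub>W\<^esub>" 0] by (simp_all add: zero_eq)

text \<open>Lists keep repeated summands and have a length, on which \<open>tens_zeroI\<close>
  inducts. Coefficients are absorbed into the left factors.\<close>

definition tens :: "('v \<times> 'w) list \<Rightarrow> ('k, 'v, 'w) tensor" where
  "tens ts = foldr (\<lambda>(v, w) t. pure_tensor V W v w \<oplus>\<^bsub>T\<^esub> t) ts \<zero>\<^bsub>T\<^esub>"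

lemma tens_Nil [simp]: "tens [] = \<zero>\<^bsub>T\<^esub>"
  and tens_Cons [simp]: "tens ((v, w) # ts) = pure_tensor V W v w \<oplus>\<^bsub>T\<^esub> tens ts"
  by (simp_all add: tens_def)

lemma tens_closed [simp, intro]: "set ts \<subseteq> carrier V \<times> carrier W \<Longrightarrow> tens ts \<in> carrier T"
  by (induction ts) auto

text \<open>One key of the formal sum is split off at a time. The induction runs over a finite set
  containing the keys, because it is enough to know that the remainder is supported in the smaller
  set.\<close>

lemma tensE:
  assumes "t \<in> carrier T"
  obtains ts where "set ts \<subseteq> carrier V \<times> carrier W" "t = tens ts"
proof -
  obtain p where p: "t = tc p" "Poly_Mapping.keys p \<subseteq> carrier V \<times> carrier W"
    using assms by (rule carrierE)
  have "\<exists>ts. set ts \<subseteq> carrier V \<times> carrier W \<and> tc p = tens ts"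
    if "finite K" "K \<subseteq> carrier V \<times> carrier W" "Poly_Mapping.keys p \<subseteq> K" for K p
    using that
  proof (induction K arbitrary: p rule: finite_induct)
    case empty
    then have "p = 0" by simp
    then show ?case by (intro exI[of _ "[]"]) (simp add: zero_eq)
  next
    case (insert k K)
    obtain v w where k: "k = (v, w)" by (cases k)
    define q where "q = p - Poly_Mapping.single k (Poly_Mapping.lookup p k)"
    have "Poly_Mapping.keys q \<subseteq> K"
    proof
      fix x assume x: "x \<in> Poly_Mapping.keys q"
      have "x \<noteq> k" using x by (auto simp: q_def in_keys_iff lookup_minus)
      moreover have "x \<in> Poly_Mapping.keys p" using x \<open>x \<noteq> k\<close>
        by (auto simp: q_def in_keys_iff lookup_minus lookup_single when_def)
      ultimately show "x \<in> K" using insert.prems(2) by blast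
    qed
    then obtain ts where ts: "set ts \<subseteq> carrier V \<times> carrier W" "tc q = tens ts"
      using insert.IH[of q] insert.prems(1) by blast
    have vw: "v \<in> carrier V" "w \<in> carrier W" using insert.prems(1) k by auto
    have "tc p = tc (Poly_Mapping.single k (Poly_Mapping.lookup p k)) \<oplus>\<^bsub>T\<^esub> tc q"
      by (simp add: tc_add q_def)
    also have "\<dots> = tens ((Poly_Mapping.lookup p k \<odot>\<^bsub>V\<^esub> v, w) # ts)"
      using ts(2) tc_single_left[OF vw] k by simp
    finally show ?case using ts(1) vw
      by (intro exI[of _ "(Poly_Mapping.lookup p k \<odot>\<^bsub>V\<^esub> v, w) # ts"]) auto
  qed
  from this[OF finite_keys p(2) order_refl] obtain ts where "set ts \<subseteq> carrier V \<times> carrier W" "tc p = tens ts"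
    by blast
  then show thesis using that p(1) by simp
qed

lemma lift_add:
  assumes "bilinear_on V W B" "s \<in> carrier T" "t \<in> carrier T"
  shows "tensor_lift B (s \<oplus>\<^bsub>T\<^esub> t) = tensor_lift B s + tensor_lift B t"
  using assms(2,3) by (auto elim!: carrierE simp: tc_add lift_class[OF assms(1)] free_lift_add)

lemma lift_scale:
  assumes "bilinear_on V W B" "t \<in> carrier T"
  shows "tensor_lift B (c \<odot>\<^bsub>T\<^esub> t) = c * tensor_lift B t"
  using assms(2) by (auto elim!: carrierE simp: tc_scale lift_class[OF assms(1)] free_lift_scale)

lemma lift_zero: "bilinear_on V W B \<Longrightarrow> tensor_lift B \<zero>\<^bsub>T\<^esub> = 0"
  by (simp add: zero_eq lift_class free_lift_def)

lemma lift_tens: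
  assumes "bilinear_on V W B" "set ts \<subseteq> carrier V \<times> carrier W"
  shows "tensor_lift B (tens ts) = (\<Sum>(v, w)\<leftarrow>ts. B v w)"
  using assms(2)
proof (induction ts)
  case (Cons a ts)
  obtain v w where "a = (v, w)" by (cases a)
  then show ?case
    using Cons lift_add[OF assms(1), of "pure_tensor V W v w" "tens ts"] lift_pure[OF assms(1)] by auto
qed (simp add: lift_zero[OF assms(1)])

lemma bilinear_on_rank_one:
  assumes "\<alpha> \<in> linear_maps V scalars" "\<beta> \<in> linear_maps W scalars"
  shows "bilinear_on V W (\<lambda>v w. \<alpha> v * \<beta> w)"
  using linear_maps_add[OF assms(1)] linear_maps_add[OF assms(2)]
    linear_maps_scale[OF assms(1)] linear_maps_scale[OF assms(2)]
  by (auto simp: bilinear_on_def algebra_simps)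

text \<open>
  If \<open>\<alpha> v \<noteq> 0\<close> for the first summand of a tensor killed by all \<open>\<alpha> \<otimes> \<beta>\<close>, then the right factor
  \<open>w\<close> is a combination of the other right factors, and the tensor can be written with one
  summand less.
\<close>

lemma tens_zeroI:
  assumes A: "A \<subseteq> linear_maps V scalars" "\<And>v. v \<in> carrier V \<Longrightarrow> v \<noteq> \<zero>\<^bsub>V\<^esub> \<Longrightarrow> \<exists>\<alpha>\<in>A. \<alpha> v \<noteq> 0"
    and B: "B \<subseteq> linear_maps W scalars" "\<And>w. w \<in> carrier W \<Longrightarrow> w \<noteq> \<zero>\<^bsub>W\<^esub> \<Longrightarrow> \<exists>\<beta>\<in>B. \<beta> w \<noteq> 0"
    and "set ts \<subseteq> carrier V \<times> carrier W"
    and "\<And>\<alpha> \<beta>. \<alpha> \<in> A \<Longrightarrow> \<beta> \<in> B \<Longrightarrow> tensor_lift (\<lambda>v w. \<alpha> v * \<beta> w) (tens ts) = 0"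
  shows "tens ts = \<zero>\<^bsub>T\<^esub>"
  using assms(5,6)
proof (induction "length ts" arbitrary: ts)
  case (Suc n)
  then obtain v w ts' where ts: "ts = (v, w) # ts'" "length ts' = n"
    by (metis length_Suc_conv surj_pair)
  have vw: "v \<in> carrier V" "w \<in> carrier W" "set ts' \<subseteq> carrier V \<times> carrier W"
    using Suc.prems(1) ts by auto
  show ?case
  proof (cases "v = \<zero>\<^bsub>V\<^esub>")
    case True
    then have "tens ts = tens ts'" using vw by (simp add: ts pure_zero)
    then show ?thesis using Suc.hyps(1)[of ts'] ts(2) vw(3) Suc.prems(2) by simp
  next
    case False
    obtain \<alpha> where \<alpha>: "\<alpha> \<in> A" "\<alpha> v \<noteq> 0" using A(2)[OF vw(1) False] by blast
    \<comment> \<open>\<open>d\<close> rescales \<alpha> to the value 1 at \<open>v\<close>. Summing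
      over the list, x \<otimes> y = (x - d(x) v) \<otimes> y + v \<otimes> d(x) y;
      \<open>red\<close> produces the first terms, and \<open>ws\<close> adds up the right factors
      d(x) y of the second.\<close>
    define d where "d x = \<alpha> x / \<alpha> v" for x
    define red :: "('v \<times> 'w) list \<Rightarrow> ('v \<times> 'w) list" where
      "red = map (\<lambda>(x, y). (x \<oplus>\<^bsub>V\<^esub> (- d x) \<odot>\<^bsub>V\<^esub> v, y))"
    define ws where "ws us = foldr (\<lambda>(x, y) s. d x \<odot>\<^bsub>W\<^esub> y \<oplus>\<^bsub>W\<^esub> s) us \<zero>\<^bsub>W\<^esub>" for us
    have ws_simps [simp]: "ws [] = \<zero>\<^bsub>W\<^esub>" "ws ((x, y) # us) = d x \<odot>\<^bsub>W\<^esub> y \<oplus>\<^bsub>W\<^esub> ws us" for x y us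
      by (simp_all add: ws_def)
    have ws_closed: "ws us \<in> carrier W" if "set us \<subseteq> carrier V \<times> carrier W" for us
      using that by (induction us) auto
    have red_closed: "set (red us) \<subseteq> carrier V \<times> carrier W" if "set us \<subseteq> carrier V \<times> carrier W" for us
      using that vw(1) by (auto simp: red_def)
    have red: "tens us = tens (red us) \<oplus>\<^bsub>T\<^esub> pure_tensor V W v (ws us)"
      if "set us \<subseteq> carrier V \<times> carrier W" for us
      using that
    proof (induction us)
      case Nil
      then show ?case using vw by (simp add: red_def pure_zero)
    next
      case (Cons a us)
      obtain x y where a: "a = (x, y)" by (cases a)
      have xy: "x \<in> carrier V" "y \<in> carrier W" "set us \<subseteq> carrier V \<times> carrier W"
        using Cons.prems a by auto
      let ?x = "x \<oplus>\<^bsub>V\<^esub> (- d x) \<odot>\<^bsub>V\<^esub> v"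
      have "?x \<oplus>\<^bsub>V\<^esub> d x \<odot>\<^bsub>V\<^esub> v = x"
        using xy vw by (simp add: V.add_assoc flip: V.smult_add_left)
      then have "pure_tensor V W x y = pure_tensor V W ?x y \<oplus>\<^bsub>T\<^esub> pure_tensor V W (d x \<odot>\<^bsub>V\<^esub> v) y"
        using pure_add_left[of ?x "d x \<odot>\<^bsub>V\<^esub> v" y] xy vw by simp
      also have "pure_tensor V W (d x \<odot>\<^bsub>V\<^esub> v) y = pure_tensor V W v (d x \<odot>\<^bsub>W\<^esub> y)"
        using xy vw by (intro pure_scale)
      finally have eq: "pure_tensor V W x y = pure_tensor V W ?x y \<oplus>\<^bsub>T\<^esub> pure_tensor V W v (d x \<odot>\<^bsub>W\<^esub> y)" .
      have "tens (a # us) = (pure_tensor V W ?x y \<oplus>\<^bsub>T\<^esub> pure_tensor V W v (d x \<odot>\<^bsub>W\<^esub> y)) \<oplus>\<^bsub>T\<^esub>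
          (tens (red us) \<oplus>\<^bsub>T\<^esub> pure_tensor V W v (ws us))"
        unfolding a tens_Cons eq Cons.IH[OF xy(3)] ..
      also have "\<dots> = (pure_tensor V W ?x y \<oplus>\<^bsub>T\<^esub> tens (red us)) \<oplus>\<^bsub>T\<^esub>
          (pure_tensor V W v (d x \<odot>\<^bsub>W\<^esub> y) \<oplus>\<^bsub>T\<^esub> pure_tensor V W v (ws us))"
        using xy vw ws_closed[OF xy(3)] red_closed[OF xy(3)] tens_closed pure_closed T.add_ac by simp
      also have "pure_tensor V W v (d x \<odot>\<^bsub>W\<^esub> y) \<oplus>\<^bsub>T\<^esub> pure_tensor V W v (ws us) = pure_tensor V W v (ws (a # us))"
        using xy vw ws_closed[OF xy(3)] by (simp add: a pure_add_right)
      also have "pure_tensor V W ?x y \<oplus>\<^bsub>T\<^esub> tens (red us) = tens (red (a # us))"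
        by (simp add: a red_def)
      finally show ?case .
    qed
    \<comment> \<open>As \<alpha> x = \<alpha> v * d x, the form \<alpha> \<otimes> \<beta> sees a
      list only through its \<open>ws\<close>.\<close>
    have lift: "tensor_lift (\<lambda>v w. \<alpha> v * \<beta> w) (tens us) = \<alpha> v * \<beta> (ws us)"
      if us: "set us \<subseteq> carrier V \<times> carrier W" and \<beta>: "\<beta> \<in> linear_maps W scalars" for us \<beta>
    proof -
      have "(\<Sum>(x, y)\<leftarrow>us. \<alpha> x * \<beta> y) = \<alpha> v * \<beta> (ws us)"
        using us
      proof (induction us)
        case (Cons a us)
        obtain x y where a: "a = (x, y)" by (cases a)
        have xy: "x \<in> carrier V" "y \<in> carrier W" "set us \<subseteq> carrier V \<times> carrier W"
          using Cons.prems a by auto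
        show ?case
          using Cons.IH[OF xy(3)] xy ws_closed[OF xy(3)] \<alpha>(2)
          by (simp add: a linear_maps_add[OF \<beta>] linear_maps_scale[OF \<beta>] d_def distrib_left)
      qed (simp add: W.functional_zero[OF \<beta>])
      then show ?thesis
        using lift_tens[OF bilinear_on_rank_one[OF _ \<beta>] us] A(1) \<alpha>(1) by auto
    qed
    \<comment> \<open>The left-hand side is \<open>ws ts\<close>. If it were nonzero, some \<beta>
      in \<open>B\<close> would detect it, whereas \<alpha> \<otimes> \<beta> vanishes on
      \<open>tens ts\<close>.\<close>
    have "w \<oplus>\<^bsub>W\<^esub> ws ts' = \<zero>\<^bsub>W\<^esub>"
    proof (rule ccontr)
      assume "w \<oplus>\<^bsub>W\<^esub> ws ts' \<noteq> \<zero>\<^bsub>W\<^esub>"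
      then obtain \<beta> where \<beta>: "\<beta> \<in> B" "\<beta> (w \<oplus>\<^bsub>W\<^esub> ws ts') \<noteq> 0"
        using B(2) vw ws_closed by blast
      then have \<beta>': "\<beta> \<in> linear_maps W scalars" using B(1) by blast
      have "d v = 1" using \<alpha>(2) by (simp add: d_def)
      then have "ws ts = w \<oplus>\<^bsub>W\<^esub> ws ts'" using vw by (simp add: ts)
      then have "\<alpha> v * \<beta> (w \<oplus>\<^bsub>W\<^esub> ws ts') = 0"
        using lift[OF Suc.prems(1) \<beta>'] Suc.prems(2)[OF \<alpha>(1) \<beta>(1)] by simp
      then show False using \<alpha>(2) \<beta>(2) by simp
    qed
    moreover have "tens ts = tens (red ts') \<oplus>\<^bsub>T\<^esub> pure_tensor V W v (w \<oplus>\<^bsub>W\<^esub> ws ts')"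
      using red[OF vw(3)] vw ws_closed[OF vw(3)] tens_closed[OF red_closed[OF vw(3)]]
      by (simp add: ts pure_add_right T.add_ac)
    \<comment> \<open>The head of the list is gone and \<open>red ts'\<close> has one entry less, so
      the induction hypothesis applies.\<close>
    ultimately have "tens ts = tens (red ts')"
      using vw tens_closed[OF red_closed[OF vw(3)]] by (simp add: pure_zero)
    then show ?thesis
      using Suc.hyps(1)[of "red ts'"] Suc.prems(2) red_closed[OF vw(3)] ts(2) by (simp add: red_def)
  qed
qed simp

text \<open>The forms are related on the carriers only, whereas \<open>tensor_lift\<close> takes
  functions on whole types. Writing t as a list of summands from the carriers bridges this.\<close>

lemma lift_sum:
  assumes "bilinear_on V W B" "bilinear_on V W B'" "bilinear_on V W B''" "t \<in> carrier T"
    and "\<And>v w. v \<in> carrier V \<Longrightarrow> w \<in> carrier W \<Longrightarrow> B v w = B' v w + B'' v w"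
  shows "tensor_lift B t = tensor_lift B' t + tensor_lift B'' t"
proof -
  obtain ts where ts: "set ts \<subseteq> carrier V \<times> carrier W" "t = tens ts" using assms(4) by (rule tensE)
  show ?thesis
    unfolding ts(2) lift_tens[OF assms(1) ts(1)] lift_tens[OF assms(2) ts(1)] lift_tens[OF assms(3) ts(1)]
    using ts(1) by (induction ts) (auto simp: assms(5) algebra_simps)
qed

lemma lift_mult:
  assumes "bilinear_on V W B" "bilinear_on V W B'" "t \<in> carrier T"
    and "\<And>v w. v \<in> carrier V \<Longrightarrow> w \<in> carrier W \<Longrightarrow> B v w = c * B' v w"
  shows "tensor_lift B t = c * tensor_lift B' t"
proof -
  obtain ts where ts: "set ts \<subseteq> carrier V \<times> carrier W" "t = tens ts" using assms(3) by (rule tensE)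
  show ?thesis
    unfolding ts(2) lift_tens[OF assms(1) ts(1)] lift_tens[OF assms(2) ts(1)]
    using ts(1) by (induction ts) (auto simp: assms(4) algebra_simps)
qed

text \<open>Serves both for the internal hom and for the pairing of the tensor product with
  \<open>L\<close>. Elements of \<open>H\<close> are separated by pure tensors. Tensors are
  separated because \<open>H\<close> realises the rank-one forms built from \<open>A\<close> and
  \<open>C\<close>, to which \<open>tens_zeroI\<close> applies.\<close>

lemma tensor_chu:
  assumes H: "H \<in> vector_spaces"
    and bil: "\<And>h. h \<in> carrier H \<Longrightarrow> bilinear_on V W (B h)"
    and add: "\<And>h h' v w. h \<in> carrier H \<Longrightarrow> h' \<in> carrier H \<Longrightarrow> v \<in> carrier V \<Longrightarrow> w \<in> carrier W \<Longrightarrow>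
      B (h \<oplus>\<^bsub>H\<^esub> h') v w = B h v w + B h' v w"
    and scale: "\<And>c h v w. h \<in> carrier H \<Longrightarrow> v \<in> carrier V \<Longrightarrow> w \<in> carrier W \<Longrightarrow>
      B (c \<odot>\<^bsub>H\<^esub> h) v w = c * B h v w"
    and zero: "\<And>h. h \<in> carrier H \<Longrightarrow> (\<And>v w. v \<in> carrier V \<Longrightarrow> w \<in> carrier W \<Longrightarrow> B h v w = 0) \<Longrightarrow> h = \<zero>\<^bsub>H\<^esub>"
    and A: "A \<subseteq> linear_maps V scalars" "\<And>v. v \<in> carrier V \<Longrightarrow> v \<noteq> \<zero>\<^bsub>V\<^esub> \<Longrightarrow> \<exists>\<alpha>\<in>A. \<alpha> v \<noteq> 0"
    and C: "C \<subseteq> linear_maps W scalars" "\<And>w. w \<in> carrier W \<Longrightarrow> w \<noteq> \<zero>\<^bsub>W\<^esub> \<Longrightarrow> \<exists>\<beta>\<in>C. \<beta> w \<noteq> 0"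
    and rank_one: "\<And>\<alpha> \<beta>. \<alpha> \<in> A \<Longrightarrow> \<beta> \<in> C \<Longrightarrow>
      \<exists>h\<in>carrier H. \<forall>v\<in>carrier V. \<forall>w\<in>carrier W. B h v w = \<alpha> v * \<beta> w"
  shows "\<lparr>lspace = T, rspace = H, pairing = \<lambda>t h. tensor_lift (B h) t\<rparr> \<in> chu"
proof -
  interpret H: vspace H using H by unfold_locales
  have sep_H: "h = \<zero>\<^bsub>H\<^esub>" if h: "h \<in> carrier H" "\<forall>t\<in>carrier T. tensor_lift (B h) t = 0" for h
  proof (rule zero[OF h(1)])
    fix v w assume "v \<in> carrier V" "w \<in> carrier W"
    then show "B h v w = 0" using h(2) lift_pure[OF bil[OF h(1)], of v w] by (metis pure_closed)
  qed
  have sep_T: "t = \<zero>\<^bsub>T\<^esub>" if t: "t \<in> carrier T" "\<forall>h\<in>carrier H. tensor_lift (B h) t = 0" for t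
  proof -
    obtain ts where ts: "set ts \<subseteq> carrier V \<times> carrier W" "t = tens ts" using t(1) by (rule tensE)
    have "tensor_lift (\<lambda>v w. \<alpha> v * \<beta> w) t = 0" if ab: "\<alpha> \<in> A" "\<beta> \<in> C" for \<alpha> \<beta>
    proof -
      obtain h where h: "h \<in> carrier H" "\<forall>v\<in>carrier V. \<forall>w\<in>carrier W. B h v w = \<alpha> v * \<beta> w"
        using rank_one[OF ab] by blast
      have "bilinear_on V W (\<lambda>v w. \<alpha> v * \<beta> w)"
        using ab A(1) C(1) by (intro bilinear_on_rank_one) auto
      then have "tensor_lift (\<lambda>v w. \<alpha> v * \<beta> w) t = 1 * tensor_lift (B h) t"
        by (rule lift_mult[OF _ bil[OF h(1)] t(1)]) (use h(2) in simp)
      then show ?thesis using t(2) h(1) by simp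
    qed
    then show ?thesis unfolding ts(2) by (intro tens_zeroI[OF A C ts(1)])
  qed
  show ?thesis
    unfolding chu_iff bilinear_on_def chu_triple.simps
    using tensor_vector_space H bil sep_H sep_T
    by (auto simp: lift_add lift_scale intro!: lift_sum[OF bil bil bil] lift_mult[OF bil bil] add scale)
qed

end

section \<open>Spaces of continuous linear maps\<close>

lemma pointwise_space_simps [simp]:
  "carrier (pointwise_space S V W) = S" "\<zero>\<^bsub>pointwise_space S V W\<^esub> = (\<lambda>x\<in>carrier V. \<zero>\<^bsub>W\<^esub>)"
  "f \<oplus>\<^bsub>pointwise_space S V W\<^esub> g = (\<lambda>x\<in>carrier V. f x \<oplus>\<^bsub>W\<^esub> g x)"
  "c \<odot>\<^bsub>pointwise_space S V W\<^esub> f = (\<lambda>x\<in>carrier V. c \<odot>\<^bsub>W\<^esub> f x)"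
  by (simp_all add: pointwise_space_def)

lemma linear_maps_ops:
  assumes "V \<in> vector_spaces" "W \<in> vector_spaces"
  shows "(\<lambda>x\<in>carrier V. \<zero>\<^bsub>W\<^esub>) \<in> linear_maps V W"
    and "f \<in> linear_maps V W \<Longrightarrow> g \<in> linear_maps V W \<Longrightarrow> (\<lambda>x\<in>carrier V. f x \<oplus>\<^bsub>W\<^esub> g x) \<in> linear_maps V W"
    and "f \<in> linear_maps V W \<Longrightarrow> (\<lambda>x\<in>carrier V. c \<odot>\<^bsub>W\<^esub> f x) \<in> linear_maps V W"
proof -
  interpret V: vspace V using assms by unfold_locales
  interpret W: vspace W using assms by unfold_locales
  show "(\<lambda>x\<in>carrier V. \<zero>\<^bsub>W\<^esub>) \<in> linear_maps V W"
    by (rule linear_mapsI) auto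
  show "(\<lambda>x\<in>carrier V. f x \<oplus>\<^bsub>W\<^esub> g x) \<in> linear_maps V W" if "f \<in> linear_maps V W" "g \<in> linear_maps V W"
    by (rule linear_mapsI)
      (auto simp: linear_maps_add[OF that(1)] linear_maps_add[OF that(2)] linear_maps_scale[OF that(1)]
        linear_maps_scale[OF that(2)] linear_maps_closed[OF that(1)] linear_maps_closed[OF that(2)]
        W.smult_add_right W.add_ac)
  show "(\<lambda>x\<in>carrier V. c \<odot>\<^bsub>W\<^esub> f x) \<in> linear_maps V W" if "f \<in> linear_maps V W"
    by (rule linear_mapsI)
      (auto simp: linear_maps_add[OF that(1)] linear_maps_scale[OF that(1)] linear_maps_closed[OF that(1)]
        W.smult_add_right mult.commute)
qed

lemma pointwise_vector_space:
  assumes V: "V \<in> vector_spaces" and W: "W \<in> vector_spaces" and S: "S \<subseteq> linear_maps V W"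
    and "(\<lambda>x\<in>carrier V. \<zero>\<^bsub>W\<^esub>) \<in> S"
    and "\<And>f g. f \<in> S \<Longrightarrow> g \<in> S \<Longrightarrow> (\<lambda>x\<in>carrier V. f x \<oplus>\<^bsub>W\<^esub> g x) \<in> S"
    and "\<And>c f. f \<in> S \<Longrightarrow> (\<lambda>x\<in>carrier V. c \<odot>\<^bsub>W\<^esub> f x) \<in> S"
  shows "pointwise_space S V W \<in> vector_spaces"
proof -
  interpret V: vspace V using V by unfold_locales
  interpret W: vspace W using W by unfold_locales
  have closed: "f x \<in> carrier W" if "f \<in> S" "x \<in> carrier V" for f x
    using linear_maps_closed[OF subsetD[OF S that(1)] that(2)] .
  have ext: "f \<in> extensional (carrier V)" if "f \<in> S" for f
    using linear_maps_extensional[OF subsetD[OF S that]] .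
  show ?thesis
  proof (rule vector_spacesI, unfold pointwise_space_simps)
    show "(\<lambda>x\<in>carrier V. \<zero>\<^bsub>W\<^esub>) \<in> S" by (rule assms(4))
    show "(\<lambda>x\<in>carrier V. f x \<oplus>\<^bsub>W\<^esub> g x) \<in> S" if "f \<in> S" "g \<in> S" for f g
      using that by (rule assms(5))
    show "(\<lambda>x\<in>carrier V. c \<odot>\<^bsub>W\<^esub> f x) \<in> S" if "f \<in> S" for c f
      using that by (rule assms(6))
  next
    fix f g h assume fgh: "f \<in> S" "g \<in> S" "h \<in> S"
    show "(\<lambda>x\<in>carrier V. (\<lambda>x\<in>carrier V. f x \<oplus>\<^bsub>W\<^esub> g x) x \<oplus>\<^bsub>W\<^esub> h x) =
        (\<lambda>x\<in>carrier V. f x \<oplus>\<^bsub>W\<^esub> (\<lambda>x\<in>carrier V. g x \<oplus>\<^bsub>W\<^esub> h x) x)"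
      by (rule restrict_ext) (simp add: fgh closed W.add_assoc)
  next
    fix f g assume fg: "f \<in> S" "g \<in> S"
    show "(\<lambda>x\<in>carrier V. f x \<oplus>\<^bsub>W\<^esub> g x) = (\<lambda>x\<in>carrier V. g x \<oplus>\<^bsub>W\<^esub> f x)"
      by (rule restrict_ext) (simp add: fg closed W.add_comm)
    show "(\<lambda>x\<in>carrier V. c \<odot>\<^bsub>W\<^esub> (\<lambda>x\<in>carrier V. f x \<oplus>\<^bsub>W\<^esub> g x) x) =
        (\<lambda>x\<in>carrier V. (\<lambda>x\<in>carrier V. c \<odot>\<^bsub>W\<^esub> f x) x \<oplus>\<^bsub>W\<^esub> (\<lambda>x\<in>carrier V. c \<odot>\<^bsub>W\<^esub> g x) x)" for c
      by (rule restrict_ext) (simp add: fg closed W.smult_add_right)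
  next
    fix f assume f: "f \<in> S"
    show "(\<lambda>x\<in>carrier V. (\<lambda>x\<in>carrier V. \<zero>\<^bsub>W\<^esub>) x \<oplus>\<^bsub>W\<^esub> f x) = f"
      by (rule extensionalityI[OF _ ext[OF f]]) (simp_all add: f closed)
    show "(\<lambda>x\<in>carrier V. 1 \<odot>\<^bsub>W\<^esub> f x) = f"
      by (rule extensionalityI[OF _ ext[OF f]]) (simp_all add: f closed)
    show "(\<lambda>x\<in>carrier V. 0 \<odot>\<^bsub>W\<^esub> f x) = (\<lambda>x\<in>carrier V. \<zero>\<^bsub>W\<^esub>)"
      by (rule restrict_ext) (simp add: f closed)
    show "(\<lambda>x\<in>carrier V. (c + d) \<odot>\<^bsub>W\<^esub> f x) =
        (\<lambda>x\<in>carrier V. (\<lambda>x\<in>carrier V. c \<odot>\<^bsub>W\<^esub> f x) x \<oplus>\<^bsub>W\<^esub> (\<lambda>x\<in>carrier V. d \<odot>\<^bsub>W\<^esub> f x) x)" for c d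
      by (rule restrict_ext) (simp add: f closed W.smult_add_left)
    show "(\<lambda>x\<in>carrier V. (c * d) \<odot>\<^bsub>W\<^esub> f x) =
        (\<lambda>x\<in>carrier V. c \<odot>\<^bsub>W\<^esub> (\<lambda>x\<in>carrier V. d \<odot>\<^bsub>W\<^esub> f x) x)" for c d
      by (rule restrict_ext) (simp add: f closed)
  qed
qed


lemma scalars_tvs_TVS: "(scalars_tvs :: ('k::real_or_complex, 'k) tvs) \<in> TVS"
proof -
  have add: "continuous_map (euclidean :: ('k \<times> 'k) topology) euclidean (\<lambda>(x, y). x + y)"
    unfolding continuous_map_iff_continuous2 case_prod_unfold by (intro continuous_intros)
  have mult: "continuous_map (euclidean :: ('k \<times> 'k) topology) euclidean (\<lambda>(x, y). x * y)"
    unfolding continuous_map_iff_continuous2 case_prod_unfold by (intro continuous_intros)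
  have convex: "convex_in scalars (ball (0 :: 'k) e)" for e
    unfolding convex_in_def
  proof (intro conjI ballI allI impI)
    fix x y :: 'k and t :: real
    assume xy: "x \<in> ball 0 e" "y \<in> ball 0 e" and t: "0 \<le> t \<and> t \<le> 1"
    have "norm (of_real (1 - t) * x + of_real t * y) \<le> norm (of_real (1 - t) * x) + norm (of_real t * y)"
      by (rule norm_triangle_ineq)
    also have "\<dots> = (1 - t) * norm x + t * norm y"
      unfolding norm_mult norm_of_real using t by simp
    also have "\<dots> < e"
      using convex_bound_lt[of "norm x" e "norm y" "1 - t" t] xy t by simp
    finally show "of_real (1 - t) \<odot>\<^bsub>scalars\<^esub> x \<oplus>\<^bsub>scalars\<^esub> of_real t \<odot>\<^bsub>scalars\<^esub> y \<in> ball 0 e" by simp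
  qed auto
  have base: "neighbourhood_base_at (0 :: 'k) (convex_in scalars) euclidean"
    unfolding neighbourhood_base_at_def
  proof (intro allI impI)
    fix U :: "'k set" assume "openin euclidean U \<and> 0 \<in> U"
    then obtain e where "0 < e" "ball 0 e \<subseteq> U" by (metis openE open_openin)
    then show "\<exists>A B. openin euclidean A \<and> convex_in scalars B \<and> 0 \<in> A \<and> A \<subseteq> B \<and> B \<subseteq> U"
      using convex[of e] by (intro exI[of _ "ball 0 e"]) auto
  qed
  show ?thesis
    unfolding TVS_def scalars_tvs_def
    using scalars_vector_space add mult base Hausdorff_space_euclidean by simp
qed

lemma L_carrier: "carrier (L A B) = continuous_linear_maps A B"
  by (simp add: L_def)

lemma L_vector_space:
  assumes A: "A \<in> TVS" and B: "B \<in> TVS"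
  shows "L A B \<in> vector_spaces"
  unfolding L_def
proof (rule pointwise_vector_space)
  interpret A: tvs A by unfold_locales (rule A)
  interpret B: tvs B by unfold_locales (rule B)
  note ops = linear_maps_ops[OF A.vector_space B.vector_space]
  \<comment> \<open>Restriction to the carrier does not affect continuity, since the carrier is the
    whole topspace.\<close>
  have cong: "continuous_map (topol A) (topol B) (restrict f (carrier (vect A)))"
    if "continuous_map (topol A) (topol B) f" for f
    using continuous_map_eq[OF that] by (simp add: A.topspace_eq)
  show "continuous_linear_maps A B \<subseteq> linear_maps (vect A) (vect B)"
    by (auto simp: continuous_linear_maps_def)
  have "continuous_map (topol A) (topol B) (\<lambda>x. \<zero>\<^bsub>vect B\<^esub>)"
    by (simp add: B.topspace_eq)
  then show "(\<lambda>x\<in>carrier (vect A). \<zero>\<^bsub>vect B\<^esub>) \<in> continuous_linear_maps A B"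
    using ops(1) cong by (simp add: continuous_linear_maps_def)
  show "(\<lambda>x\<in>carrier (vect A). f x \<oplus>\<^bsub>vect B\<^esub> g x) \<in> continuous_linear_maps A B"
    if "f \<in> continuous_linear_maps A B" "g \<in> continuous_linear_maps A B" for f g
  proof -
    have fg: "f \<in> linear_maps (vect A) (vect B)" "g \<in> linear_maps (vect A) (vect B)"
      "continuous_map (topol A) (topol B) f" "continuous_map (topol A) (topol B) g"
      using that by (simp_all add: continuous_linear_maps_def)
    have "continuous_map (topol A) (prod_topology (topol B) (topol B)) (\<lambda>x. (f x, g x))"
      using fg(3,4) by (rule continuous_map_pairedI)
    moreover have "continuous_map (prod_topology (topol B) (topol B)) (topol B) (\<lambda>(x, y). x \<oplus>\<^bsub>vect B\<^esub> y)"
      using B by (simp add: TVS_def)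
    ultimately have "continuous_map (topol A) (topol B) ((\<lambda>(x, y). x \<oplus>\<^bsub>vect B\<^esub> y) \<circ> (\<lambda>x. (f x, g x)))"
      by (rule continuous_map_compose)
    then have "continuous_map (topol A) (topol B) (\<lambda>x. f x \<oplus>\<^bsub>vect B\<^esub> g x)"
      by (simp add: o_def)
    then show ?thesis
      using ops(2)[OF fg(1,2)] cong by (simp add: continuous_linear_maps_def)
  qed
  show "(\<lambda>x\<in>carrier (vect A). c \<odot>\<^bsub>vect B\<^esub> f x) \<in> continuous_linear_maps A B"
    if "f \<in> continuous_linear_maps A B" for c f
  proof -
    have f: "f \<in> linear_maps (vect A) (vect B)" "continuous_map (topol A) (topol B) f"
      using that by (simp_all add: continuous_linear_maps_def)
    have "continuous_map (topol A) (prod_topology euclidean (topol B)) (\<lambda>x. (c, f x))"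
      using f(2) by (intro continuous_map_pairedI) simp_all
    from continuous_map_compose[OF this B.continuous_smult]
    have "continuous_map (topol A) (topol B) (\<lambda>x. c \<odot>\<^bsub>vect B\<^esub> f x)"
      by (simp add: o_def)
    then show ?thesis
      using ops(3)[OF f(1)] cong by (simp add: continuous_linear_maps_def)
  qed
qed (use A B in \<open>simp_all add: TVS_def\<close>)

section \<open>Topological duals and the chu triple of a space\<close>

lemma topological_dual_vector_space: "A \<in> TVS \<Longrightarrow> topological_dual A \<in> vector_spaces"
  unfolding topological_dual_def by (rule L_vector_space[OF _ scalars_tvs_TVS])

lemma topological_dual_ops [simp]:
  "\<zero>\<^bsub>topological_dual A\<^esub> = (\<lambda>x\<in>carrier (vect A). 0)"
  "\<phi> \<oplus>\<^bsub>topological_dual A\<^esub> \<psi> = (\<lambda>x\<in>carrier (vect A). \<phi> x + \<psi> x)"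
  "c \<odot>\<^bsub>topological_dual A\<^esub> \<phi> = (\<lambda>x\<in>carrier (vect A). c * \<phi> x)"
  by (simp_all add: topological_dual_def L_def scalars_tvs_def)

lemma topological_dual_linear:
  "\<phi> \<in> carrier (topological_dual A) \<Longrightarrow> \<phi> \<in> linear_maps (vect A) scalars"
  by (simp add: topological_dual_def L_def scalars_tvs_def continuous_linear_maps_def)

text \<open>Some continuous seminorm is nonzero at x; a functional that lies below it and norms x is
  continuous by domination.\<close>

lemma topological_dual_separating:
  assumes A: "A \<in> TVS" and x: "x \<in> carrier (vect A)" "x \<noteq> \<zero>\<^bsub>vect A\<^esub>"
  shows "\<exists>\<phi>\<in>carrier (topological_dual A). \<phi> x \<noteq> 0"
proof -
  interpret A: tvs A by unfold_locales (rule A)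
  obtain p where p: "p \<in> cont_seminorms A" "p x \<noteq> 0"
    using A.separating_cont x unfolding separating_def by blast
  obtain \<psi> where \<psi>: "\<psi> \<in> linear_maps (vect A) scalars"
    "\<And>y. y \<in> carrier (vect A) \<Longrightarrow> norm (\<psi> y) \<le> p y" "\<psi> x = of_real (p x)"
    by (rule A.norming_functional[OF A.cont.is_seminorm[OF p(1)] x(1)]) (rule that)
  have "(\<lambda>x. norm (\<psi> x)) \<in> cont_seminorms A"
    by (rule A.cont.dominated_in[OF p(1) A.seminorms_functional[OF \<psi>(1)] \<psi>(2)])
  then have "\<psi> \<in> carrier (topological_dual A)"
    using \<psi>(1) by (simp add: A.carrier_dual)
  then show ?thesis using \<psi>(3) p(2) by (intro bexI[of _ \<psi>]) simp_all
qed

lemma to_chu_chu: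
  assumes A: "A \<in> TVS"
  shows "to_chu A \<in> chu"
proof -
  interpret A: tvs A by unfold_locales (rule A)
  have zero: "\<phi> = (\<lambda>x\<in>carrier (vect A). 0)"
    if "\<phi> \<in> carrier (topological_dual A)" "\<forall>x\<in>carrier (vect A). \<phi> x = 0" for \<phi>
    by (rule extensionalityI[OF linear_maps_extensional[OF topological_dual_linear[OF that(1)]]])
      (simp_all add: that(2))
  have sep: "x = \<zero>\<^bsub>vect A\<^esub>"
    if "x \<in> carrier (vect A)" "\<forall>\<phi>\<in>carrier (topological_dual A). \<phi> x = 0" for x
    using topological_dual_separating[OF A that(1)] that(2) by blast
  have "\<phi> (x \<oplus>\<^bsub>vect A\<^esub> y) = \<phi> x + \<phi> y" "\<phi> (c \<odot>\<^bsub>vect A\<^esub> x) = c * \<phi> x"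
    if "\<phi> \<in> carrier (topological_dual A)" "x \<in> carrier (vect A)" "y \<in> carrier (vect A)" for \<phi> x y c
    using that linear_maps_add[OF topological_dual_linear[OF that(1)]]
      linear_maps_scale[OF topological_dual_linear[OF that(1)]] by simp_all
  then show ?thesis
    unfolding chu_iff bilinear_on_def to_chu_def chu_triple.simps
    using A.vector_space topological_dual_vector_space[OF A] zero sep by simp
qed

lemma chu_dual_chu: "P \<in> chu \<Longrightarrow> chu_dual P \<in> chu"
  unfolding chu_iff bilinear_on_def chu_dual_def chu_triple.simps by simp

lemma chu_dual_dual: "chu_dual (chu_dual P) = P"
  by (cases P) (simp add: chu_dual_def)

lemma functionals_to_chu: "functionals (to_chu A) = carrier (topological_dual A)"
proof -
  have "curry_right (to_chu A) \<phi> = \<phi>" if "\<phi> \<in> carrier (topological_dual A)" for \<phi>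
    using that extensional_restrict[OF linear_maps_extensional[OF topological_dual_linear[OF that]]]
    by (simp add: curry_right_def to_chu_def)
  then show ?thesis by (simp add: functionals_def to_chu_def)
qed

text \<open>Passing from a triple to a space with a dual topology and back replaces the second space
  by an isomorphic copy but keeps the functionals, hence also the weak and Mackey
  topologies.\<close>

lemma functionals_to_chu_dual_topology:
  assumes "T \<in> dual_topologies P"
  shows "functionals (to_chu \<lparr>vect = lspace P, topol = T\<rparr>) = functionals P"
  unfolding functionals_to_chu using assms by (simp add: dual_topologies_def bij_betw_def functionals_def)

text \<open>The second component of a morphism supplies the transpose that
  \<open>weak_topology_functorial\<close> and \<open>mackey_topology_functorial\<close> ask
  for.\<close>

lemma chu_homs_transpose:
  assumes h: "(f, g) \<in> chu_homs P Q" and \<psi>: "\<psi> \<in> functionals Q"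
  shows "(\<lambda>x\<in>carrier (lspace P). \<psi> (f x)) \<in> functionals P"
proof -
  obtain w where w: "w \<in> carrier (rspace Q)" "\<psi> = curry_right Q w"
    using \<psi> unfolding functionals_def by blast
  have f: "f \<in> linear_maps (lspace P) (lspace Q)" and g: "g \<in> linear_maps (rspace Q) (rspace P)"
    and eq: "\<And>v w. v \<in> carrier (lspace P) \<Longrightarrow> w \<in> carrier (rspace Q) \<Longrightarrow> pairing Q (f v) w = pairing P v (g w)"
    using h by (auto simp: chu_homs_def)
  have "(\<lambda>x\<in>carrier (lspace P). \<psi> (f x)) = curry_right P (g w)"
    unfolding w(2) curry_right_def using w(1)
    by (simp add: linear_maps_closed[OF f] linear_maps_closed[OF g] eq cong: restrict_cong)
  then show ?thesis using linear_maps_closed[OF g w(1)] by (simp add: functionals_def)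
qed

lemma pairing_bilinear:
  assumes "P \<in> chu" "v \<in> carrier (lspace P)" "w \<in> carrier (rspace P)"
  shows "v' \<in> carrier (lspace P) \<Longrightarrow> pairing P (v \<oplus>\<^bsub>lspace P\<^esub> v') w = pairing P v w + pairing P v' w"
    and "w' \<in> carrier (rspace P) \<Longrightarrow> pairing P v (w \<oplus>\<^bsub>rspace P\<^esub> w') = pairing P v w + pairing P v w'"
    and "pairing P (c \<odot>\<^bsub>lspace P\<^esub> v) w = c * pairing P v w"
    and "pairing P v (c \<odot>\<^bsub>rspace P\<^esub> w) = c * pairing P v w"
  using assms unfolding chu_iff bilinear_on_def by simp_all

section \<open>The internal hom\<close>

lemma hom_space_ops:
  "\<zero>\<^bsub>hom_space V W\<^esub> = (\<lambda>x\<in>carrier V. \<zero>\<^bsub>W\<^esub>)"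
  "f \<oplus>\<^bsub>hom_space V W\<^esub> g = (\<lambda>x\<in>carrier V. f x \<oplus>\<^bsub>W\<^esub> g x)"
  "c \<odot>\<^bsub>hom_space V W\<^esub> f = (\<lambda>x\<in>carrier V. c \<odot>\<^bsub>W\<^esub> f x)"
  "carrier (hom_space V W) = linear_maps V W"
  by (simp_all add: hom_space_def)

lemma hom_space_vector_space: "V \<in> vector_spaces \<Longrightarrow> W \<in> vector_spaces \<Longrightarrow> hom_space V W \<in> vector_spaces"
  unfolding hom_space_def by (rule pointwise_vector_space) (auto simp: linear_maps_ops)

lemma chu_hom_space_simps:
  "carrier (chu_hom_space P Q) = chu_homs P Q"
  "\<zero>\<^bsub>chu_hom_space P Q\<^esub> = (\<zero>\<^bsub>hom_space (lspace P) (lspace Q)\<^esub>, \<zero>\<^bsub>hom_space (rspace Q) (rspace P)\<^esub>)"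
  "(f, g) \<oplus>\<^bsub>chu_hom_space P Q\<^esub> (f', g') =
     (f \<oplus>\<^bsub>hom_space (lspace P) (lspace Q)\<^esub> f', g \<oplus>\<^bsub>hom_space (rspace Q) (rspace P)\<^esub> g')"
  "c \<odot>\<^bsub>chu_hom_space P Q\<^esub> (f, g) =
     (c \<odot>\<^bsub>hom_space (lspace P) (lspace Q)\<^esub> f, c \<odot>\<^bsub>hom_space (rspace Q) (rspace P)\<^esub> g)"
  by (simp_all add: chu_hom_space_def Let_def)

lemma chu_hom_space_vector_space:
  assumes P: "P \<in> chu" and Q: "Q \<in> chu"
  shows "chu_hom_space P Q \<in> vector_spaces"
proof -
  note P' = P[unfolded chu_iff bilinear_on_def] and Q' = Q[unfolded chu_iff bilinear_on_def]
  interpret F: vspace "hom_space (lspace P) (lspace Q)"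
    using P' Q' by unfold_locales (rule hom_space_vector_space; blast)
  interpret G: vspace "hom_space (rspace Q) (rspace P)"
    using P' Q' by unfold_locales (rule hom_space_vector_space; blast)
  interpret X: vspace "lspace P" using P' by unfold_locales blast
  interpret Y: vspace "rspace Q" using Q' by unfold_locales blast
  let ?H = "chu_hom_space P Q"
  have homs: "(f, g) \<in> chu_homs P Q \<longleftrightarrow>
      f \<in> carrier (hom_space (lspace P) (lspace Q)) \<and> g \<in> carrier (hom_space (rspace Q) (rspace P)) \<and>
      (\<forall>v\<in>carrier (lspace P). \<forall>w\<in>carrier (rspace Q). pairing Q (f v) w = pairing P v (g w))" for f g
    by (auto simp: chu_homs_def hom_space_ops)
  have closed: "f v \<in> carrier (lspace Q)" if "f \<in> carrier (hom_space (lspace P) (lspace Q))" "v \<in> carrier (lspace P)" for f v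
    using that linear_maps_closed[of f] by (simp add: hom_space_ops)
  have closed': "g w \<in> carrier (rspace P)" if "g \<in> carrier (hom_space (rspace Q) (rspace P))" "w \<in> carrier (rspace Q)" for g w
    using that linear_maps_closed[of g] by (simp add: hom_space_ops)
  note bil = pairing_bilinear(1,3)[OF Q] pairing_bilinear(2,4)[OF P]
  have pz: "pairing Q \<zero>\<^bsub>lspace Q\<^esub> w = 0" if "w \<in> carrier (rspace Q)" for w
  proof -
    interpret Z: vspace "lspace Q" using Q' by unfold_locales blast
    show ?thesis using pairing_bilinear(3)[OF Q Z.zero_closed that, of 0] by simp
  qed
  have pz': "pairing P v \<zero>\<^bsub>rspace P\<^esub> = 0" if "v \<in> carrier (lspace P)" for v
  proof -
    interpret Z: vspace "rspace P" using P' by unfold_locales blast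
    show ?thesis using pairing_bilinear(4)[OF P that Z.zero_closed, of 0] by simp
  qed
  have zero: "\<zero>\<^bsub>?H\<^esub> \<in> chu_homs P Q"
    unfolding chu_hom_space_simps homs using F.zero_closed G.zero_closed by (simp add: hom_space_ops(1) pz pz')
  have add: "(f, g) \<oplus>\<^bsub>?H\<^esub> (f', g') \<in> chu_homs P Q"
    if "(f, g) \<in> chu_homs P Q" "(f', g') \<in> chu_homs P Q" for f g f' g'
    using that F.add_closed[of f f'] G.add_closed[of g g'] unfolding chu_hom_space_simps homs
    by (simp add: closed closed' bil hom_space_ops(2))
  have scale: "c \<odot>\<^bsub>?H\<^esub> (f, g) \<in> chu_homs P Q" if "(f, g) \<in> chu_homs P Q" for c f g
    using that F.smult_closed[of f c] G.smult_closed[of g c] unfolding chu_hom_space_simps homs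
    by (simp add: closed closed' bil hom_space_ops(3))
  show ?thesis
  proof (rule vector_spacesI, unfold chu_hom_space_simps(1))
    fix x y z assume "x \<in> chu_homs P Q" "y \<in> chu_homs P Q" "z \<in> chu_homs P Q"
    moreover obtain f g f' g' f'' g'' where "x = (f, g)" "y = (f', g')" "z = (f'', g'')"
      by (cases x, cases y, cases z)
    ultimately show "(x \<oplus>\<^bsub>?H\<^esub> y) \<oplus>\<^bsub>?H\<^esub> z = x \<oplus>\<^bsub>?H\<^esub> (y \<oplus>\<^bsub>?H\<^esub> z)"
      by (simp add: chu_hom_space_simps homs F.add_assoc G.add_assoc)
  next
    fix x y assume xy: "x \<in> chu_homs P Q" "y \<in> chu_homs P Q"
    obtain f g f' g' where eq: "x = (f, g)" "y = (f', g')" by (cases x, cases y)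
    show "x \<oplus>\<^bsub>?H\<^esub> y \<in> chu_homs P Q" using add xy unfolding eq by blast
    show "x \<oplus>\<^bsub>?H\<^esub> y = y \<oplus>\<^bsub>?H\<^esub> x"
      using xy unfolding eq by (simp add: chu_hom_space_simps homs F.add_comm G.add_comm)
    show "c \<odot>\<^bsub>?H\<^esub> (x \<oplus>\<^bsub>?H\<^esub> y) = c \<odot>\<^bsub>?H\<^esub> x \<oplus>\<^bsub>?H\<^esub> c \<odot>\<^bsub>?H\<^esub> y" for c
      using xy unfolding eq by (simp add: chu_hom_space_simps homs F.smult_add_right G.smult_add_right)
  next
    fix x assume x: "x \<in> chu_homs P Q"
    obtain f g where eq: "x = (f, g)" by (cases x)
    show "c \<odot>\<^bsub>?H\<^esub> x \<in> chu_homs P Q" for c using scale x unfolding eq by blast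
    show "\<zero>\<^bsub>?H\<^esub> \<oplus>\<^bsub>?H\<^esub> x = x" "1 \<odot>\<^bsub>?H\<^esub> x = x" "0 \<odot>\<^bsub>?H\<^esub> x = \<zero>\<^bsub>?H\<^esub>"
      using x unfolding eq by (simp_all add: chu_hom_space_simps homs)
    show "(c + d) \<odot>\<^bsub>?H\<^esub> x = c \<odot>\<^bsub>?H\<^esub> x \<oplus>\<^bsub>?H\<^esub> d \<odot>\<^bsub>?H\<^esub> x" "(c * d) \<odot>\<^bsub>?H\<^esub> x = c \<odot>\<^bsub>?H\<^esub> (d \<odot>\<^bsub>?H\<^esub> x)" for c d
      using x unfolding eq by (simp_all add: chu_hom_space_simps homs F.smult_add_left G.smult_add_left)
  qed (rule zero)
qed

text \<open>Puts the tensor space on the left, as \<open>tensor_chu\<close> expects.\<close>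

lemma chu_internal_hom_dual:
  "chu_dual (chu_internal_hom P Q) =
     \<lparr>lspace = tensor_space (lspace P) (rspace Q), rspace = chu_hom_space P Q,
      pairing = \<lambda>t h. tensor_lift (\<lambda>v w. pairing Q (fst h v) w) t\<rparr>"
  by (simp add: chu_dual_def chu_internal_hom_def case_prod_unfold)

text \<open>Membership in \<open>chu\<close> is invariant under duality, so the dual is treated by
  \<open>tensor_chu\<close>; the rank-one forms come from rank-one morphisms.\<close>

lemma chu_internal_hom_chu:
  assumes P: "P \<in> chu" and Q: "Q \<in> chu"
  shows "chu_internal_hom P Q \<in> chu"
proof -
  note P' = P[unfolded chu_iff bilinear_on_def] and Q' = Q[unfolded chu_iff bilinear_on_def]
  interpret P: dual_pair "lspace P" "functionals P" by (rule dual_pair_functionals[OF P])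
  interpret Q: dual_pair "rspace Q" "functionals (chu_dual Q)"
    using dual_pair_functionals[OF chu_dual_chu[OF Q]] by (simp add: chu_dual_def)
  interpret X: vspace "rspace P" using P' by unfold_locales blast
  interpret Y: vspace "lspace Q" using Q' by unfold_locales blast
  interpret tensor "lspace P" "rspace Q" using P' Q' by unfold_locales blast+
  have homs: "f \<in> linear_maps (lspace P) (lspace Q)" "g \<in> linear_maps (rspace Q) (rspace P)"
    "\<And>v w. v \<in> carrier (lspace P) \<Longrightarrow> w \<in> carrier (rspace Q) \<Longrightarrow> pairing Q (f v) w = pairing P v (g w)"
    if "(f, g) \<in> chu_homs P Q" for f g
    using that by (auto simp: chu_homs_def)
  have "\<lparr>lspace = T, rspace = chu_hom_space P Q, pairing = \<lambda>t h. tensor_lift (\<lambda>v w. pairing Q (fst h v) w) t\<rparr> \<in> chu"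
  proof (rule tensor_chu[where A = "functionals P" and C = "functionals (chu_dual Q)"])
    show "chu_hom_space P Q \<in> vector_spaces" by (rule chu_hom_space_vector_space[OF P Q])
    show "bilinear_on (lspace P) (rspace Q) (\<lambda>v w. pairing Q (fst h v) w)" if h: "h \<in> carrier (chu_hom_space P Q)" for h
    proof -
      obtain f g where fg: "h = (f, g)" "(f, g) \<in> chu_homs P Q" using h by (cases h) (simp add: chu_hom_space_simps)
      note f = homs(1)[OF fg(2)]
      show ?thesis
        unfolding bilinear_on_def fg(1) fst_conv
        using Q' by (simp add: linear_maps_add[OF f] linear_maps_scale[OF f] linear_maps_closed[OF f])
    qed
  next
    fix h h' v w assume h: "h \<in> carrier (chu_hom_space P Q)" "h' \<in> carrier (chu_hom_space P Q)"
      and vw: "v \<in> carrier (lspace P)" "w \<in> carrier (rspace Q)"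
    obtain f g f' g' where fg: "h = (f, g)" "h' = (f', g')" by (cases h, cases h')
    have "f v \<in> carrier (lspace Q)" "f' v \<in> carrier (lspace Q)"
      using linear_maps_closed[OF homs(1) vw(1)] h unfolding fg chu_hom_space_simps(1) by blast+
    then show "pairing Q (fst (h \<oplus>\<^bsub>chu_hom_space P Q\<^esub> h') v) w = pairing Q (fst h v) w + pairing Q (fst h' v) w"
      using vw Q' by (simp add: fg chu_hom_space_simps hom_space_ops)
  next
    fix c h v w assume h: "h \<in> carrier (chu_hom_space P Q)"
      and vw: "v \<in> carrier (lspace P)" "w \<in> carrier (rspace Q)"
    obtain f g where fg: "h = (f, g)" by (cases h)
    have "f v \<in> carrier (lspace Q)"
      using linear_maps_closed[OF homs(1) vw(1)] h unfolding fg chu_hom_space_simps(1) by blast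
    then show "pairing Q (fst (c \<odot>\<^bsub>chu_hom_space P Q\<^esub> h) v) w = c * pairing Q (fst h v) w"
      using vw Q' by (simp add: fg chu_hom_space_simps hom_space_ops)
  next
    fix h assume h: "h \<in> carrier (chu_hom_space P Q)"
      and zero: "\<And>v w. v \<in> carrier (lspace P) \<Longrightarrow> w \<in> carrier (rspace Q) \<Longrightarrow> pairing Q (fst h v) w = 0"
    obtain f g where fg: "h = (f, g)" "(f, g) \<in> chu_homs P Q" using h by (cases h) (simp add: chu_hom_space_simps)
    note f = homs(1)[OF fg(2)] and g = homs(2)[OF fg(2)]
    have "f v = \<zero>\<^bsub>lspace Q\<^esub>" if "v \<in> carrier (lspace P)" for v
      using Q' linear_maps_closed[OF f that] zero[OF that] unfolding fg(1) by simp
    then have "f = (\<lambda>x\<in>carrier (lspace P). \<zero>\<^bsub>lspace Q\<^esub>)"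
      by (intro extensionalityI[OF linear_maps_extensional[OF f]]) simp_all
    \<comment> \<open>The adjunction turns the vanishing of the form into the vanishing of all
      pairings of v with g w, and \<open>P\<close> is nondegenerate.\<close>
    moreover have "g w = \<zero>\<^bsub>rspace P\<^esub>" if w: "w \<in> carrier (rspace Q)" for w
    proof -
      have "\<forall>v\<in>carrier (lspace P). pairing P v (g w) = 0"
        using homs(3)[OF fg(2) _ w] zero[OF _ w] by (simp add: fg(1))
      then show ?thesis using P' linear_maps_closed[OF g w] by blast
    qed
    then have "g = (\<lambda>x\<in>carrier (rspace Q). \<zero>\<^bsub>rspace P\<^esub>)"
      by (intro extensionalityI[OF linear_maps_extensional[OF g]]) simp_all
    ultimately show "h = \<zero>\<^bsub>chu_hom_space P Q\<^esub>" by (simp add: fg(1) chu_hom_space_simps hom_space_ops)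
  next
    fix \<alpha> \<beta> assume "\<alpha> \<in> functionals P" "\<beta> \<in> functionals (chu_dual Q)"
    then obtain x u where x: "x \<in> carrier (rspace P)" "\<alpha> = curry_right P x"
      and u: "u \<in> carrier (lspace Q)" "\<beta> = curry_right (chu_dual Q) u"
      unfolding functionals_def by (auto simp: chu_dual_def)
    \<comment> \<open>The morphism v -> <v, x> u, with transpose w -> <u, w> x.\<close>
    define f where "f = (\<lambda>v\<in>carrier (lspace P). pairing P v x \<odot>\<^bsub>lspace Q\<^esub> u)"
    define g where "g = (\<lambda>w\<in>carrier (rspace Q). pairing Q u w \<odot>\<^bsub>rspace P\<^esub> x)"
    have "f \<in> linear_maps (lspace P) (lspace Q)"
      by (rule linear_mapsI) (use P' x(1) u(1) in \<open>auto simp: f_def Y.smult_add_left\<close>)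
    moreover have "g \<in> linear_maps (rspace Q) (rspace P)"
      by (rule linear_mapsI) (use Q' x(1) u(1) in \<open>auto simp: g_def X.smult_add_left\<close>)
    ultimately have "(f, g) \<in> chu_homs P Q"
      using P' Q' x(1) u(1) by (simp add: chu_homs_def f_def g_def)
    then show "\<exists>h\<in>carrier (chu_hom_space P Q). \<forall>v\<in>carrier (lspace P). \<forall>w\<in>carrier (rspace Q).
        pairing Q (fst h v) w = \<alpha> v * \<beta> w"
      using P' Q' x u
      by (intro bexI[of _ "(f, g)"]) (simp_all add: chu_hom_space_simps curry_right_def chu_dual_def f_def)
  qed (auto intro: P.F_linear Q.F_linear P.F_separating Q.F_separating)
  then have "chu_dual (chu_dual (chu_internal_hom P Q)) \<in> chu"
    unfolding chu_internal_hom_dual by (rule chu_dual_chu)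
  then show ?thesis unfolding chu_dual_dual .
qed


section \<open>The tensor products of weak and of Mackey spaces\<close>

lemma inverse_linear_map:
  assumes V: "V \<in> vector_spaces" and f: "f \<in> linear_maps V W" and bij: "bij_betw f (carrier V) (carrier W)"
  shows "restrict (inv_into (carrier V) f) (carrier W) \<in> linear_maps W V"
proof -
  interpret V: vspace V using V by unfold_locales
  let ?g = "inv_into (carrier V) f"
  have g: "?g y \<in> carrier V" "f (?g y) = y" if "y \<in> carrier W" for y
    using that bij by (auto simp: bij_betw_def intro: inv_into_into f_inv_into_f)
  have inv: "?g (f x) = x" if "x \<in> carrier V" for x
    using that bij by (simp add: bij_betw_def)
  have add: "y \<oplus>\<^bsub>W\<^esub> z = f (?g y \<oplus>\<^bsub>V\<^esub> ?g z)" if "y \<in> carrier W" "z \<in> carrier W" for y z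
    using linear_maps_add[OF f g(1)[OF that(1)] g(1)[OF that(2)]] g(2) that by simp
  have scale: "c \<odot>\<^bsub>W\<^esub> y = f (c \<odot>\<^bsub>V\<^esub> ?g y)" if "y \<in> carrier W" for c y
    using linear_maps_scale[OF f g(1)[OF that]] g(2) that by simp
  show ?thesis
    by (rule linear_mapsI) (simp_all add: g(1) add scale inv linear_maps_closed[OF f])
qed

lemma functionals_dual_topology:
  assumes "vect D = lspace P" "topol D \<in> dual_topologies P"
  shows "functionals (to_chu D) = functionals P" "D \<in> TVS"
proof -
  have D: "D = \<lparr>vect = lspace P, topol = topol D\<rparr>" using assms(1) by (cases D) simp
  show "functionals (to_chu D) = functionals P"
    using functionals_to_chu_dual_topology[OF assms(2)] D by simp
  show "D \<in> TVS" using assms(2) by (subst D) (simp add: dual_topologies_def)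
qed

text \<open>The common part of the weak and the Mackey case: \<open>D\<close> is the dual of
  \<open>B\<close> with some dual topology. The cases differ in why morphisms of triples are
  continuous, which is recorded as \<open>hom_continuous\<close>.\<close>

locale tensor_duality =
  fixes A :: "('k::real_or_complex, 'v) tvs" and B :: "('k, 'w) tvs" and D :: "('k, 'w \<Rightarrow> 'k) tvs"
  assumes A: "A \<in> TVS" and B: "B \<in> TVS"
    and vect_D: "vect D = topological_dual B"
    and topol_D: "topol D \<in> dual_topologies (chu_dual (to_chu B))"
    and hom_continuous: "(f, g) \<in> chu_homs (to_chu A) (to_chu D) \<Longrightarrow> continuous_map (topol A) (topol D) f"
begin

abbreviation "hom_pair \<equiv> chu_internal_hom (to_chu A) (to_chu D)"

abbreviation "tensor_pair \<equiv>
  \<lparr>lspace = tensor_space (vect A) (vect B), rspace = L A D,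
   pairing = \<lambda>t f. tensor_lift (\<lambda>v w. f v w) t\<rparr>"

text \<open>The canonical map from \<open>B\<close> to the dual of \<open>D\<close>. It is onto
  since the topology of \<open>D\<close> is dual for the pairing with \<open>B\<close>
  (\<open>carrier_dual_D\<close>).\<close>

definition ev :: "'w \<Rightarrow> ('w \<Rightarrow> 'k) \<Rightarrow> 'k" where
  "ev w = (\<lambda>\<phi>\<in>carrier (topological_dual B). \<phi> w)"

lemma vect_D': "vect D = lspace (chu_dual (to_chu B))"
  by (simp add: vect_D chu_dual_def to_chu_def)

lemmas D = functionals_dual_topology(2)[OF vect_D' topol_D]
lemmas functionals_D = functionals_dual_topology(1)[OF vect_D' topol_D]

lemma carrier_dual_D: "carrier (topological_dual D) = ev ` carrier (vect B)"
  using functionals_D unfolding functionals_to_chu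
  by (simp add: functionals_def chu_dual_def to_chu_def curry_right_def ev_def image_def)

sublocale A: tvs A by unfold_locales (rule A)
sublocale B: tvs B by unfold_locales (rule B)
sublocale D: tvs D by unfold_locales (rule D)
sublocale X: tensor "vect A" "vect B"
  by unfold_locales (rule A.vector_space, rule B.vector_space)
sublocale Y: tensor "vect A" "topological_dual D"
  by unfold_locales (rule A.vector_space, rule topological_dual_vector_space[OF D])

lemma chu_homs_iff:
  "(f, g) \<in> chu_homs (to_chu A) (to_chu D) \<longleftrightarrow>
     f \<in> linear_maps (vect A) (vect D) \<and> g \<in> linear_maps (topological_dual D) (topological_dual A) \<and>
     (\<forall>v\<in>carrier (vect A). \<forall>\<psi>\<in>carrier (topological_dual D). \<psi> (f v) = g \<psi> v)"
  by (simp add: chu_homs_def to_chu_def)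

lemma fst_chu_homs:
  assumes "h \<in> chu_homs (to_chu A) (to_chu D)"
  shows "fst h \<in> carrier (L A D)"
proof -
  obtain f g where h: "h = (f, g)" by (cases h)
  show ?thesis
    using assms hom_continuous[of f g] unfolding h L_carrier continuous_linear_maps_def chu_homs_iff by simp
qed

text \<open>The transpose sends \<psi> to \<psi> o f, continuous as a composite. Together with
  \<open>fst_chu_homs\<close> this identifies morphisms of triples with continuous linear
  maps.\<close>

lemma transpose_chu_homs:
  assumes f: "f \<in> carrier (L A D)"
  obtains g where "(f, g) \<in> chu_homs (to_chu A) (to_chu D)"
proof -
  have f': "f \<in> linear_maps (vect A) (vect D)" "continuous_map (topol A) (topol D) f"
    using f by (simp_all add: L_carrier continuous_linear_maps_def)
  define g where "g = (\<lambda>\<psi>\<in>carrier (topological_dual D). \<lambda>v\<in>carrier (vect A). \<psi> (f v))"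
  have "g \<in> linear_maps (topological_dual D) (topological_dual A)"
  proof (rule linear_mapsI)
    fix \<psi> assume \<psi>: "\<psi> \<in> carrier (topological_dual D)"
    note \<psi>' = topological_dual_linear[OF \<psi>]
    have "continuous_map (topol D) euclidean \<psi>"
      using \<psi> by (simp add: topological_dual_def L_carrier continuous_linear_maps_def scalars_tvs_def)
    from continuous_map_compose[OF f'(2) this]
    have "continuous_map (topol A) euclidean (g \<psi>)"
      by (rule continuous_map_eq) (simp add: g_def \<psi> A.topspace_eq)
    moreover have "g \<psi> \<in> linear_maps (vect A) scalars"
      by (rule linear_mapsI)
        (simp_all add: g_def \<psi> linear_maps_add[OF f'(1)] linear_maps_scale[OF f'(1)]
          linear_maps_closed[OF f'(1)] linear_maps_add[OF \<psi>'] linear_maps_scale[OF \<psi>'])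
    ultimately show "g \<psi> \<in> carrier (topological_dual A)"
      by (simp add: topological_dual_def L_carrier continuous_linear_maps_def scalars_tvs_def)
  qed (auto simp: g_def linear_maps_closed[OF f'(1)] Y.W.add_closed[simplified] Y.W.smult_closed[simplified]
      intro!: restrict_ext)
  then have "(f, g) \<in> chu_homs (to_chu A) (to_chu D)"
    unfolding chu_homs_iff using f'(1) by (simp add: g_def)
  then show thesis by (rule that)
qed

lemma bilinear_on_L:
  assumes "f \<in> carrier (L A D)"
  shows "bilinear_on (vect A) (vect B) f"
proof -
  have f: "f \<in> linear_maps (vect A) (topological_dual B)"
    using assms vect_D by (simp add: L_carrier continuous_linear_maps_def)
  note fv = topological_dual_linear[OF linear_maps_closed[OF f]]
  show ?thesis
    unfolding bilinear_on_def
    by (simp add: linear_maps_add[OF f] linear_maps_scale[OF f] linear_maps_add[OF fv] linear_maps_scale[OF fv])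
qed

lemma bilinear_on_hom:
  assumes f: "f \<in> linear_maps (vect A) (vect D)"
  shows "bilinear_on (vect A) (topological_dual D) (\<lambda>v \<psi>. \<psi> (f v))"
  unfolding bilinear_on_def
  by (simp add: linear_maps_add[OF f] linear_maps_scale[OF f] linear_maps_closed[OF f]
      linear_maps_add[OF topological_dual_linear] linear_maps_scale[OF topological_dual_linear])

lemma hom_pair_chu: "hom_pair \<in> chu"
  by (rule chu_internal_hom_chu[OF to_chu_chu[OF A] to_chu_chu[OF D]])

lemma L_ops:
  "\<zero>\<^bsub>L A D\<^esub> = (\<lambda>x\<in>carrier (vect A). \<zero>\<^bsub>topological_dual B\<^esub>)"
  "f \<oplus>\<^bsub>L A D\<^esub> g = (\<lambda>x\<in>carrier (vect A). f x \<oplus>\<^bsub>topological_dual B\<^esub> g x)"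
  "c \<odot>\<^bsub>L A D\<^esub> f = (\<lambda>x\<in>carrier (vect A). c \<odot>\<^bsub>topological_dual B\<^esub> f x)"
  by (simp_all add: L_def vect_D)

text \<open>An instance of \<open>tensor_chu\<close> in which the two topological duals provide the
  separating functionals.\<close>

lemma tensor_pair_chu: "tensor_pair \<in> chu"
proof (rule X.tensor_chu[where A = "carrier (topological_dual A)" and C = "carrier (topological_dual B)"])
  show "L A D \<in> vector_spaces" by (rule L_vector_space[OF A D])
  fix f assume f: "f \<in> carrier (L A D)"
    and zero: "\<And>v w. v \<in> carrier (vect A) \<Longrightarrow> w \<in> carrier (vect B) \<Longrightarrow> f v w = 0"
  have f': "f \<in> linear_maps (vect A) (topological_dual B)"
    using f vect_D by (simp add: L_carrier continuous_linear_maps_def)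
  have "f v = (\<lambda>w\<in>carrier (vect B). 0)" if v: "v \<in> carrier (vect A)" for v
    by (rule extensionalityI[OF linear_maps_extensional[OF topological_dual_linear[OF linear_maps_closed[OF f' v]]]])
      (simp_all add: zero[OF v])
  then show "f = \<zero>\<^bsub>L A D\<^esub>"
    unfolding L_ops by (intro extensionalityI[OF linear_maps_extensional[OF f']]) simp_all
next
  fix \<alpha> \<beta> assume \<alpha>: "\<alpha> \<in> carrier (topological_dual A)" and \<beta>: "\<beta> \<in> carrier (topological_dual B)"
  note \<alpha>' = topological_dual_linear[OF \<alpha>]
  have \<beta>': "\<beta> \<in> carrier (vect D)" using \<beta> by (simp add: vect_D)
  \<comment> \<open>The map v -> \<alpha> (v) \<beta> realises the rank-one form; it is continuous
    because scalar multiplication on \<open>D\<close> is.\<close>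
  define f where "f = (\<lambda>v\<in>carrier (vect A). \<alpha> v \<odot>\<^bsub>vect D\<^esub> \<beta>)"
  have "f \<in> linear_maps (vect A) (vect D)"
    by (rule linear_mapsI)
      (simp_all add: f_def linear_maps_add[OF \<alpha>'] linear_maps_scale[OF \<alpha>'] D.smult_add_left \<beta>')
  moreover have "continuous_map (topol A) (topol D) f"
  proof -
    have "continuous_map (topol A) euclidean \<alpha>"
      using \<alpha> by (simp add: topological_dual_def L_carrier continuous_linear_maps_def scalars_tvs_def)
    then have "continuous_map (topol A) (prod_topology euclidean (topol D)) (\<lambda>v. (\<alpha> v, \<beta>))"
      using \<beta>' by (intro continuous_map_pairedI) (simp_all add: D.topspace_eq)
    from continuous_map_compose[OF this D.continuous_smult] show ?thesis
      by (rule continuous_map_eq) (simp add: f_def A.topspace_eq)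
  qed
  ultimately have "f \<in> carrier (L A D)" by (simp add: L_carrier continuous_linear_maps_def)
  then show "\<exists>h\<in>carrier (L A D). \<forall>v\<in>carrier (vect A). \<forall>w\<in>carrier (vect B). h v w = \<alpha> v * \<beta> w"
    by (rule bexI[rotated]) (simp add: f_def vect_D)
next
  show "\<exists>\<beta>\<in>carrier (topological_dual B). \<beta> w \<noteq> 0" if "w \<in> carrier (vect B)" "w \<noteq> \<zero>\<^bsub>vect B\<^esub>" for w
    by (rule topological_dual_separating[OF B that])
  show "\<exists>\<alpha>\<in>carrier (topological_dual A). \<alpha> v \<noteq> 0" if "v \<in> carrier (vect A)" "v \<noteq> \<zero>\<^bsub>vect A\<^esub>" for v
    by (rule topological_dual_separating[OF A that])
qed (auto simp: L_ops bilinear_on_L intro: topological_dual_linear)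

text \<open>The functionals on the hom space come from the tensor product of \<open>A\<close> with
  the dual of \<open>D\<close>. Starting directly from the tensor product of \<open>A\<close> with
  \<open>B\<close> avoids constructing the induced map id \<otimes> \<open>ev\<close> between tensor
  spaces.\<close>

definition comparison :: "('k, 'v, 'w) tensor \<Rightarrow> ('v \<Rightarrow> 'w \<Rightarrow> 'k) \<times> ((('w \<Rightarrow> 'k) \<Rightarrow> 'k) \<Rightarrow> 'v \<Rightarrow> 'k) \<Rightarrow> 'k" where
  "comparison = (\<lambda>t\<in>carrier X.T.
     \<lambda>h\<in>chu_homs (to_chu A) (to_chu D). tensor_lift (fst h) t)"

text \<open>Compatibility with id \<otimes> \<open>ev\<close>, expressed on lists of summands: both
  sides evaluate f at v and then at w.\<close>

lemma comparison_tens: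
  assumes ts: "set ts \<subseteq> carrier (vect A) \<times> carrier (vect B)"
  shows "comparison (X.tens ts) = curry_right hom_pair (Y.tens (map (\<lambda>(v, w). (v, ev w)) ts))"
proof -
  let ?us = "map (\<lambda>(v, w). (v, ev w)) ts"
  have us: "set ?us \<subseteq> carrier (vect A) \<times> carrier (topological_dual D)"
    using ts by (auto simp: carrier_dual_D)
  have "tensor_lift f (X.tens ts) = tensor_lift (\<lambda>v \<psi>. \<psi> (f v)) (Y.tens ?us)"
    if h: "(f, g) \<in> chu_homs (to_chu A) (to_chu D)" for f g
  proof -
    have L: "f \<in> carrier (L A D)" using fst_chu_homs[OF h] by simp
    have f: "f \<in> linear_maps (vect A) (vect D)" using h by (simp add: chu_homs_iff)
    have "(\<Sum>(v, w)\<leftarrow>ts. f v w) = (\<Sum>(v, \<psi>)\<leftarrow>?us. \<psi> (f v))"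
      using ts
    proof (induction ts)
      case (Cons a ts)
      obtain v w where a: "a = (v, w)" by (cases a)
      have "f v \<in> carrier (topological_dual B)"
        using Cons.prems linear_maps_closed[OF f, of v] by (simp add: a vect_D)
      then show ?case using Cons by (simp add: a ev_def)
    qed simp
    then show ?thesis
      unfolding X.lift_tens[OF bilinear_on_L[OF L] ts] Y.lift_tens[OF bilinear_on_hom[OF f] us] .
  qed
  moreover have "Y.tens ?us \<in> carrier Y.T" by (rule Y.tens_closed[OF us])
  ultimately show ?thesis
    unfolding comparison_def curry_right_def using X.tens_closed[OF ts]
    by (auto simp: chu_internal_hom_def chu_hom_space_simps to_chu_def intro!: restrict_ext)
qed

text \<open>Each functional on \<open>D\<close> is an evaluation, so a list of summands over the
  dual of \<open>D\<close> lifts entry by entry to one over \<open>B\<close>.\<close>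

lemma comparison_image:
  "comparison ` carrier X.T = functionals hom_pair"
proof
  show "comparison ` carrier X.T \<subseteq> functionals hom_pair"
  proof
    fix l assume "l \<in> comparison ` carrier X.T"
    then obtain t where t: "t \<in> carrier X.T" "l = comparison t" by blast
    obtain ts where ts: "set ts \<subseteq> carrier (vect A) \<times> carrier (vect B)" "t = X.tens ts"
      using t(1) by (rule X.tensE)
    have "set (map (\<lambda>(v, w). (v, ev w)) ts) \<subseteq> carrier (vect A) \<times> carrier (topological_dual D)"
      using ts(1) by (auto simp: carrier_dual_D)
    then show "l \<in> functionals hom_pair"
      unfolding t(2) ts(2) comparison_tens[OF ts(1)] functionals_def
      using Y.tens_closed by (simp add: chu_internal_hom_def to_chu_def)
  qed
  show "functionals hom_pair \<subseteq> comparison ` carrier X.T"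
  proof
    fix l assume "l \<in> functionals hom_pair"
    then obtain t where t: "t \<in> carrier Y.T" "l = curry_right hom_pair t"
      unfolding functionals_def by (auto simp: chu_internal_hom_def to_chu_def)
    obtain us where us: "set us \<subseteq> carrier (vect A) \<times> carrier (topological_dual D)" "t = Y.tens us"
      using t(1) by (rule Y.tensE)
    have "\<exists>ts. set ts \<subseteq> carrier (vect A) \<times> carrier (vect B) \<and> us = map (\<lambda>(v, w). (v, ev w)) ts"
      using us(1)
    proof (induction us)
      case (Cons a us)
      then obtain ts where ts: "set ts \<subseteq> carrier (vect A) \<times> carrier (vect B)" "us = map (\<lambda>(v, w). (v, ev w)) ts"
        by auto
      obtain v w where "a = (v, ev w)" "v \<in> carrier (vect A)" "w \<in> carrier (vect B)"
        using Cons.prems by (auto simp: carrier_dual_D)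
      then show ?case using ts by (intro exI[of _ "(v, w) # ts"]) simp
    qed simp
    then obtain ts where ts: "set ts \<subseteq> carrier (vect A) \<times> carrier (vect B)" "us = map (\<lambda>(v, w). (v, ev w)) ts"
      by blast
    have "l = comparison (X.tens ts)"
      unfolding t(2) us(2) ts(2) comparison_tens[OF ts(1)] ..
    then show "l \<in> comparison ` carrier X.T"
      using X.tens_closed[OF ts(1)] by blast
  qed
qed

lemma comparison_apply:
  assumes "t \<in> carrier X.T" "(f, g) \<in> chu_homs (to_chu A) (to_chu D)"
  shows "comparison t (f, g) = tensor_lift f t"
  using assms by (simp add: comparison_def)

text \<open>Every continuous linear map is the first component of a morphism, so
  \<open>comparison t\<close> determines the pairings of t with all of \<open>L A D\<close>, and
  \<open>tensor_pair\<close> is nondegenerate.\<close>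

lemma inj_on_comparison: "inj_on comparison (carrier X.T)"
proof (rule inj_onI)
  fix s t assume st: "s \<in> carrier X.T" "t \<in> carrier X.T" "comparison s = comparison t"
  have "tensor_lift f s = tensor_lift f t" if f: "f \<in> carrier (L A D)" for f
  proof -
    obtain g where g: "(f, g) \<in> chu_homs (to_chu A) (to_chu D)" using f by (rule transpose_chu_homs)
    show ?thesis using comparison_apply[OF st(1) g] comparison_apply[OF st(2) g] st(3) by simp
  qed
  then have "curry_left tensor_pair s = curry_left tensor_pair t"
    using st by (auto simp: curry_left_def intro!: restrict_ext)
  moreover have "inj_on (curry_left tensor_pair) (carrier X.T)"
    using tensor_pair_chu by (simp add: chu_def)
  ultimately show "s = t" using st by (auto dest: inj_onD)
qed

text \<open>All dual topologies on the hom space have the same continuous functionals, so the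
  comparison can be carried out for an arbitrary one.\<close>

context
  fixes T
  assumes T: "T \<in> dual_topologies hom_pair"
begin

abbreviation "hom_tvs \<equiv> \<lparr>vect = lspace hom_pair, topol = T\<rparr>"

lemma hom_tvs_TVS: "hom_tvs \<in> TVS"
  using T by (simp add: dual_topologies_def)

lemma carrier_hom_tvs: "carrier (vect hom_tvs) = chu_homs (to_chu A) (to_chu D)"
  by (simp add: chu_internal_hom_def chu_hom_space_simps)

lemma carrier_dual_hom_tvs: "carrier (topological_dual hom_tvs) = functionals hom_pair"
  using functionals_to_chu_dual_topology[OF T] by (simp add: functionals_to_chu)

lemma bij_comparison:
  "bij_betw comparison (carrier X.T) (carrier (topological_dual hom_tvs))"
  unfolding bij_betw_def carrier_dual_hom_tvs using inj_on_comparison comparison_image by blast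

lemma comparison_linear:
  "comparison \<in> linear_maps X.T (topological_dual hom_tvs)"
proof (rule linear_mapsI)
  show "comparison t \<in> carrier (topological_dual hom_tvs)" if "t \<in> carrier X.T" for t
    using bij_betwE[OF bij_comparison] that by simp
  have bil: "bilinear_on (vect A) (vect B) (fst h)" if "h \<in> chu_homs (to_chu A) (to_chu D)" for h
    by (rule bilinear_on_L[OF fst_chu_homs[OF that]])
  show "comparison (s \<oplus>\<^bsub>X.T\<^esub> t) = comparison s \<oplus>\<^bsub>topological_dual hom_tvs\<^esub> comparison t"
    if "s \<in> carrier X.T" "t \<in> carrier X.T" for s t
    unfolding topological_dual_ops carrier_hom_tvs
    using that by (simp add: comparison_def) (rule restrict_ext, simp add: X.lift_add[OF bil])
  show "comparison (c \<odot>\<^bsub>X.T\<^esub> t) = c \<odot>\<^bsub>topological_dual hom_tvs\<^esub> comparison t"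
    if "t \<in> carrier X.T" for c t
    unfolding topological_dual_ops carrier_hom_tvs
    using that by (simp add: comparison_def) (rule restrict_ext, simp add: X.lift_scale[OF bil])
qed (simp add: comparison_def)

abbreviation "dual_hom_pair \<equiv> chu_dual (to_chu hom_tvs)"

lemma lspace_dual_hom_pair: "lspace dual_hom_pair = topological_dual hom_tvs"
  by (simp add: chu_dual_def to_chu_def)

lemma dual_hom_pair_chu: "dual_hom_pair \<in> chu"
  by (rule chu_dual_chu[OF to_chu_chu[OF hom_tvs_TVS]])

lemma functionals_dual_hom_pair:
  "functionals dual_hom_pair =
     (\<lambda>h. \<lambda>l\<in>carrier (topological_dual hom_tvs). l h) ` chu_homs (to_chu A) (to_chu D)"
  unfolding functionals_def
  by (simp add: curry_right_def chu_dual_def to_chu_def chu_internal_hom_def chu_hom_space_simps cong: image_cong)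

lemma functionals_tensor_pair:
  "functionals tensor_pair = (\<lambda>f. \<lambda>t\<in>carrier X.T. tensor_lift f t) ` carrier (L A D)"
  unfolding functionals_def by (simp add: curry_right_def cong: image_cong)

text \<open>Evaluation at a morphism corresponds to the lift of its first component. With
  \<open>transpose_comparison_inv\<close> this shows that the comparison matches the functionals on
  both sides.\<close>

lemma transpose_comparison:
  assumes "\<psi> \<in> functionals dual_hom_pair"
  shows "(\<lambda>t\<in>carrier X.T. \<psi> (comparison t)) \<in> functionals tensor_pair"
proof -
  obtain h where h: "h \<in> chu_homs (to_chu A) (to_chu D)" "\<psi> = (\<lambda>l\<in>carrier (topological_dual hom_tvs). l h)"
    using assms unfolding functionals_dual_hom_pair by blast
  have "(\<lambda>t\<in>carrier X.T. \<psi> (comparison t)) = (\<lambda>t\<in>carrier X.T. tensor_lift (fst h) t)"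
  proof (rule restrict_ext)
    fix t assume t: "t \<in> carrier X.T"
    show "\<psi> (comparison t) = tensor_lift (fst h) t"
      using t bij_betwE[OF bij_comparison] h by (simp add: comparison_def)
  qed
  then show ?thesis
    unfolding functionals_tensor_pair using fst_chu_homs[OF h(1)] by blast
qed

definition "comparison_inv = restrict (inv_into (carrier X.T) comparison) (carrier (topological_dual hom_tvs))"

lemma comparison_inverse:
  "t \<in> carrier X.T \<Longrightarrow> comparison_inv (comparison t) = t"
  "l \<in> carrier (topological_dual hom_tvs) \<Longrightarrow> comparison (comparison_inv l) = l"
  "l \<in> carrier (topological_dual hom_tvs) \<Longrightarrow> comparison_inv l \<in> carrier X.T"
proof -
  show "comparison_inv (comparison t) = t" if "t \<in> carrier X.T"
    using that bij_comparison bij_betwE[OF bij_comparison] by (simp add: comparison_inv_def bij_betw_inv_into_left)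
  show *: "comparison_inv l \<in> carrier X.T" if "l \<in> carrier (topological_dual hom_tvs)"
    using that bij_betwE[OF bij_betw_inv_into[OF bij_comparison]] by (simp add: comparison_inv_def)
  show "comparison (comparison_inv l) = l" if "l \<in> carrier (topological_dual hom_tvs)"
    using that *[OF that] bij_comparison by (simp add: comparison_inv_def bij_betw_inv_into_right)
qed

lemma comparison_inv_linear:
  "comparison_inv \<in> linear_maps (topological_dual hom_tvs) X.T"
  unfolding comparison_inv_def
  by (rule inverse_linear_map[OF X.tensor_vector_space comparison_linear bij_comparison])

lemma transpose_comparison_inv:
  assumes "\<psi> \<in> functionals tensor_pair"
  shows "(\<lambda>l\<in>carrier (topological_dual hom_tvs). \<psi> (comparison_inv l)) \<in> functionals dual_hom_pair"
proof -
  obtain f where f: "f \<in> carrier (L A D)" "\<psi> = (\<lambda>t\<in>carrier X.T. tensor_lift f t)"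
    using assms unfolding functionals_tensor_pair by blast
  obtain g where g: "(f, g) \<in> chu_homs (to_chu A) (to_chu D)" using f(1) by (rule transpose_chu_homs)
  have "(\<lambda>l\<in>carrier (topological_dual hom_tvs). \<psi> (comparison_inv l)) =
      (\<lambda>l\<in>carrier (topological_dual hom_tvs). l (f, g))"
  proof (rule restrict_ext)
    fix l assume l: "l \<in> carrier (topological_dual hom_tvs)"
    have "l (f, g) = comparison (comparison_inv l) (f, g)"
      using comparison_inverse(2,3)[OF l] by simp
    then show "\<psi> (comparison_inv l) = l (f, g)"
      using comparison_inverse(3)[OF l] comparison_apply[OF _ g] by (simp add: f(2))
  qed
  then show ?thesis
    unfolding functionals_dual_hom_pair using g by blast
qed

text \<open>The last two hypotheses have the shape of \<open>weak_topology_functorial\<close> and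
  \<open>mackey_topology_functorial\<close>, so that one proof covers both choices of
  topology.\<close>

lemma tensor_isomorphic:
  assumes "\<lparr>vect = topological_dual hom_tvs, topol = S\<rparr> \<in> TVS"
    and "\<lparr>vect = X.T, topol = S'\<rparr> \<in> TVS"
    and cont: "\<And>f. f \<in> linear_maps (lspace dual_hom_pair) (lspace tensor_pair) \<Longrightarrow>
      (\<And>\<psi>. \<psi> \<in> functionals tensor_pair \<Longrightarrow>
        (\<lambda>x\<in>carrier (lspace dual_hom_pair). \<psi> (f x)) \<in> functionals dual_hom_pair) \<Longrightarrow>
      continuous_map S S' f"
    and cont': "\<And>f. f \<in> linear_maps (lspace tensor_pair) (lspace dual_hom_pair) \<Longrightarrow>
      (\<And>\<psi>. \<psi> \<in> functionals dual_hom_pair \<Longrightarrow>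
        (\<lambda>x\<in>carrier (lspace tensor_pair). \<psi> (f x)) \<in> functionals tensor_pair) \<Longrightarrow>
      continuous_map S' S f"
  shows "\<lparr>vect = topological_dual hom_tvs, topol = S\<rparr> \<cong>\<^sub>T\<^sub>V\<^sub>S \<lparr>vect = X.T, topol = S'\<rparr>"
  unfolding tvs_isomorphic_def
proof (intro conjI bexI[of _ comparison_inv] bexI[of _ comparison])
  have "continuous_map S S' comparison_inv"
    by (rule cont) (use comparison_inv_linear transpose_comparison_inv in \<open>simp_all add: lspace_dual_hom_pair\<close>)
  then show "comparison_inv \<in> continuous_linear_maps \<lparr>vect = topological_dual hom_tvs, topol = S\<rparr>
      \<lparr>vect = X.T, topol = S'\<rparr>"
    using comparison_inv_linear by (simp add: continuous_linear_maps_def)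
  have "continuous_map S' S comparison"
    by (rule cont') (use comparison_linear transpose_comparison in \<open>simp_all add: lspace_dual_hom_pair\<close>)
  then show "comparison \<in> continuous_linear_maps
      \<lparr>vect = X.T, topol = S'\<rparr> \<lparr>vect = topological_dual hom_tvs, topol = S\<rparr>"
    using comparison_linear by (simp add: continuous_linear_maps_def)
qed (use assms(1,2) comparison_inverse in simp_all)

end

end

section \<open>The weak and the Mackey case\<close>

lemma tensor_w_eq:
  "V \<otimes>\<^sub>w W = weak_space (chu_dual (to_chu \<lparr>vect = lspace (chu_internal_hom (to_chu V) (to_chu (weak_dual W))),
     topol = \<sigma> (chu_internal_hom (to_chu V) (to_chu (weak_dual W)))\<rparr>))"
proof -
  have "D_w W = weak_dual W"
    by (simp add: D_w_def weak_space_def weak_dual_def chu_dual_def to_chu_def)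
  then show ?thesis
    \<comment> \<open>The instantiated equations unfold only the inner hom space and the outer dual,
      so the outermost \<open>weak_space\<close> stays folded.\<close>
    unfolding tensor_w_def by (simp only: Hom_w_def weak_space_def[of "chu_internal_hom _ _"] D_w_def[of "\<lparr>vect = _, topol = _\<rparr>"])
qed

lemma tensor_m_eq:
  "V \<otimes>\<^sub>m W = mackey_space (chu_dual (to_chu \<lparr>vect = lspace (chu_internal_hom (to_chu V) (to_chu (mackey_dual W))),
     topol = \<tau> (chu_internal_hom (to_chu V) (to_chu (mackey_dual W)))\<rparr>))"
proof -
  have "D_m W = mackey_dual W"
    by (simp add: D_m_def mackey_space_def mackey_dual_def chu_dual_def to_chu_def)
  then show ?thesis
    unfolding tensor_m_def by (simp only: Hom_m_def mackey_space_def[of "chu_internal_hom _ _"] D_m_def[of "\<lparr>vect = _, topol = _\<rparr>"])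
qed

lemma dual_to_chu_eq:
  "chu_dual (to_chu W) = \<lparr>lspace = topological_dual W, rspace = vect W, pairing = \<lambda>f v. f v\<rparr>"
  by (simp add: chu_dual_def to_chu_def)

lemma tensor_duality_weak:
  assumes V: "V \<in> TVS_w" and W: "W \<in> TVS"
  shows "tensor_duality V W (weak_dual W)"
proof
  let ?P = "chu_dual (to_chu W)" and ?D = "weak_dual W"
  show V': "V \<in> TVS" using V by (simp add: TVS_w_def)
  show "W \<in> TVS" by (rule W)
  show vect: "vect ?D = topological_dual W" by (simp add: weak_dual_def)
  have lspace: "vect ?D = lspace ?P" by (simp add: vect dual_to_chu_eq)
  have P: "?P \<in> chu" by (rule chu_dual_chu[OF to_chu_chu[OF W]])
  have topol: "topol ?D = \<sigma> ?P" by (simp add: weak_dual_def dual_to_chu_eq)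
  show dual: "topol ?D \<in> dual_topologies ?P"
    unfolding topol by (rule weak_topology_eq(2)[OF P])
  have D: "to_chu ?D \<in> chu" by (rule to_chu_chu[OF functionals_dual_topology(2)[OF lspace dual]])
  \<comment> \<open>The topology of \<open>?D\<close> is defined by the pairing with
    \<open>W\<close>, whereas morphisms into \<open>to_chu ?D\<close> refer to the pairing with the
    dual of \<open>?D\<close>. Both have the same functionals, hence the same weak topology.\<close>
  have topol': "topol ?D = \<sigma> (to_chu ?D)"
    unfolding topol weak_topology_eq(1)[OF P] weak_topology_eq(1)[OF D] functionals_dual_topology(1)[OF lspace dual]
    by (simp add: to_chu_def lspace[unfolded to_chu_def])
  fix f g assume h: "(f, g) \<in> chu_homs (to_chu V) (to_chu ?D)"
  have "continuous_map (\<sigma> (to_chu V)) (\<sigma> (to_chu ?D)) f"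
    by (rule weak_topology_functorial[OF to_chu_chu[OF V'] D _ chu_homs_transpose[OF h]])
      (use h in \<open>simp add: chu_homs_def\<close>)
  then show "continuous_map (topol V) (topol ?D) f"
    using V topol' by (simp add: TVS_w_def)
qed

lemma tensor_duality_mackey:
  assumes V: "V \<in> TVS_m" and W: "W \<in> TVS"
  shows "tensor_duality V W (mackey_dual W)"
proof
  let ?P = "chu_dual (to_chu W)" and ?D = "mackey_dual W"
  show V': "V \<in> TVS" using V by (simp add: TVS_m_def)
  show "W \<in> TVS" by (rule W)
  show vect: "vect ?D = topological_dual W" by (simp add: mackey_dual_def)
  have lspace: "vect ?D = lspace ?P" by (simp add: vect dual_to_chu_eq)
  have P: "?P \<in> chu" by (rule chu_dual_chu[OF to_chu_chu[OF W]])
  have topol: "topol ?D = \<tau> ?P" by (simp add: mackey_dual_def dual_to_chu_eq)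
  show dual: "topol ?D \<in> dual_topologies ?P"
    unfolding topol by (rule mackey_topology_eq(2)[OF P])
  have D: "to_chu ?D \<in> chu" by (rule to_chu_chu[OF functionals_dual_topology(2)[OF lspace dual]])
  have topol': "topol ?D = \<tau> (to_chu ?D)"
    unfolding topol mackey_topology_eq(1)[OF P] mackey_topology_eq(1)[OF D] functionals_dual_topology(1)[OF lspace dual]
    by (simp add: to_chu_def lspace[unfolded to_chu_def])
  fix f g assume h: "(f, g) \<in> chu_homs (to_chu V) (to_chu ?D)"
  have "continuous_map (\<tau> (to_chu V)) (\<tau> (to_chu ?D)) f"
    by (rule mackey_topology_functorial[OF to_chu_chu[OF V'] D _ chu_homs_transpose[OF h]])
      (use h in \<open>simp add: chu_homs_def\<close>)
  then show "continuous_map (topol V) (topol ?D) f"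
    using V topol' by (simp add: TVS_m_def)
qed

theorem lemma4p3p5:
  fixes V :: "('k::real_or_complex, 'v) tvs" and W :: "('k, 'w) tvs"
  shows
    "(V \<in> TVS_w \<and> W \<in> TVS_w \<longrightarrow>
       V \<otimes>\<^sub>w W \<cong>\<^sub>T\<^sub>V\<^sub>S
         \<lparr>vect = tensor_space (vect V) (vect W),
          topol = \<sigma> \<lparr>lspace = tensor_space (vect V) (vect W),
                     rspace = L V (weak_dual W),
                     pairing = (\<lambda>t f. tensor_lift (\<lambda>v w. f v w) t)\<rparr>\<rparr>) \<and>
     (V \<in> TVS_m \<and> W \<in> TVS_m \<longrightarrow>
       V \<otimes>\<^sub>m W \<cong>\<^sub>T\<^sub>V\<^sub>S
         \<lparr>vect = tensor_space (vect V) (vect W),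
          topol = \<tau> \<lparr>lspace = tensor_space (vect V) (vect W),
                     rspace = L V (mackey_dual W),
                     pairing = (\<lambda>t f. tensor_lift (\<lambda>v w. f v w) t)\<rparr>\<rparr>)"
proof (intro conjI impI)
  assume VW: "V \<in> TVS_w \<and> W \<in> TVS_w"
  interpret tensor_duality V W "weak_dual W"
    by (rule tensor_duality_weak) (use VW in \<open>simp_all add: TVS_w_def\<close>)
  note dual = weak_topology_eq(2)[OF hom_pair_chu]
  \<comment> \<open>Taken in this order the two facts give continuity of the inverse comparison, in
    the opposite order that of the comparison.\<close>
  note chu = dual_hom_pair_chu[OF dual] tensor_pair_chu
  show "V \<otimes>\<^sub>w W \<cong>\<^sub>T\<^sub>V\<^sub>S \<lparr>vect = tensor_space (vect V) (vect W), topol = \<sigma> tensor_pair\<rparr>"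
    unfolding tensor_w_eq weak_space_def[of "chu_dual _"] lspace_dual_hom_pair[OF dual]
    by (rule tensor_isomorphic[OF dual _ _ weak_topology_functorial[OF chu] weak_topology_functorial[OF chu(2,1)]])
      (use weak_space_TVS[OF chu(1)] weak_space_TVS[OF chu(2)] in
        \<open>simp_all add: weak_space_def lspace_dual_hom_pair[OF dual]\<close>)
next
  assume VW: "V \<in> TVS_m \<and> W \<in> TVS_m"
  interpret tensor_duality V W "mackey_dual W"
    by (rule tensor_duality_mackey) (use VW in \<open>simp_all add: TVS_m_def\<close>)
  note dual = mackey_topology_eq(2)[OF hom_pair_chu]
  note chu = dual_hom_pair_chu[OF dual] tensor_pair_chu
  show "V \<otimes>\<^sub>m W \<cong>\<^sub>T\<^sub>V\<^sub>S \<lparr>vect = tensor_space (vect V) (vect W), topol = \<tau> tensor_pair\<rparr>"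
    unfolding tensor_m_eq mackey_space_def[of "chu_dual _"] lspace_dual_hom_pair[OF dual]
    by (rule tensor_isomorphic[OF dual _ _ mackey_topology_functorial[OF chu] mackey_topology_functorial[OF chu(2,1)]])
      (use mackey_space_TVS[OF chu(1)] mackey_space_TVS[OF chu(2)] in
        \<open>simp_all add: mackey_space_def lspace_dual_hom_pair[OF dual]\<close>)
qed

end
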